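(* Let $n\ge 3$, $R\ge 1$ and $\ell$ be integers with $\ell>\max\{n+1,\frac n2+4\}$. Let $\mathbf{x}_0\in\mathbb{R}^n$ and let $f_1,\dots,f_R\in\mathcal{C}^{\ell}(\mathbb{R}^n)$ be real-valued functions such that for every $\mathbf{t}=(t_1,\dots,t_R)\in\mathbb{R}^R\setminus\{\mathbf 0\}$ $$\operatorname{rank} H_{t_1f_1+\cdots+t_Rf_R}(\mathbf{x}_0)\ge n-1 .$$ Suppose that $\varepsilon_0>0$ is sufficiently small (in terms of $n,R,\mathbf{x}_0,f_1,\dots,f_R$) and let $\mathscr{M}=\{(\mathbf{x},f_1(\mathbf{x}),\dots,f_R(\mathbf{x})):\mathbf{x}\in\overline{B_{\varepsilon_0}(\mathbf{x}_0)}\}\subset\mathbb{R}^{n+R}$. Then there exists a constant $c_{\mathscr{M}}>0$ depending only on $\mathscr{M}$ such that for every sufficiently small $\epsilon>0$ $$N(\mathscr{M};Q,\delta)\sim c_{\mathscr{M}}\,\delta^R\,Q^{\dim\mathscr{M}+1}\qquad\text{as } Q\to\infty,$$ uniformly for $Q^{-\frac{n-1}{n+2R-1}+\epsilon}\le\delta\le\frac12$ (i.e. the ratio of the two sides tends to $1$ as $Q\to\infty$, uniformly in such $\delta$). Here $\dim\mathscr{M}=n$.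
   Context: $|\cdot|$ is the $L^\infty$-norm, $B_\varepsilon(\mathbf{x}_0)=\{\mathbf{x}\in\mathbb{R}^n:|\mathbf{x}-\mathbf{x}_0|<\varepsilon\}$, and $H_f(\mathbf{x})$ is the Hessian matrix of $f$ at $\mathbf{x}$. With $M=n+R$, $Q\in\mathbb{N}$, and $\operatorname{dist}$ the $L^\infty$-distance in $\mathbb{R}^M$, $$N(\mathscr{M};Q,\delta)=\#\left\{(\mathbf{a},q)\in\mathbb{Z}^M\times\mathbb{N}:\ 1\le q\le Q,\ \operatorname{dist}\!\left(\frac{\mathbf{a}}{q},\mathscr{M}\right)\le\frac{\delta}{q}\right\}.$$ *)

theory Defs
  imports "HOL-Analysis.Analysis"
begin

text \<open>
  \<open>\<real>\<^sup>n\<close> and \<open>\<real>\<^sup>R\<close> are \<open>real ^ 'n\<close> and \<open>real ^ 'r\<close>, with \<open>n = CARD('n)\<close> and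
  \<open>R = CARD('r)\<close>; the ambient space \<open>\<real>\<^sup>M\<close>, \<open>M = n + R\<close>, is \<open>real ^ ('n + 'r)\<close>.
  The \<open>L\<^sup>\<infinity>\<close>-norm on each of them is the library's \<^const>\<open>infnorm\<close>.
\<close>

definition has_partial_deriv :: "'n::finite \<Rightarrow> (real ^ 'n \<Rightarrow> real) \<Rightarrow> real ^ 'n \<Rightarrow> bool" where
  "has_partial_deriv i f x \<longleftrightarrow> (\<lambda>s::real. f (x + s *\<^sub>R axis i 1)) differentiable (at 0)"

definition partial_deriv :: "'n::finite \<Rightarrow> (real ^ 'n \<Rightarrow> real) \<Rightarrow> real ^ 'n \<Rightarrow> real" where
  "partial_deriv i f x = deriv (\<lambda>s::real. f (x + s *\<^sub>R axis i 1)) 0"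

text \<open>\<open>C_k k f\<close>: all iterated partial derivatives of \<open>f\<close> of order at most \<open>k\<close> exist and are
  continuous on the whole of \<open>\<real>\<^sup>n\<close>.\<close>

primrec C_k :: "nat \<Rightarrow> (real ^ 'n::finite \<Rightarrow> real) \<Rightarrow> bool" where
  "C_k 0 f \<longleftrightarrow> continuous_on UNIV f"
| "C_k (Suc k) f \<longleftrightarrow> continuous_on UNIV f \<and>
     (\<forall>i. (\<forall>x. has_partial_deriv i f x) \<and> C_k k (partial_deriv i f))"

definition hessian :: "(real ^ 'n::finite \<Rightarrow> real) \<Rightarrow> real ^ 'n \<Rightarrow> real ^ 'n ^ 'n" where
  "hessian f x = (\<chi> i j. partial_deriv i (partial_deriv j f) x)"

definition linf_ball :: "real ^ 'n::finite \<Rightarrow> real \<Rightarrow> (real ^ 'n) set" where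
  "linf_ball x0 \<epsilon> = {x. infnorm (x - x0) < \<epsilon>}"

definition linf_dist_set :: "real ^ 'm::finite \<Rightarrow> (real ^ 'm) set \<Rightarrow> real" where
  "linf_dist_set y S = (INF z\<in>S. infnorm (y - z))"

definition graph_manifold ::
    "('r::finite \<Rightarrow> real ^ 'n::finite \<Rightarrow> real) \<Rightarrow> real ^ 'n \<Rightarrow> real \<Rightarrow> (real ^ ('n + 'r)) set" where
  "graph_manifold f x0 \<epsilon>0 =
     (\<lambda>x. \<chi> k. case k of Inl i \<Rightarrow> x $ i | Inr j \<Rightarrow> f j x) ` closure (linf_ball x0 \<epsilon>0)"

definition rational_points :: "(real ^ 'm::finite) set \<Rightarrow> nat \<Rightarrow> real \<Rightarrow> ((int ^ 'm) \<times> nat) set" where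
  "rational_points S Q \<delta> = {(a, q). 1 \<le> q \<and> q \<le> Q \<and>
     linf_dist_set (\<chi> i. real_of_int (a $ i) / real q) S \<le> \<delta> / real q}"

text \<open>For bounded nonempty \<open>S\<close> (such as a graph over a small closed cube) the set counted here
  is finite, so \<^const>\<open>card\<close> is the genuine cardinality.\<close>

definition count_rational :: "(real ^ 'm::finite) set \<Rightarrow> nat \<Rightarrow> real \<Rightarrow> nat" where
  "count_rational S Q \<delta> = card (rational_points S Q \<delta>)"

end

theory Submission imports Defs "HOL-Real_Asymp.Real_Asymp"
begin

text \<open>
  Write \<open>e(x) = exp (2 \<pi> \<i> x)\<close> and let \<open>j \<in> \<int>\<^sup>R\<close> be nonzero. A multidimensional van der Corput
  argument bounds the sum of \<open>e(q j \<cdot> f(a/q))\<close> over the \<open>a \<in> \<int>\<^sup>n\<close> with \<open>a/q\<close> in a small cube by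
  \<open>O((\<bar>j\<bar> q)^((n-1)/2) q (2 + log q)^n)\<close>: there is a set \<open>I\<close> of at least \<open>n - 1\<close> coordinates for which
  the principal \<open>I\<close>-minor of the Hessian of \<open>j \<cdot> f\<close> is nonzero, and the range of \<open>a\<close> is cut into
  boxes of side \<open>(q/\<bar>j\<bar>)^(1/2)\<close> in the directions of \<open>I\<close>. On each box the phase is linear up to a
  remainder of bounded mixed variation, which is removed by Abel summation, and the gradients belonging
  to different boxes are separated because the minor does not vanish.

  Replacing the indicator of \<open>\<bar>y\<bar> \<le> \<delta>\<close> modulo 1 by a trigonometric polynomial of degree
  \<open>Q^(\<epsilon>/2)/\<delta>\<close>, this bound gives equidistribution of the points \<open>(a/q, (b - q f(a/q))/\<delta>)\<close> in
  \<open>\<real>\<^sup>n \<times> \<real>\<^sup>R\<close> exactly in the range \<open>\<delta> \<ge> Q^(-(n-1)/(n+2R-1)+\<epsilon>)\<close>. Up to \<open>o(1)\<close>, the pair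
  \<open>((a,b), q)\<close> is counted if and only if this point lies in the compact set of all \<open>(x, v)\<close> with
  \<open>\<bar>x - x\<^sub>0\<bar> \<le> \<epsilon>\<^sub>0\<close> and \<open>v \<in> Df(x)[-1,1]\<^sup>n + [-1,1]\<^sup>R\<close>; the constant is its volume divided by \<open>n + 1\<close>.
\<close>

section \<open>Multidimensional Abel summation\<close>

text \<open>The exponent comes from one comparison. Degree \<open>D\<close>, about
  Q^(\<epsilon>/2)/\<delta>, means D^R frequencies, each contributing at most (D Q)^((n-1)/2) Q up
  to logarithms for one denominator; against the main term Q^n this asks for D^(R+(n-1)/2) to be
  below Q^((n-1)/2), which is the stated range. The comparison closes only because every Fourier
  coefficient of the approximating polynomial is at most its mean, so that main term and error carry
  the same factor \<delta>^R. Rank n-1 is enough because a lost direction is summed trivially and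
  costs a factor \<open>q\<close>, the single factor \<open>q\<close> in the bound. Since
  \<open>j\<close> may point in any direction, the minors must be bounded away from 0 uniformly over
  all directions, which is a compactness argument. The obstacle on the geometric side is that the
  sup-norm distance also allows a horizontal displacement of size \<delta>/q, which moves the graph
  vertically by the same order. The limit region is therefore not a box, and counts are compared
  with volumes through grid cubes and dilations of that region.\<close>

definition ecis :: "real \<Rightarrow> complex" where
  "ecis x = cis (2 * pi * x)"

lemma norm_ecis [simp]: "norm (ecis x) = 1"
  by (simp add: ecis_def)

lemma ecis_0 [simp]: "ecis 0 = 1"
  by (simp add: ecis_def)

lemma ecis_add: "ecis (x + y) = ecis x * ecis y"
  by (simp add: ecis_def cis_mult algebra_simps)

lemma ecis_of_int [simp]: "ecis (of_int k) = 1"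
  by (simp add: ecis_def)

lemma norm_ecis_minus_1: "norm (ecis x - 1) = 2 * \<bar>sin (pi * x)\<bar>"
  using dist_exp_i_1[of "2 * pi * x"] by (simp add: ecis_def cis_conv_exp)

lemma norm_ecis_minus_1_le: "norm (ecis x - 1) \<le> 2 * pi * \<bar>x\<bar>"
  unfolding norm_ecis_minus_1 using abs_sin_le_one abs_sin_x_le_abs_x[of "pi * x"] by (simp add: abs_mult)

section \<open>Mixed differences of products and of unimodular factors\<close>

definition fdiff :: "'n \<Rightarrow> (('n \<Rightarrow> nat) \<Rightarrow> 'a::ab_group_add) \<Rightarrow> ('n \<Rightarrow> nat) \<Rightarrow> 'a" where
  "fdiff i u h = u (h(i := Suc (h i))) - u h"

text \<open>\<open>w m\<close> bounds the mixed differences of order \<open>m \<le> k\<close>. The box of validity shrinks by one with each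
  order, because a difference at \<open>h\<close> involves the next lattice point.\<close>

primrec dbound :: "nat \<Rightarrow> nat \<Rightarrow> (nat \<Rightarrow> real) \<Rightarrow> (('n \<Rightarrow> nat) \<Rightarrow> 'a::real_normed_vector) \<Rightarrow> bool" where
  "dbound B 0 w u \<longleftrightarrow> (\<forall>h. (\<forall>i. h i \<le> B) \<longrightarrow> norm (u h) \<le> w 0)"
| "dbound B (Suc k) w u \<longleftrightarrow> (\<forall>h. (\<forall>i. h i \<le> B + Suc k) \<longrightarrow> norm (u h) \<le> w 0) \<and>
     (\<forall>i. dbound B k (\<lambda>m. w (Suc m)) (fdiff i u))"

lemma dboundD: "dbound B k w u \<Longrightarrow> (\<And>i. h i \<le> B + k) \<Longrightarrow> norm (u h) \<le> w 0"
  by (cases k) auto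

lemma dbound_mono_k: "dbound B (Suc k) w u \<Longrightarrow> dbound B k w u"
proof (induction k arbitrary: w u)
  case 0
  then show ?case by (auto simp: le_Suc_eq)
next
  case (Suc k)
  have "dbound B k (\<lambda>m. w (Suc m)) (fdiff i u)" for i
    using Suc.IH[of "\<lambda>m. w (Suc m)" "fdiff i u"] Suc.prems by simp
  moreover have "norm (u h) \<le> w 0" if "\<And>i. h i \<le> B + Suc k" for h
    using dboundD[OF Suc.prems, of h] that by (meson add_left_mono le_SucI le_trans lessI less_imp_le)
  ultimately show ?case by simp
qed

text \<open>A shift moves the box of validity by one; giving up one order of differences restores
  it.\<close>

lemma dbound_shift: "dbound B (Suc k) w u \<Longrightarrow> dbound B k w (\<lambda>h. u (h(i := Suc (h i))))"
proof (induction k arbitrary: w u)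
  case 0
  have "norm (u (h(i := Suc (h i)))) \<le> w 0" if "\<forall>i. h i \<le> B" for h
    using that by (intro dboundD[OF 0]) (auto simp: le_SucI)
  then show ?case by (simp add: fun_upd_def)
next
  case (Suc k)
  have "dbound B k (\<lambda>m. w (Suc m)) (fdiff j (\<lambda>h. u (h(i := Suc (h i)))))" for j
  proof -
    have "fdiff j (\<lambda>h. u (h(i := Suc (h i)))) = (\<lambda>h. fdiff j u (h(i := Suc (h i))))"
      by (auto simp: fdiff_def fun_eq_iff fun_upd_twist)
    moreover have "dbound B k (\<lambda>m. w (Suc m)) (\<lambda>h. fdiff j u (h(i := Suc (h i))))"
      by (rule Suc.IH) (use Suc.prems in simp)
    ultimately show ?thesis by (simp only:)
  qed
  moreover have "norm (u (h(i := Suc (h i)))) \<le> w 0" if "\<And>i. h i \<le> B + Suc k" for h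
    using that by (intro dboundD[OF Suc.prems]) (auto simp: le_SucI)
  ultimately show ?case unfolding dbound.simps by blast
qed

lemma dbound_mono: "dbound B k w u \<Longrightarrow> (\<And>m. w m \<le> w' m) \<Longrightarrow> dbound B k w' u"
proof (induction k arbitrary: w w' u)
  case (Suc k)
  have "dbound B k (\<lambda>m. w' (Suc m)) (fdiff i u)" for i
    by (rule Suc.IH[of "\<lambda>m. w (Suc m)"]) (use Suc.prems in auto)
  then show ?case using Suc.prems by (auto intro: order.trans)
qed (auto intro: order.trans)

lemma dbound_add:
  "dbound B k w u \<Longrightarrow> dbound B k w' v \<Longrightarrow> dbound B k (\<lambda>m. w m + w' m) (\<lambda>h. u h + v h)"
proof (induction k arbitrary: w w' u v)
  case 0
  then show ?case by (auto intro: norm_triangle_mono)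
next
  case (Suc k)
  have "fdiff i (\<lambda>h. u h + v h) = (\<lambda>h. fdiff i u h + fdiff i v h)" for i
    by (simp add: fdiff_def fun_eq_iff)
  with Suc show ?case by (auto intro: norm_triangle_mono)
qed

lemma dbound_const:
  assumes "norm c \<le> w 0" "\<And>m. 0 \<le> w m"
  shows "dbound B k w (\<lambda>h. c)"
proof -
  have z: "dbound B k w (\<lambda>h. 0)" if "\<And>m. 0 \<le> w m" for k and w :: "nat \<Rightarrow> real"
    using that
  proof (induction k arbitrary: w)
    case (Suc k)
    then show ?case by (simp add: fdiff_def[abs_def])
  qed simp
  show ?thesis
  proof (cases k)
    case (Suc k')
    have "dbound B k' (\<lambda>m. w (Suc m)) (\<lambda>h. 0)" by (rule z) (rule assms)
    then show ?thesis using assms by (simp add: Suc fdiff_def[abs_def])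
  qed (use assms in auto)
qed

text \<open>Discrete Leibniz rule, in which one factor is shifted and \<open>dbound_shift\<close>
  absorbs the shift. The weights are geometric in the order, so both terms of the rule have the same
  shape, and each order costs a factor 2.\<close>

lemma dbound_mult:
  fixes u v :: "('n \<Rightarrow> nat) \<Rightarrow> complex"
  assumes "H > 0" "M \<ge> 0" "M' \<ge> 0"
  shows "dbound B k (\<lambda>m. M / H ^ m) u \<Longrightarrow> dbound B k (\<lambda>m. M' / H ^ m) v
     \<Longrightarrow> dbound B k (\<lambda>m. 2 ^ k * M * M' / H ^ m) (\<lambda>h. u h * v h)"
  using assms
proof (induction k arbitrary: M M' u v)
  case 0
  then show ?case by (auto simp: norm_mult intro!: mult_mono)
next
  case (Suc k)
  have "dbound B k (\<lambda>m. 2 ^ Suc k * M * M' / H ^ Suc m) (fdiff i (\<lambda>h. u h * v h))" for i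
  proof -
    have 1: "dbound B k (\<lambda>m. (M / H) / H ^ m) (fdiff i u)" "dbound B k (\<lambda>m. (M' / H) / H ^ m) (fdiff i v)"
      using Suc.prems by (simp_all add: field_simps)
    have 2: "dbound B k (\<lambda>m. M' / H ^ m) (\<lambda>h. v (h(i := Suc (h i))))"
      by (rule dbound_shift[OF Suc.prems(2)])
    have 3: "dbound B k (\<lambda>m. M / H ^ m) u"
      by (rule dbound_mono_k[OF Suc.prems(1)])
    have "dbound B k (\<lambda>m. 2 ^ k * (M / H) * M' / H ^ m + 2 ^ k * M * (M' / H) / H ^ m)
      (\<lambda>h. fdiff i u h * v (h(i := Suc (h i))) + u h * fdiff i v h)"
      by (intro dbound_add Suc.IH 1 2 3) (use Suc.prems in auto)
    moreover have "(\<lambda>h. fdiff i u h * v (h(i := Suc (h i))) + u h * fdiff i v h) = fdiff i (\<lambda>h. u h * v h)"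
      by (auto simp: fdiff_def fun_eq_iff algebra_simps)
    moreover have "(\<lambda>m. 2 ^ k * (M / H) * M' / H ^ m + 2 ^ k * M * (M' / H) / H ^ m) = (\<lambda>m. 2 ^ Suc k * M * M' / H ^ Suc m)"
      using Suc.prems(3) by (auto simp: fun_eq_iff field_simps)
    ultimately show ?thesis by simp
  qed
  moreover have "norm (u h * v h) \<le> 2 ^ Suc k * M * M'" if "\<And>i. h i \<le> B + Suc k" for h
  proof -
    have "norm (u h * v h) \<le> M * M'"
      using dboundD[OF Suc.prems(1), of h] dboundD[OF Suc.prems(2), of h] that Suc.prems
      by (auto simp: norm_mult intro!: mult_mono)
    also have "\<dots> \<le> 2 ^ Suc k * (M * M')"
      using mult_right_mono[of 1 "2 ^ Suc k" "M * M'"] one_le_power[of "2::real" "Suc k"] Suc.prems by simp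
    finally show ?thesis by (simp add: mult.assoc)
  qed
  ultimately show ?case by simp
qed

text \<open>A difference of e(s) is e(s) (e(t) - 1), where \<open>t\<close> is the difference of
  \<open>s\<close>, a phase of size \<sigma>/H. The induction therefore needs a bound linear in
  \<sigma> with a constant uniform for \<sigma> \<le> S: linearity is what yields the extra 1/H at
  each order. Subtracting 1 makes the bound linear already at order 0.\<close>

lemma dbound_ecis_minus_1:
  fixes S :: real
  assumes "S \<ge> 0"
  shows "\<exists>C\<ge>0. \<forall>B H \<sigma>. \<forall>s :: ('n \<Rightarrow> nat) \<Rightarrow> real. H \<ge> 1 \<longrightarrow> 0 \<le> \<sigma> \<longrightarrow> \<sigma> \<le> S \<longrightarrow>
     dbound B k (\<lambda>m. \<sigma> / H ^ m) s \<longrightarrow> dbound B k (\<lambda>m. C * \<sigma> / H ^ m) (\<lambda>h. ecis (s h) - 1)"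
proof (induction k)
  case 0
  have "norm (ecis x - 1) \<le> (2 * pi) * \<sigma>" if "\<bar>x\<bar> \<le> \<sigma>" for x \<sigma>
    using norm_ecis_minus_1_le[of x] that by (smt (verit) mult_left_mono pi_gt_zero)
  then show ?case by (intro exI[of _ "2 * pi"]) auto
next
  case (Suc k)
  then obtain C where C: "C \<ge> 0"
    and IH: "\<And>B H \<sigma>. \<And>s :: ('n \<Rightarrow> nat) \<Rightarrow> real. H \<ge> 1 \<Longrightarrow> 0 \<le> \<sigma> \<Longrightarrow> \<sigma> \<le> S \<Longrightarrow>
     dbound B k (\<lambda>m. \<sigma> / H ^ m) s \<Longrightarrow> dbound B k (\<lambda>m. C * \<sigma> / H ^ m) (\<lambda>h. ecis (s h) - 1)" by blast
  define C' where "C' = 2 * pi + 2 ^ k * (1 + C * S) * C"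
  have "dbound B (Suc k) (\<lambda>m. C' * \<sigma> / H ^ m) (\<lambda>h. ecis (s h) - 1)"
    if H: "H \<ge> 1" and \<sigma>: "0 \<le> \<sigma>" "\<sigma> \<le> S" and s: "dbound B (Suc k) (\<lambda>m. \<sigma> / H ^ m) s"
    for B H \<sigma> and s :: "('n \<Rightarrow> nat) \<Rightarrow> real"
  proof -
    have "norm (ecis (s h) - 1) \<le> C' * \<sigma>" if "\<And>i. h i \<le> B + Suc k" for h
    proof -
      have "norm (ecis (s h) - 1) \<le> 2 * pi * \<sigma>"
        using dboundD[OF s, of h] that norm_ecis_minus_1_le[of "s h"]
        by (smt (verit) mult_left_mono pi_gt_zero real_norm_def div_by_1 power_0)
      also have "\<dots> \<le> C' * \<sigma>"
        using C assms \<sigma> unfolding C'_def by (intro mult_right_mono) auto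
      finally show ?thesis .
    qed
    moreover have "dbound B k (\<lambda>m. C' * \<sigma> / H ^ Suc m) (fdiff i (\<lambda>h. ecis (s h) - 1))" for i
    proof -
      have "dbound B k (\<lambda>m. C * \<sigma> / H ^ m) (\<lambda>h. ecis (s h) - 1)"
        using dbound_mono_k[OF s] H \<sigma> by (intro IH)
      then have "dbound B k (\<lambda>m. C * \<sigma> / H ^ m + 1 / H ^ m) (\<lambda>h. (ecis (s h) - 1) + 1)"
        using H by (intro dbound_add dbound_const) auto
      then have 1: "dbound B k (\<lambda>m. (1 + C * S) / H ^ m) (\<lambda>h. ecis (s h))"
        using H \<sigma> C
        by (auto elim!: dbound_mono simp: add_divide_distrib[symmetric] intro!: divide_right_mono mult_left_mono)
      have "\<sigma> / H \<le> \<sigma> / 1" using H \<sigma> by (intro divide_left_mono) auto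
      then have "\<sigma> / H \<le> S" using \<sigma> by simp
      moreover have "dbound B k (\<lambda>m. (\<sigma> / H) / H ^ m) (fdiff i s)"
        using s by (simp add: field_simps)
      ultimately have 2: "dbound B k (\<lambda>m. C * (\<sigma> / H) / H ^ m) (\<lambda>h. ecis (fdiff i s h) - 1)"
        using H \<sigma> by (intro IH) auto
      have 3: "dbound B k (\<lambda>m. 2 ^ k * (1 + C * S) * (C * (\<sigma> / H)) / H ^ m) (\<lambda>h. ecis (s h) * (ecis (fdiff i s h) - 1))"
        using H C \<sigma> assms by (intro dbound_mult 1 2) auto
      have eq: "(\<lambda>h. ecis (s h) * (ecis (fdiff i s h) - 1)) = fdiff i (\<lambda>h. ecis (s h) - 1)"
        by (auto simp: fdiff_def fun_eq_iff algebra_simps ecis_add[symmetric])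
      have "2 ^ k * (1 + C * S) * (C * (\<sigma> / H)) / H ^ m \<le> C' * \<sigma> / H ^ Suc m" for m
      proof -
        have "2 ^ k * (1 + C * S) * (C * (\<sigma> / H)) / H ^ m = 2 ^ k * (1 + C * S) * C * \<sigma> / H ^ Suc m"
          using H by (simp add: field_simps)
        also have "\<dots> \<le> C' * \<sigma> / H ^ Suc m"
          using H \<sigma> unfolding C'_def by (intro divide_right_mono mult_right_mono) auto
        finally show ?thesis .
      qed
      then show ?thesis using dbound_mono[OF 3] eq by simp
    qed
    ultimately show ?thesis by simp
  qed
  moreover have "C' \<ge> 0" using C assms unfolding C'_def by auto
  ultimately show ?case by blast
qed

corollary dbound_ecis:
  fixes S :: real
  assumes "S \<ge> 0"
  shows "\<exists>C\<ge>0. \<forall>B H. \<forall>s :: ('n \<Rightarrow> nat) \<Rightarrow> real. H \<ge> 1 \<longrightarrow>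
     dbound B k (\<lambda>m. S / H ^ m) s \<longrightarrow> dbound B k (\<lambda>m. C / H ^ m) (\<lambda>h. ecis (s h))"
proof -
  obtain C where C: "C \<ge> 0"
    and IH: "\<And>B H. \<And>s :: ('n \<Rightarrow> nat) \<Rightarrow> real. H \<ge> 1 \<Longrightarrow>
     dbound B k (\<lambda>m. S / H ^ m) s \<Longrightarrow> dbound B k (\<lambda>m. C * S / H ^ m) (\<lambda>h. ecis (s h) - 1)"
    using dbound_ecis_minus_1[of S k] assms by blast
  have "dbound B k (\<lambda>m. (1 + C * S) / H ^ m) (\<lambda>h. ecis (s h))"
    if "H \<ge> 1" "dbound B k (\<lambda>m. S / H ^ m) s" for B H and s :: "('n \<Rightarrow> nat) \<Rightarrow> real"
  proof -
    have "dbound B k (\<lambda>m. C * S / H ^ m + 1 / H ^ m) (\<lambda>h. (ecis (s h) - 1) + 1)"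
      using that by (intro dbound_add dbound_const IH) auto
    then show ?thesis by (simp add: add_divide_distrib add.commute)
  qed
  then show ?thesis using C assms by (intro exI[of _ "1 + C * S"]) auto
qed

section \<open>Summation by parts in one and several variables\<close>

text \<open>The coefficients vary by at most M/H per step, and m \<le> H steps keep their total
  variation below M.\<close>

lemma abel_sum_bound:
  fixes E B :: "nat \<Rightarrow> complex"
  assumes "\<And>k. k \<le> m \<Longrightarrow> norm (\<Sum>j<k. E j) \<le> T"
    and "norm (B m) \<le> M" "\<And>k. k < m \<Longrightarrow> norm (B (Suc k) - B k) \<le> M / H" "real m \<le> H" "H > 0" "M \<ge> 0"
  shows "norm (\<Sum>k<m. E k * B k) \<le> 2 * T * M"
proof -
  have T: "T \<ge> 0" using assms(1)[of 0] by simp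
  have "(\<Sum>k<m'. E k * B k) = (\<Sum>j<m'. E j) * B m' - (\<Sum>k<m'. (\<Sum>j<Suc k. E j) * (B (Suc k) - B k))" for m'
    by (induction m') (auto simp: algebra_simps)
  then have "norm (\<Sum>k<m. E k * B k) = norm ((\<Sum>j<m. E j) * B m - (\<Sum>k<m. (\<Sum>j<Suc k. E j) * (B (Suc k) - B k)))"
    by simp
  also have "\<dots> \<le> norm ((\<Sum>j<m. E j) * B m) + (\<Sum>k<m. norm ((\<Sum>j<Suc k. E j) * (B (Suc k) - B k)))"
    by (rule order.trans[OF norm_triangle_ineq4]) (intro add_left_mono norm_sum)
  also have "\<dots> \<le> T * M + (\<Sum>k<m. T * (M / H))"
    unfolding norm_mult using assms(2-) assms(1)[of "Suc _"] assms(1)[of m] T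
    by (intro add_mono sum_mono mult_mono) (auto simp del: sum.lessThan_Suc)
  also have "(\<Sum>k<m. T * (M / H)) = (real m / H) * (T * M)" by simp
  also have "\<dots> \<le> 1 * (T * M)"
    using assms T by (intro mult_right_mono) auto
  finally show ?thesis by (simp add: algebra_simps)
qed

text \<open>Coordinates outside \<open>I\<close> are frozen at \<open>z\<close>, so that slicing off
  one coordinate of a box yields boxes of the same kind; this carries the induction on
  \<open>I\<close>.\<close>

definition lbox :: "'n set \<Rightarrow> ('n \<Rightarrow> nat) \<Rightarrow> ('n \<Rightarrow> nat) \<Rightarrow> ('n \<Rightarrow> nat) set" where
  "lbox I m z = {h. (\<forall>i\<in>I. h i < m i) \<and> (\<forall>i. i \<notin> I \<longrightarrow> h i = z i)}"

lemma finite_lbox: "finite I \<Longrightarrow> finite (lbox I m z)"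
proof (induction I arbitrary: z rule: finite_induct)
  case empty
  have "lbox {} m z = {z}" by (auto simp: lbox_def)
  then show ?case by simp
next
  case (insert i I)
  have "lbox (insert i I) m z \<subseteq> (\<Union>k<m i. lbox I m (z(i := k)))"
    by (auto simp: lbox_def)
  then show ?case using insert by (auto intro: finite_subset)
qed

lemma sum_lbox_insert:
  fixes f :: "('n \<Rightarrow> nat) \<Rightarrow> 'a::comm_monoid_add"
  assumes "finite I" "i \<notin> I"
  shows "sum f (lbox (insert i I) m z) = (\<Sum>k<m i. sum f (lbox I m (z(i := k))))"
proof -
  have eq: "lbox (insert i I) m z = (\<Union>k\<in>{..<m i}. lbox I m (z(i := k)))"
    using assms by (auto simp: lbox_def)
  show ?thesis unfolding eq
  proof (rule sum.UNION_disjoint)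
    show "\<forall>k\<in>{..<m i}. finite (lbox I m (z(i := k)))" using assms finite_lbox by blast
  qed (use assms in \<open>auto simp: lbox_def\<close>)
qed

text \<open>One Abel summation per coordinate, hence \<open>card I\<close> orders of differences. In
  direction \<open>i\<close> the coefficients are the sums \<open>b k\<close> over slices; an
  increment of \<open>b\<close> is a slice sum with \<open>fdiff i u\<close> in place of
  \<open>u\<close>, so the induction hypothesis bounds it with \<open>M / H\<close> in place of
  \<open>M\<close>.\<close>

lemma multi_abel_bound:
  fixes u :: "('n::finite \<Rightarrow> nat) \<Rightarrow> complex"
  assumes "dbound B (card I) (\<lambda>m. M / H ^ m) u" "M \<ge> 0" "H > 0" "\<And>i. z i \<le> B"
    and "\<And>i. i \<in> I \<Longrightarrow> m i \<le> B \<and> real (m i) \<le> H"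
    and "\<And>i k. i \<in> I \<Longrightarrow> k \<le> m i \<Longrightarrow> norm (\<Sum>j<k. ecis (\<theta> i * real j)) \<le> T i"
  shows "norm (\<Sum>h\<in>lbox I m z. u h * (\<Prod>i\<in>I. ecis (\<theta> i * real (h i)))) \<le> 2 ^ card I * M * (\<Prod>i\<in>I. T i)"
proof -
  have "finite I" by simp
  then show ?thesis using assms
  proof (induction I arbitrary: u M z rule: finite_induct)
    case empty
    have "lbox {} m z = {z}" by (auto simp: lbox_def)
    then show ?case using empty by simp
  next
    case (insert i I)
    define P where "P = (\<lambda>h. \<Prod>i\<in>I. ecis (\<theta> i * real (h i :: nat)))"
    have card: "card (insert i I) = Suc (card I)" using insert by simp
    define b where "b = (\<lambda>k. \<Sum>h\<in>lbox I m (z(i := k)). u h * P h)"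
    let ?M = "2 ^ card I * M * (\<Prod>i\<in>I. T i)"
    have T0: "T j \<ge> 0" if "j \<in> insert i I" for j
      using insert.prems(6)[of j 0] that by simp
    have Pupd: "P (h(i := k)) = P h" for h k
      unfolding P_def using insert.hyps by (intro prod.cong) auto
    \<comment> \<open>Consecutive slices are translates of each other; reindexing turns
      \<open>b (Suc k) - b k\<close> into a sum over a single slice.\<close>
    have upd: "(\<lambda>h. h(i := Suc (h i))) ` lbox I m (z(i := k)) = lbox I m (z(i := Suc k))" for k
    proof
      show "lbox I m (z(i := Suc k)) \<subseteq> (\<lambda>h. h(i := Suc (h i))) ` lbox I m (z(i := k))"
      proof
        fix h assume h: "h \<in> lbox I m (z(i := Suc k))"
        then have "h i = Suc k" using insert.hyps by (auto simp: lbox_def)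
        then have "h = (h(i := k))(i := Suc ((h(i := k)) i))" by auto
        moreover have "h(i := k) \<in> lbox I m (z(i := k))"
          using h insert.hyps by (auto simp: lbox_def)
        ultimately show "h \<in> (\<lambda>h. h(i := Suc (h i))) ` lbox I m (z(i := k))" by blast
      qed
    qed (use insert.hyps in \<open>auto simp: lbox_def\<close>)
    have "norm (\<Sum>k<m i. ecis (\<theta> i * real k) * b k) \<le> 2 * T i * ?M"
    proof (rule abel_sum_bound[where H = H])
      show "norm (b (m i)) \<le> ?M"
        unfolding b_def P_def
      proof (rule insert.IH)
        show "dbound B (card I) (\<lambda>m. M / H ^ m) u"
          by (rule dbound_mono_k[OF insert.prems(1)[unfolded card]])
        show "(z(i := m i)) i' \<le> B" for i' using insert.prems by auto
      qed (use insert.prems in auto)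
      show "norm (b (Suc k) - b k) \<le> ?M / H" if "k < m i" for k
      proof -
        have "b (Suc k) = (\<Sum>h\<in>lbox I m (z(i := k)). u (h(i := Suc (h i))) * P h)"
          unfolding b_def upd[symmetric]
          by (subst sum.reindex) (auto simp: Pupd inj_on_def lbox_def fun_eq_iff split: if_splits)
        then have "b (Suc k) - b k = (\<Sum>h\<in>lbox I m (z(i := k)). fdiff i u h * P h)"
          unfolding b_def fdiff_def by (simp add: sum_subtractf algebra_simps)
        also have "norm \<dots> \<le> 2 ^ card I * (M / H) * (\<Prod>i\<in>I. T i)"
          unfolding P_def
        proof (rule insert.IH)
          show "dbound B (card I) (\<lambda>m. M / H / H ^ m) (fdiff i u)"
            using insert.prems(1) unfolding card by (simp add: field_simps)
          show "(z(i := k)) i' \<le> B" for i' using insert.prems(4,5) that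
            by (auto intro: order.trans less_imp_le)
        qed (use insert.prems in auto)
        finally show ?thesis by simp
      qed
    qed (use insert.prems T0 in \<open>auto intro!: mult_nonneg_nonneg prod_nonneg\<close>)
    also have "(\<Sum>k<m i. ecis (\<theta> i * real k) * b k)
      = (\<Sum>h\<in>lbox (insert i I) m z. u h * (\<Prod>i\<in>insert i I. ecis (\<theta> i * real (h i))))"
      unfolding sum_lbox_insert[OF insert.hyps] b_def sum_distrib_left P_def
      using insert.hyps by (intro sum.cong) (auto simp: lbox_def)
    also have "2 * T i * ?M = 2 ^ card (insert i I) * M * (\<Prod>i\<in>insert i I. T i)"
      using insert.hyps by simp
    finally show ?case .
  qed
qed

text \<open>A monotone lattice path from the origin to \<open>h\<close> has as many unit steps as
  the coordinate sum of \<open>h\<close>, and it never leaves the box.\<close>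

lemma norm_le_telescope:
  fixes v :: "('n::finite \<Rightarrow> nat) \<Rightarrow> 'a::real_normed_vector"
  assumes "\<And>h i. (\<And>i. h i \<le> B) \<Longrightarrow> norm (fdiff i v h) \<le> \<omega>" "v (\<lambda>_. 0) = 0" "\<And>i. h i \<le> B"
  shows "norm (v h) \<le> real (\<Sum>i\<in>UNIV. h i) * \<omega>"
  using assms(2-)
proof (induction "\<Sum>i\<in>UNIV. h i" arbitrary: h)
  case 0
  then have "h = (\<lambda>_. 0)" by auto
  then show ?case using 0 by simp
next
  case (Suc N)
  then obtain i where i: "h i > 0" by (metis gr0I nat.distinct(1) sum.neutral)
  define h' where "h' = h(i := h i - 1)"
  have h: "h = h'(i := Suc (h' i))" using i by (auto simp: h'_def)
  have "(\<Sum>i\<in>UNIV. h i) = Suc (\<Sum>i\<in>UNIV. h' i)"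
    using i by (simp add: h'_def sum.remove[of _ i])
  then have N: "N = (\<Sum>i\<in>UNIV. h' i)" using Suc(2) by simp
  have le: "h' j \<le> B" for j using Suc.prems(2)[of j] by (auto simp: h'_def)
  have "norm (v h') \<le> real N * \<omega>"
    unfolding N using le by (intro Suc.hyps(1)[OF N]) (auto simp: assms)
  moreover have "norm (fdiff i v h') \<le> \<omega>" using assms(1) le by blast
  moreover have "v h = v h' + fdiff i v h'" by (simp add: fdiff_def h[symmetric])
  ultimately have "norm (v h) \<le> real N * \<omega> + \<omega>" by (metis norm_triangle_mono)
  then show ?case using Suc(2)[symmetric] by (simp add: algebra_simps)
qed

section \<open>Finite differences and partial derivatives\<close>

text \<open>\<open>partial_deriv\<close> is defined by a derivative at parameter 0; translating the
  base point gives the derivative along the whole coordinate line, as the mean value theorem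
  requires.\<close>

lemma C_k_Suc_deriv:
  assumes "C_k (Suc k) f"
  shows "((\<lambda>s. f (x + s *\<^sub>R axis i 1)) has_real_derivative partial_deriv i f (x + t *\<^sub>R axis i 1)) (at t)"
proof -
  have "has_partial_deriv i f (x + t *\<^sub>R axis i 1)" using assms by simp
  then have "((\<lambda>s. f (x + t *\<^sub>R axis i 1 + s *\<^sub>R axis i 1)) has_real_derivative
      partial_deriv i f (x + t *\<^sub>R axis i 1)) (at 0)"
    unfolding has_partial_deriv_def partial_deriv_def
    by (simp add: DERIV_deriv_iff_real_differentiable)
  then show ?thesis
    using DERIV_shift[of "\<lambda>s. f (x + s *\<^sub>R axis i 1)" "partial_deriv i f (x + t *\<^sub>R axis i 1)" 0 t]
    by (simp add: algebra_simps)
qed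

lemma C_k_Suc: "C_k (Suc k) f \<Longrightarrow> C_k k f"
  by (induction k arbitrary: f) auto

lemma C_k_mono: "C_k l f \<Longrightarrow> k \<le> l \<Longrightarrow> C_k k f"
  by (induction l) (auto simp: le_Suc_eq dest: C_k_Suc simp del: C_k.simps(2))

lemma C_k_continuous: "C_k k f \<Longrightarrow> continuous_on UNIV f"
  by (cases k) auto

lemma C_k_partial: "C_k (Suc k) f \<Longrightarrow> C_k k (partial_deriv i f)"
  by simp

lemma partial_deriv_eqI:
  "((\<lambda>s. f (x + s *\<^sub>R axis i 1)) has_real_derivative D) (at 0) \<Longrightarrow> partial_deriv i f x = D"
  unfolding partial_deriv_def by (rule DERIV_imp_deriv)

lemma partial_deriv_sum:
  assumes "\<And>j. j \<in> J \<Longrightarrow> C_k (Suc k) (f j)"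
  shows "partial_deriv i (\<lambda>x. \<Sum>j\<in>J. t j * f j x) = (\<lambda>x. \<Sum>j\<in>J. t j * partial_deriv i (f j) x)"
proof
  fix x
  have "((\<lambda>s. f j (x + s *\<^sub>R axis i 1)) has_real_derivative partial_deriv i (f j) x) (at 0)" if "j \<in> J" for j
    using C_k_Suc_deriv[OF assms[OF that], of x i 0] by simp
  then show "partial_deriv i (\<lambda>x. \<Sum>j\<in>J. t j * f j x) x = (\<Sum>j\<in>J. t j * partial_deriv i (f j) x)"
    by (intro partial_deriv_eqI) (auto intro!: derivative_eq_intros DERIV_sum sum.cong)
qed

text \<open>The head of the list is differentiated first, matching the recursion of
  \<open>C_k\<close>.\<close>

primrec pders :: "'n::finite list \<Rightarrow> (real ^ 'n \<Rightarrow> real) \<Rightarrow> real ^ 'n \<Rightarrow> real" where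
  "pders [] f = f"
| "pders (i # ks) f = pders ks (partial_deriv i f)"

lemma continuous_on_pders: "C_k k f \<Longrightarrow> length ks \<le> k \<Longrightarrow> continuous_on UNIV (pders ks f)"
proof (induction ks arbitrary: f k)
  case (Cons i ks)
  then obtain k' where "k = Suc k'" by (cases k) auto
  with Cons show ?case by auto
qed (auto intro: C_k_continuous)

lemma pders_bounded:
  fixes f :: "'r::finite \<Rightarrow> real ^ 'n::finite \<Rightarrow> real"
  assumes "\<And>j. C_k k (f j)" "compact K"
  shows "\<exists>M>0. \<forall>j ks. length ks \<le> k \<longrightarrow> (\<forall>y\<in>K. \<bar>pders ks (f j) y\<bar> \<le> M)"
proof -
  define L where "L = (UNIV :: 'r set) \<times> {ks :: 'n list. set ks \<subseteq> UNIV \<and> length ks \<le> k}"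
  have fin: "finite L" unfolding L_def
    by (intro finite_cartesian_product finite_lists_length_le) auto
  have "\<exists>M. \<forall>y\<in>K. \<bar>pders (snd a) (f (fst a)) y\<bar> \<le> M" if "a \<in> L" for a
  proof -
    have "length (snd a) \<le> k" using that by (auto simp: L_def)
    then have "continuous_on UNIV (pders (snd a) (f (fst a)))"
      by (rule continuous_on_pders[OF assms(1)])
    then have "continuous_on K (pders (snd a) (f (fst a)))"
      by (rule continuous_on_subset) auto
    then have "bounded (pders (snd a) (f (fst a)) ` K)"
      using assms(2) compact_continuous_image compact_imp_bounded by blast
    then show ?thesis unfolding bounded_iff by auto
  qed
  then obtain M where M: "\<And>a y. a \<in> L \<Longrightarrow> y \<in> K \<Longrightarrow> \<bar>pders (snd a) (f (fst a)) y\<bar> \<le> M a" by metis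
  have "\<bar>pders ks (f j) y\<bar> \<le> 1 + (\<Sum>a\<in>L. \<bar>M a\<bar>)" if "length ks \<le> k" "y \<in> K" for j ks y
  proof -
    have "(j, ks) \<in> L" using that by (auto simp: L_def)
    then have "\<bar>pders ks (f j) y\<bar> \<le> \<bar>M (j, ks)\<bar>" using M[of "(j, ks)" y] that by auto
    also have "\<dots> \<le> (\<Sum>a\<in>L. \<bar>M a\<bar>)" using fin \<open>(j, ks) \<in> L\<close> by (intro member_le_sum) auto
    finally show ?thesis by simp
  qed
  moreover have "1 + (\<Sum>a\<in>L. \<bar>M a\<bar>) > 0" by (smt (verit) sum_nonneg abs_ge_zero)
  ultimately show ?thesis by blast
qed

section \<open>Iterated forward differences and the mean value theorem\<close>

definition dif :: "real \<Rightarrow> 'n::finite \<Rightarrow> (real ^ 'n \<Rightarrow> real) \<Rightarrow> real ^ 'n \<Rightarrow> real" where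
  "dif s i f y = f (y + s *\<^sub>R axis i 1) - f y"

primrec difs :: "real \<Rightarrow> 'n::finite list \<Rightarrow> (real ^ 'n \<Rightarrow> real) \<Rightarrow> real ^ 'n \<Rightarrow> real" where
  "difs s [] f = f"
| "difs s (i # ks) f = difs s ks (dif s i f)"

lemma difs_diff: "difs s ks (\<lambda>y. f y - g y) = (\<lambda>y. difs s ks f y - difs s ks g y)"
proof (induction ks arbitrary: f g)
  case (Cons i ks)
  have "dif s i (\<lambda>y. f y - g y) = (\<lambda>y. dif s i f y - dif s i g y)"
    by (auto simp: dif_def)
  then show ?case using Cons by simp
qed auto

lemma difs_shift: "difs s ks (\<lambda>y. f (y + v)) = (\<lambda>y. difs s ks f (y + v))"
proof (induction ks arbitrary: f)
  case (Cons i ks)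
  have "dif s i (\<lambda>y. f (y + v)) = (\<lambda>y. dif s i f (y + v))"
    by (auto simp: dif_def algebra_simps)
  then show ?case using Cons by simp
qed auto

text \<open>Difference operators commute with translations and sums, so the head may be applied
  last; in that form the mean value theorem in direction \<open>i\<close> applies to
  \<open>difs s ks f\<close>.\<close>

lemma difs_Cons': "difs s (i # ks) f y = difs s ks f (y + s *\<^sub>R axis i 1) - difs s ks f y"
proof -
  have "dif s i f = (\<lambda>y. f (y + s *\<^sub>R axis i 1) - f y)" by (auto simp: dif_def)
  then show ?thesis
    using difs_diff[of s ks "\<lambda>y. f (y + s *\<^sub>R axis i 1)" f] difs_shift[of s ks f] by simp
qed

lemma difs_has_derivative:
  assumes "\<And>y t. ((\<lambda>t. f (y + t *\<^sub>R axis j 1)) has_real_derivative g (y + t *\<^sub>R axis j 1)) (at t)"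
  shows "((\<lambda>t. difs s ks f (y + t *\<^sub>R axis j 1)) has_real_derivative difs s ks g (y + t *\<^sub>R axis j 1)) (at t)"
  using assms
proof (induction ks arbitrary: f g)
  case (Cons i ks)
  have "((\<lambda>t. dif s i f (y + t *\<^sub>R axis j 1)) has_real_derivative dif s i g (y + t *\<^sub>R axis j 1)) (at t)" for y t
  proof -
    have eq: "y + t *\<^sub>R axis j 1 + s *\<^sub>R axis i 1 = (y + s *\<^sub>R axis i 1) + t *\<^sub>R axis j 1" for t
      by (simp add: algebra_simps)
    show ?thesis unfolding dif_def eq by (intro DERIV_diff Cons.prems)
  qed
  from Cons.IH[OF this] show ?case by simp
qed simp

lemma difs_MVT:
  assumes "C_k (Suc 0) f" "s > 0"
  shows "\<exists>\<xi>. 0 < \<xi> \<and> \<xi> < s \<and> difs s (i # ks) f y = s * difs s ks (partial_deriv i f) (y + \<xi> *\<^sub>R axis i 1)"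
proof -
  have "((\<lambda>t. difs s ks f (y + t *\<^sub>R axis i 1)) has_real_derivative
      difs s ks (partial_deriv i f) (y + t *\<^sub>R axis i 1)) (at t)" for t
    by (intro difs_has_derivative C_k_Suc_deriv[OF assms(1)])
  from MVT2[OF assms(2) this] show ?thesis
    unfolding difs_Cons' by auto
qed

text \<open>Each use of the mean value theorem trades one difference for a partial derivative and
  moves the base point by less than \<open>s\<close>; the margin \<open>s * length ks\<close> keeps
  all intermediate points in the cube of radius \<rho>.\<close>

lemma difs_bound:
  fixes x0 :: "real ^ 'n::finite"
  assumes "s > 0" "C_k (length ks) f"
    and "\<And>is y. length is = length ks \<Longrightarrow> (\<And>i. \<bar>y $ i - x0 $ i\<bar> \<le> \<rho>) \<Longrightarrow> \<bar>pders is f y\<bar> \<le> M"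
    and "\<And>i. \<bar>y $ i - x0 $ i\<bar> \<le> \<rho> - s * real (length ks)"
  shows "\<bar>difs s ks f y\<bar> \<le> M * s ^ length ks"
  using assms(2-)
proof (induction ks arbitrary: f y)
  case Nil
  then show ?case using Nil(2)[of "[]" y] by auto
next
  case (Cons i ks)
  have "C_k (Suc 0) f" using Cons.prems(1) by (rule C_k_mono) auto
  then obtain \<xi> where \<xi>: "0 < \<xi>" "\<xi> < s"
    "difs s (i # ks) f y = s * difs s ks (partial_deriv i f) (y + \<xi> *\<^sub>R axis i 1)"
    using difs_MVT assms(1) by blast
  have "\<bar>difs s ks (partial_deriv i f) (y + \<xi> *\<^sub>R axis i 1)\<bar> \<le> M * s ^ length ks"
  proof (rule Cons.IH)
    show "C_k (length ks) (partial_deriv i f)" using Cons.prems(1) by simp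
    show "\<bar>pders is (partial_deriv i f) y\<bar> \<le> M"
      if "length is = length ks" "\<And>i. \<bar>y $ i - x0 $ i\<bar> \<le> \<rho>" for "is" y
      using Cons.prems(2)[of "i # is" y] that by simp
    show "\<bar>(y + \<xi> *\<^sub>R axis i 1) $ j - x0 $ j\<bar> \<le> \<rho> - s * real (length ks)" for j
      using Cons.prems(3)[of j] \<xi> by (auto simp: axis_def algebra_simps abs_if split: if_splits)
  qed
  then show ?case unfolding \<xi>(3) using assms(1) by (simp add: abs_mult algebra_simps)
qed

text \<open>Schwarz's theorem: the second difference is symmetric in \<open>i\<close> and
  \<open>j\<close>, and two mean value steps exhibit it as s^2 times either mixed derivative at a
  point tending to \<open>x\<close>. It supplies the symmetry of the Hessian.\<close>

lemma partial_deriv_commute: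
  fixes f :: "real ^ 'n::finite \<Rightarrow> real"
  assumes "C_k (Suc (Suc 0)) f"
  shows "partial_deriv i (partial_deriv j f) x = partial_deriv j (partial_deriv i f) x"
proof -
  have appr: "\<exists>d>0. \<forall>s. 0 < s \<and> s < d \<longrightarrow> \<bar>difs s [i, j] f x / s\<^sup>2 - partial_deriv j (partial_deriv i f) x\<bar> < e"
    if "e > 0" for e i j
  proof -
    let ?g = "partial_deriv j (partial_deriv i f)"
    have "continuous_on UNIV ?g" using assms by simp
    then have "continuous (at x) ?g" by (simp add: continuous_on_eq_continuous_at)
    then have "\<exists>d>0. \<forall>y. dist y x < d \<longrightarrow> dist (?g y) (?g x) < e"
      using that unfolding continuous_at_eps_delta by (elim allE[where x = e]) simp
    then obtain d where d: "d > 0" "\<And>y. dist y x < d \<Longrightarrow> dist (?g y) (?g x) < e"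
      by blast
    have "\<bar>difs s [i, j] f x / s\<^sup>2 - ?g x\<bar> < e" if s: "0 < s" "s < d / 2" for s
    proof -
      obtain \<xi> where \<xi>: "0 < \<xi>" "\<xi> < s" "difs s [i, j] f x = s * difs s [j] (partial_deriv i f) (x + \<xi> *\<^sub>R axis i 1)"
        using difs_MVT[OF C_k_Suc[OF assms] s(1)] by blast
      have "C_k (Suc 0) (partial_deriv i f)" using assms by (rule C_k_partial)
      from difs_MVT[OF this s(1), of j "[]" "x + \<xi> *\<^sub>R axis i 1"] obtain \<zeta> where \<zeta>: "0 < \<zeta>" "\<zeta> < s" "difs s [j] (partial_deriv i f) (x + \<xi> *\<^sub>R axis i 1)
         = s * ?g (x + \<xi> *\<^sub>R axis i 1 + \<zeta> *\<^sub>R axis j 1)"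
        by auto
      have "dist (x + \<xi> *\<^sub>R axis i 1 + \<zeta> *\<^sub>R axis j 1) x = norm (\<xi> *\<^sub>R axis i 1 + \<zeta> *\<^sub>R axis j (1::real))"
        unfolding add.assoc dist_norm by (rule arg_cong[where f = norm]) (rule add_diff_cancel_left')
      also have "\<dots> \<le> \<xi> + \<zeta>"
        by (rule order.trans[OF norm_triangle_ineq]) (use \<xi> \<zeta> in simp)
      also have "\<dots> < d" using \<xi> \<zeta> s by linarith
      finally have "dist (?g (x + \<xi> *\<^sub>R axis i 1 + \<zeta> *\<^sub>R axis j 1)) (?g x) < e" by (rule d)
      then show ?thesis using \<xi>(3) \<zeta>(3) s by (simp add: dist_real_def power2_eq_square)
    qed
    then show ?thesis using d(1) by (intro exI[of _ "d / 2"]) auto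
  qed
  have comm: "difs s [i, j] f x = difs s [j, i] f x" for s
    by (simp add: dif_def algebra_simps)
  show ?thesis
  proof (rule ccontr)
    assume ne: "\<not> ?thesis"
    define e where "e = \<bar>partial_deriv i (partial_deriv j f) x - partial_deriv j (partial_deriv i f) x\<bar> / 2"
    have e: "e > 0" using ne by (simp add: e_def)
    obtain d1 where d1: "d1 > 0" "\<And>s. 0 < s \<and> s < d1 \<Longrightarrow> \<bar>difs s [i, j] f x / s\<^sup>2 - partial_deriv j (partial_deriv i f) x\<bar> < e"
      using appr[OF e] by metis
    obtain d2 where d2: "d2 > 0" "\<And>s. 0 < s \<and> s < d2 \<Longrightarrow> \<bar>difs s [j, i] f x / s\<^sup>2 - partial_deriv i (partial_deriv j f) x\<bar> < e"
      using appr[OF e] by metis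
    define s where "s = min d1 d2 / 2"
    have "0 < s" "s < d1" "s < d2" using d1(1) d2(1) by (auto simp: s_def min_def)
    then show False using d1(2)[of s] d2(2)[of s] unfolding comm e_def by (smt (verit) field_sum_of_halves)
  qed
qed

text \<open>Only partial derivatives are at hand, so \<open>y\<close> is moved to \<open>x\<close>
  one coordinate at a time inside the box. Comparison with arbitrary slopes \<open>m j\<close>
  covers both the Lipschitz bound (slopes 0) and linearisation (slopes taken at a fixed
  point).\<close>

lemma coordinatewise_MVT:
  fixes \<phi> :: "real ^ 'n::finite \<Rightarrow> real"
  assumes der: "\<And>j y t. ((\<lambda>t. \<phi> (y + t *\<^sub>R axis j 1)) has_real_derivative g j (y + t *\<^sub>R axis j 1)) (at t)"
    and bd: "\<And>j \<xi>. (\<And>i. lo i \<le> \<xi> $ i \<and> \<xi> $ i \<le> hi i) \<Longrightarrow> \<bar>g j \<xi> - m j\<bar> \<le> \<omega>"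
    and x: "\<And>i. lo i \<le> x $ i \<and> x $ i \<le> hi i" and y: "\<And>i. lo i \<le> y $ i \<and> y $ i \<le> hi i"
  shows "\<bar>\<phi> x - \<phi> y - (\<Sum>j\<in>UNIV. m j * (x $ j - y $ j))\<bar> \<le> \<omega> * (\<Sum>j\<in>UNIV. \<bar>x $ j - y $ j\<bar>)"
proof -
  have "\<bar>\<phi> x - \<phi> y - (\<Sum>j\<in>J. m j * (x $ j - y $ j))\<bar> \<le> \<omega> * (\<Sum>j\<in>J. \<bar>x $ j - y $ j\<bar>)"
    if "finite J" "\<And>i. lo i \<le> y $ i \<and> y $ i \<le> hi i" "\<And>i. i \<notin> J \<Longrightarrow> x $ i = y $ i" for J y
    using that
  proof (induction J arbitrary: y rule: finite_induct)
    case empty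
    then have "x = y" by (simp add: vec_eq_iff)
    then show ?case by simp
  next
    case (insert j J)
    define z where "z = y + (x $ j - y $ j) *\<^sub>R axis j 1"
    have zi: "z $ i = (if i = j then x $ j else y $ i)" for i by (simp add: z_def axis_def)
    have IH: "\<bar>\<phi> x - \<phi> z - (\<Sum>j\<in>J. m j * (x $ j - z $ j))\<bar> \<le> \<omega> * (\<Sum>j\<in>J. \<bar>x $ j - z $ j\<bar>)"
      by (rule insert.IH) (use insert.prems x in \<open>auto simp: zi\<close>)
    define \<psi> where "\<psi> t = \<phi> (y + t *\<^sub>R axis j 1) - m j * t" for t
    have "norm (\<psi> (x $ j - y $ j) - \<psi> 0) \<le> \<omega> * norm ((x $ j - y $ j) - 0)"
    proof (rule field_differentiable_bound)
      show "convex (closed_segment 0 (x $ j - y $ j))" by simp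
      show "(\<psi> has_field_derivative g j (y + t *\<^sub>R axis j 1) - m j) (at t within closed_segment 0 (x $ j - y $ j))" for t
        unfolding \<psi>_def[abs_def]
        by (rule has_field_derivative_at_within) (auto intro!: derivative_eq_intros der)
      show "norm (g j (y + t *\<^sub>R axis j 1) - m j) \<le> \<omega>" if "t \<in> closed_segment 0 (x $ j - y $ j)" for t
        unfolding real_norm_def
      proof (rule bd)
        show "lo i \<le> (y + t *\<^sub>R axis j 1) $ i \<and> (y + t *\<^sub>R axis j 1) $ i \<le> hi i" for i
          using insert.prems(1)[of i] x[of i] that
          by (auto simp: axis_def closed_segment_eq_real_ivl split: if_splits)
      qed
    qed auto
    then have "\<bar>\<phi> z - \<phi> y - m j * (x $ j - y $ j)\<bar> \<le> \<omega> * \<bar>x $ j - y $ j\<bar>"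
      by (simp add: \<psi>_def z_def algebra_simps)
    moreover have "(\<Sum>j\<in>J. m j * (x $ j - z $ j)) = (\<Sum>j\<in>J. m j * (x $ j - y $ j))"
      "(\<Sum>j\<in>J. \<bar>x $ j - z $ j\<bar>) = (\<Sum>j\<in>J. \<bar>x $ j - y $ j\<bar>)"
      using insert.hyps by (auto intro!: sum.cong simp: zi)
    ultimately show ?case using IH insert.hyps by (simp add: algebra_simps)
  qed
  from this[of UNIV y] y show ?thesis by simp
qed

definition lat :: "real ^ 'n::finite \<Rightarrow> real \<Rightarrow> (real ^ 'n \<Rightarrow> real) \<Rightarrow> ('n \<Rightarrow> nat) \<Rightarrow> real" where
  "lat x s \<phi> h = \<phi> (x + s *\<^sub>R (\<chi> i. real (h i)))"

lemma fdiff_lat: "fdiff i (lat x s \<phi>) = lat x s (dif s i \<phi>)"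
proof
  fix h :: "'a \<Rightarrow> nat"
  have "x + s *\<^sub>R (\<chi> j. real ((h(i := Suc (h i))) j)) = x + s *\<^sub>R (\<chi> i. real (h i)) + s *\<^sub>R axis i 1"
    by (auto simp: vec_eq_iff axis_def algebra_simps)
  then show "fdiff i (lat x s \<phi>) h = lat x s (dif s i \<phi>) h" unfolding fdiff_def lat_def dif_def by (simp only:)
qed

lemma dbound_lat:
  assumes "\<And>ks h. length ks \<le> k \<Longrightarrow> (\<And>i. h i \<le> B + k - length ks) \<Longrightarrow>
      \<bar>difs s ks \<phi> (x + s *\<^sub>R (\<chi> i. real (h i)))\<bar> \<le> w (length ks)"
  shows "dbound B k w (lat x s \<phi>)"
  using assms
proof (induction k arbitrary: \<phi> w)
  case 0
  then show ?case using 0[of "[]"] by (auto simp: lat_def)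
next
  case (Suc k)
  have "dbound B k (\<lambda>m. w (Suc m)) (lat x s (dif s i \<phi>))" for i
    by (rule Suc.IH) (use Suc.prems[of "i # _"] in auto)
  moreover have "\<forall>h. (\<forall>i. h i \<le> B + Suc k) \<longrightarrow> norm (lat x s \<phi> h) \<le> w 0"
    using Suc.prems[of "[]"] by (auto simp: lat_def)
  ultimately show ?case by (simp add: fdiff_lat)
qed

section \<open>Products of geometric sums\<close>

lemma norm_geometric_ecis_le: "norm (\<Sum>j<m. ecis (\<theta> * real j)) \<le> real m"
  by (rule order.trans[OF norm_sum]) simp

lemma norm_geometric_ecis:
  assumes "sin (pi * \<theta>) \<noteq> 0"
  shows "norm (\<Sum>j<m. ecis (\<theta> * real j)) \<le> 1 / \<bar>sin (pi * \<theta>)\<bar>"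
proof -
  have "(ecis \<theta> - 1) * (\<Sum>j<m. ecis (\<theta> * real j)) = ecis (\<theta> * real m) - 1"
    by (induction m) (auto simp: algebra_simps ecis_add[symmetric])
  then have "norm (ecis \<theta> - 1) * norm (\<Sum>j<m. ecis (\<theta> * real j)) = norm (ecis (\<theta> * real m) - 1)"
    by (metis norm_mult)
  also have "\<dots> \<le> 2" using norm_triangle_ineq4[of "ecis (\<theta> * real m)" 1] by simp
  finally show ?thesis using assms by (simp add: norm_ecis_minus_1 field_simps)
qed

text \<open>A weak form of Jordan's inequality. Up to 1/3 the cosine is at least 1/2; beyond that,
  sin(pi/6) = 1/2 already suffices.\<close>

lemma sin_pi_ge:
  assumes "0 \<le> \<phi>" "\<phi> \<le> 1/2"
  shows "sin (pi * \<phi>) \<ge> \<phi>"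
proof (cases "\<phi> \<le> 1/3")
  case True
  show ?thesis
  proof (cases "\<phi> = 0")
    case False
    then have p: "0 < pi * \<phi>" using assms by simp
    have "\<exists>z>0. z < pi * \<phi> \<and> sin (pi * \<phi>) - sin 0 = (pi * \<phi> - 0) * cos z"
      by (rule MVT2[OF p]) (rule DERIV_sin)
    then obtain z where z: "0 < z" "z < pi * \<phi>" "sin (pi * \<phi>) - sin 0 = (pi * \<phi> - 0) * cos z"
      by blast
    have "pi * \<phi> \<le> pi * (1 / 3)" using True by (intro mult_left_mono) auto
    then have "z \<le> pi * (1 / 3)" using z(2) by linarith
    then have "z \<le> pi / 3" by simp
    then have "cos z \<ge> cos (pi / 3)" using z by (intro cos_monotone_0_pi_le) auto
    then have "cos z \<ge> 1/2" by (simp add: cos_60)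
    then have "(pi * \<phi>) * cos z \<ge> (pi * \<phi>) * (1/2)" using p by (intro mult_left_mono) auto
    moreover have "(pi * \<phi>) * (1/2) \<ge> \<phi>" using mult_right_mono[OF pi_ge_two assms(1)] by simp
    moreover have "sin (pi * \<phi>) = (pi * \<phi>) * cos z" using z(3) by simp
    ultimately show ?thesis by linarith
  qed simp
next
  case False
  have "pi / 6 \<le> pi * \<phi>" "pi * \<phi> \<le> pi / 2" using False assms pi_gt_zero
    by (auto simp: field_simps)
  then have "sin (pi / 6) \<le> sin (pi * \<phi>)" by (intro sin_monotone_2pi_le) auto
  then show ?thesis using assms by (simp add: sin_30)
qed

lemma abs_sin_pi_ge:
  assumes "d \<le> frac \<theta>" "frac \<theta> \<le> 1 - d" "d \<ge> 0"
  shows "\<bar>sin (pi * \<theta>)\<bar> \<ge> d"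
proof -
  have "pi * \<theta> = pi * frac \<theta> + pi * of_int \<lfloor>\<theta>\<rfloor>" by (simp add: frac_def algebra_simps)
  then have eq: "\<bar>sin (pi * \<theta>)\<bar> = \<bar>sin (pi * frac \<theta>)\<bar>"
    by (simp add: sin_add abs_mult) 
  show ?thesis
  proof (cases "frac \<theta> \<le> 1/2")
    case True
    then show ?thesis using sin_pi_ge[of "frac \<theta>"] assms unfolding eq by auto
  next
    case False
    have "sin (pi * (1 - frac \<theta>)) = sin (pi * frac \<theta>)" by (simp add: algebra_simps sin_diff)
    then show ?thesis using sin_pi_ge[of "1 - frac \<theta>"] False assms frac_lt_1[of \<theta>] unfolding eq by auto
  qed
qed

text \<open>The usual bound for a geometric sum by the smaller of \<open>H\<close> and the
  reciprocal distance of \<theta> to the integers, discretised so that it depends only on the cell k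
  = \<lfloor>H \<theta>\<rfloor>. In that cell the distance is at least the minimum in the
  denominator divided by \<open>H\<close>; \<open>max 1\<close> gives the trivial bound
  \<open>H\<close> in the cells close to an integer.\<close>

definition geow :: "nat \<Rightarrow> int \<Rightarrow> real" where
  "geow H k = real H / of_int (max 1 (min (k mod int H) (int H - 1 - k mod int H)))"

lemma geow_nonneg: "geow H k \<ge> 0"
  by (simp add: geow_def)

lemma geometric_ecis_le_geow:
  assumes "H > 0" "m \<le> H"
  shows "norm (\<Sum>j<m. ecis (\<theta> * real j)) \<le> geow H \<lfloor>real H * \<theta>\<rfloor>"
proof -
  define k where "k = \<lfloor>real H * \<theta>\<rfloor>"
  define r where "r = min (k mod int H) (int H - 1 - k mod int H)"
  show ?thesis
  proof (cases "r \<le> 1")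
    case True
    then have "geow H k = real H" by (simp add: geow_def r_def[symmetric])
    then show ?thesis using norm_geometric_ecis_le[of \<theta> m] assms by (simp add: k_def)
  next
    case False
    define b where "b = k div int H"
    have k: "k = b * int H + k mod int H" by (simp add: b_def)
    have 1: "of_int k \<le> real H * \<theta>" "real H * \<theta> < of_int k + 1" by (auto simp: k_def)
    have m0: "0 \<le> k mod int H" "k mod int H < int H" using assms by auto
    have lo: "of_int b \<le> \<theta>" "\<theta> < of_int b + 1"
    proof -
      have "real H * of_int b \<le> real H * \<theta>"
      proof -
        have "int H * b \<le> k" using k m0(1) by (simp add: algebra_simps)
        then have "real_of_int (int H * b) \<le> real_of_int k" by (simp only: of_int_le_iff)
        then show ?thesis using 1(1) by simp
      qed
      then show "of_int b \<le> \<theta>" using assms by simp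
      have "k + 1 \<le> int H * (b + 1)" using k m0(2) by (simp add: algebra_simps)
      then have "real_of_int (k + 1) \<le> real_of_int (int H * (b + 1))" by (simp only: of_int_le_iff)
      then have "real H * \<theta> < real H * (of_int b + 1)" using 1(2) by simp
      then show "\<theta> < of_int b + 1" using assms by simp
    qed
    then have fl: "\<lfloor>\<theta>\<rfloor> = b" by linarith
    have fr: "real H * frac \<theta> = real H * \<theta> - of_int (b * int H)" by (simp add: frac_def fl algebra_simps)
    have kr: "real_of_int k = of_int (b * int H) + of_int (k mod int H)"
      by (subst k) (simp only: of_int_add)
    have f1: "of_int (k mod int H) \<le> real H * frac \<theta>"
      using 1(1) kr unfolding fr by linarith
    have f2: "real H * frac \<theta> \<le> of_int (k mod int H) + 1"
      using 1(2) kr unfolding fr by linarith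
    have "of_int r \<le> real H * frac \<theta>" using f1 by (simp add: r_def min_le_iff_disj of_int_min)
    then have a: "of_int r / real H \<le> frac \<theta>" using assms by (simp add: field_simps)
    have "real_of_int r \<le> of_int (int H - 1 - k mod int H)" unfolding of_int_le_iff r_def by simp
    then have "real H * frac \<theta> \<le> real H - of_int r" using f2 by simp
    then have b: "frac \<theta> \<le> 1 - of_int r / real H" using assms by (simp add: field_simps)
    have c: "of_int r / real H > 0" using False assms by simp
    have s: "\<bar>sin (pi * \<theta>)\<bar> \<ge> of_int r / real H" using abs_sin_pi_ge[OF a b] c by simp
    then have "norm (\<Sum>j<m. ecis (\<theta> * real j)) \<le> 1 / \<bar>sin (pi * \<theta>)\<bar>"
      using c by (intro norm_geometric_ecis) auto
    also have "\<dots> \<le> 1 / (of_int r / real H)" using s c by (intro divide_left_mono mult_pos_pos) linarith+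
    also have "\<dots> = geow H k" using False by (simp add: geow_def r_def[symmetric])
    finally show ?thesis by (simp add: k_def)
  qed
qed

text \<open>The harmonic sum with index 0 counted like index 1; starting from two terms puts r = 0
  and r = 1 into the constant 2.\<close>

lemma sum_recip_le: "(\<Sum>r<Suc (Suc H). 1 / real (max 1 r)) \<le> 2 + ln (real (Suc H))"
proof (induction H)
  case (Suc H)
  have "ln (real (Suc H) / real (Suc (Suc H))) \<le> real (Suc H) / real (Suc (Suc H)) - 1"
    by (intro ln_le_minus_one) simp
  moreover have "real (Suc H) / real (Suc (Suc H)) - 1 = - (1 / real (Suc (Suc H)))"
    by (simp add: field_simps)
  moreover have "ln (real (Suc H) / real (Suc (Suc H))) = ln (real (Suc H)) - ln (real (Suc (Suc H)))"
    by (simp add: ln_div)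
  ultimately have "1 / real (Suc (Suc H)) \<le> ln (real (Suc (Suc H))) - ln (real (Suc H))"
    by linarith
  then show ?case using Suc by simp
qed (simp add: lessThan_Suc)

lemma sum_recip_le': "H > 0 \<Longrightarrow> (\<Sum>r<H. 1 / real (max 1 r)) \<le> 2 + ln (real H)"
proof -
  assume "H > 0"
  then obtain H' where H: "H = Suc H'" by (cases H) auto
  show ?thesis
  proof (cases H')
    case 0
    then show ?thesis by (simp add: H)
  next
    case (Suc H'')
    have "ln (real (Suc H'')) \<le> ln (real H)" by (simp add: H Suc)
    then show ?thesis using sum_recip_le[of H''] unfolding H Suc by linarith
  qed
qed

text \<open>The reciprocal of the smaller distance is at most the sum of both reciprocals, and the
  two resulting sums are the same harmonic sum read in opposite directions.\<close>

lemma sum_geow_period: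
  assumes "H > 0"
  shows "(\<Sum>k\<in>{int H * a..<int H * (a + 1)}. geow H k) \<le> 2 * real H * (2 + ln (real H))"
proof -
  have "(\<Sum>k\<in>{int H * a..<int H * (a + 1)}. geow H k) = (\<Sum>r<H. geow H (int H * a + int r))"
    by (rule sum.reindex_bij_witness[of _ "\<lambda>r. int H * a + int r" "\<lambda>k. nat (k - int H * a)"])
      (use assms in \<open>auto simp: algebra_simps\<close>)
  also have "\<dots> \<le> (\<Sum>r<H. real H * (1 / real (max 1 r)) + real H * (1 / real (max 1 (H - Suc r))))"
  proof (rule sum_mono)
    fix r assume "r \<in> {..<H}"
    then have r: "r < H" by simp
    then have "(int H * a + int r) mod int H = int r" by simp
    then have "geow H (int H * a + int r) = real H / of_int (max 1 (min (int r) (int H - 1 - int r)))"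
      by (simp add: geow_def)
    also have "max 1 (min (int r) (int H - 1 - int r)) = int (max 1 (min r (H - Suc r)))"
      using r by (auto simp: max_def min_def)
    also have "real H / of_int (int (max 1 (min r (H - Suc r)))) = real H * (1 / real (max 1 (min r (H - Suc r))))"
      by simp
    also have "\<dots> \<le> real H * (1 / real (max 1 r) + 1 / real (max 1 (H - Suc r)))"
      by (intro mult_left_mono) (auto simp: min_def)
    finally show "geow H (int H * a + int r) \<le> real H * (1 / real (max 1 r)) + real H * (1 / real (max 1 (H - Suc r)))"
      by (simp add: algebra_simps)
  qed
  also have "\<dots> = real H * ((\<Sum>r<H. 1 / real (max 1 r)) + (\<Sum>r<H. 1 / real (max 1 (H - Suc r))))"
    by (simp add: sum.distrib sum_distrib_left algebra_simps)
  also have "(\<Sum>r<H. 1 / real (max 1 (H - Suc r))) = (\<Sum>r<H. 1 / real (max 1 r))"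
    by (rule sum.nat_diff_reindex)
  also have "real H * ((\<Sum>r<H. 1 / real (max 1 r)) + (\<Sum>r<H. 1 / real (max 1 r))) \<le> real H * ((2 + ln (real H)) + (2 + ln (real H)))"
    using sum_recip_le'[OF assms] by (intro mult_left_mono) auto
  finally show ?thesis by (simp add: algebra_simps)
qed

lemma sum_geow_periods:
  assumes "H > 0"
  shows "(\<Sum>k\<in>{int H * a..<int H * (a + int p)}. geow H k) \<le> real p * (2 * real H * (2 + ln (real H)))"
proof (induction p)
  case (Suc p)
  have "{int H * a..<int H * (a + int (Suc p))} = {int H * a..<int H * (a + int p)} \<union> {int H * (a + int p)..<int H * (a + int p + 1)}"
    using assms by (subst ivl_disj_un) (auto simp: algebra_simps)
  then have "(\<Sum>k\<in>{int H * a..<int H * (a + int (Suc p))}. geow H k)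
    = (\<Sum>k\<in>{int H * a..<int H * (a + int p)}. geow H k) + (\<Sum>k\<in>{int H * (a + int p)..<int H * (a + int p + 1)}. geow H k)"
    by (simp add: sum.union_disjoint)
  then show ?case using Suc sum_geow_period[OF assms, of "a + int p"] by (simp add: algebra_simps)
qed simp

lemma sum_comp_le_fibers:
  fixes g :: "'b \<Rightarrow> real"
  assumes "finite C" "finite S" "\<Phi> ` C \<subseteq> S" "\<And>y. y \<in> S \<Longrightarrow> g y \<ge> 0"
    and "\<And>y. card {c \<in> C. \<Phi> c = y} \<le> K"
  shows "(\<Sum>c\<in>C. g (\<Phi> c)) \<le> real K * (\<Sum>y\<in>S. g y)"
proof -
  have "(\<Sum>c\<in>C. g (\<Phi> c)) = (\<Sum>y\<in>S. \<Sum>c\<in>{c \<in> C. \<Phi> c = y}. g (\<Phi> c))"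
    by (rule sum.group[symmetric]) (use assms in auto)
  also have "\<dots> = (\<Sum>y\<in>S. real (card {c \<in> C. \<Phi> c = y}) * g y)"
    by (intro sum.cong) auto
  also have "\<dots> \<le> (\<Sum>y\<in>S. real K * g y)"
    using assms by (intro sum_mono mult_right_mono) auto
  finally show ?thesis by (simp add: sum_distrib_left)
qed

lemma card_close_le:
  fixes X :: "('n::finite \<Rightarrow> nat) set"
  assumes "\<And>c c' i. c \<in> X \<Longrightarrow> c' \<in> X \<Longrightarrow> \<bar>int (c i) - int (c' i)\<bar> \<le> int P"
  shows "card X \<le> (2 * P + 1) ^ CARD('n)"
proof (cases "X = {}")
  case False
  then obtain c0 where c0: "c0 \<in> X" by blast
  have "X \<subseteq> PiE UNIV (\<lambda>i. {c0 i - P..c0 i + P})"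
  proof
    fix c assume "c \<in> X"
    then have "c0 i - P \<le> c i \<and> c i \<le> c0 i + P" for i
      using assms[OF \<open>c \<in> X\<close> c0, of i] by linarith
    then show "c \<in> PiE UNIV (\<lambda>i. {c0 i - P..c0 i + P})" by auto
  qed
  then have "card X \<le> card (PiE UNIV (\<lambda>i. {c0 i - P..c0 i + P}))"
    by (intro card_mono finite_PiE) auto
  also have "\<dots> = (\<Prod>i\<in>UNIV. card {c0 i - P..c0 i + P})" by (simp add: card_PiE)
  also have "\<dots> \<le> (\<Prod>i\<in>(UNIV::'n set). 2 * P + 1)" by (intro prod_mono) auto
  finally show ?thesis by simp
qed simp

text \<open>Each box \<open>c\<close> is sent to the cells of H \<theta> in the directions of
  \<open>I\<close>, together with \<open>c\<close> itself in the others. By \<open>sep\<close> a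
  fibre fits into a cube of side 2P+1, so at the cost of (2P+1)^n the sum runs over a product of
  intervals, where the weights factorise into one-dimensional sums over \<open>p\<close>
  periods.\<close>

lemma sum_prod_geow_le:
  fixes \<theta> :: "('n::finite \<Rightarrow> nat) \<Rightarrow> 'n \<Rightarrow> real"
  assumes "finite C" "H > 0"
    and sep: "\<And>c c'. c \<in> C \<Longrightarrow> c' \<in> C \<Longrightarrow> (\<And>i. i \<notin> I \<Longrightarrow> c i = c' i) \<Longrightarrow>
         (\<And>i. i \<in> I \<Longrightarrow> \<lfloor>real H * \<theta> c i\<rfloor> = \<lfloor>real H * \<theta> c' i\<rfloor>) \<Longrightarrow> \<forall>i. \<bar>int (c i) - int (c' i)\<bar> \<le> int P"
    and rng: "\<And>c i. c \<in> C \<Longrightarrow> i \<in> I \<Longrightarrow> of_int (A i) \<le> \<theta> c i \<and> \<theta> c i < of_int (A i + int p)"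
    and out: "\<And>c i. c \<in> C \<Longrightarrow> i \<notin> I \<Longrightarrow> c i < N"
  shows "(\<Sum>c\<in>C. \<Prod>i\<in>I. geow H \<lfloor>real H * \<theta> c i\<rfloor>) \<le>
    real ((2 * P + 1) ^ CARD('n)) * ((real p * (2 * real H * (2 + ln (real H)))) ^ card I * real N ^ (CARD('n) - card I))"
proof -
  define \<Phi> where "\<Phi> c = (\<lambda>i. if i \<in> I then \<lfloor>real H * \<theta> c i\<rfloor> else int (c i))" for c
  define S where "S = (\<lambda>i. if i \<in> I then {int H * A i..<int H * (A i + int p)} else {0..<int N})"
  define g where "g = (\<lambda>y. \<Prod>i\<in>UNIV. if i \<in> I then geow H (y i) else 1)"
  have g: "g y = (\<Prod>i\<in>I. geow H (y i))" for y
    unfolding g_def by (simp add: prod.If_cases)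
  have "(\<Sum>c\<in>C. g (\<Phi> c)) \<le> real ((2 * P + 1) ^ CARD('n)) * (\<Sum>y\<in>PiE UNIV S. g y)"
  proof (rule sum_comp_le_fibers)
    show "\<Phi> ` C \<subseteq> PiE UNIV S"
    proof
      fix y assume "y \<in> \<Phi> ` C"
      then obtain c where c: "c \<in> C" "y = \<Phi> c" by blast
      have "y i \<in> S i" for i
      proof (cases "i \<in> I")
        case True
        have "real_of_int (int H * A i) \<le> real H * \<theta> c i"
          using rng[OF c(1) True] by (simp add: mult_left_mono)
        moreover have "real H * \<theta> c i < real_of_int (int H * (A i + int p))"
          using rng[OF c(1) True] assms(2) by (simp del: of_int_add)
        ultimately show ?thesis using True by (simp add: c \<Phi>_def S_def le_floor_iff floor_less_iff del: of_int_mult)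
      next
        case False
        then show ?thesis using out[OF c(1)] by (simp add: c \<Phi>_def S_def)
      qed
      then show "y \<in> PiE UNIV S" by auto
    qed
    show "card {c \<in> C. \<Phi> c = y} \<le> (2 * P + 1) ^ CARD('n)" for y
    proof (rule card_close_le)
      fix c c' i assume c: "c \<in> {c \<in> C. \<Phi> c = y}" "c' \<in> {c \<in> C. \<Phi> c = y}"
      then have "\<Phi> c i = \<Phi> c' i" for i by simp
      then have "\<And>i. i \<in> I \<Longrightarrow> \<lfloor>real H * \<theta> c i\<rfloor> = \<lfloor>real H * \<theta> c' i\<rfloor>" "\<And>i. i \<notin> I \<Longrightarrow> c i = c' i"
        unfolding \<Phi>_def by (metis, metis of_nat_eq_iff)
      then show "\<bar>int (c i) - int (c' i)\<bar> \<le> int P" using sep[of c c'] c by blast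
    qed
  qed (use assms in \<open>auto simp: S_def g_def intro!: finite_PiE prod_nonneg geow_nonneg\<close>)
  also have "(\<Sum>y\<in>PiE UNIV S. g y) = (\<Prod>i\<in>UNIV. \<Sum>k\<in>S i. if i \<in> I then geow H k else 1)"
    unfolding g_def by (rule prod_sum_PiE[symmetric]) (auto simp: S_def)
  also have "\<dots> \<le> (\<Prod>i\<in>UNIV. if i \<in> I then real p * (2 * real H * (2 + ln (real H))) else real N)"
  proof (rule prod_mono)
    fix i show "0 \<le> (\<Sum>k\<in>S i. if i \<in> I then geow H k else 1) \<and> (\<Sum>k\<in>S i. if i \<in> I then geow H k else 1) \<le> (if i \<in> I then real p * (2 * real H * (2 + ln (real H))) else real N)"
      using sum_geow_periods[OF assms(2), of "A i" p] by (auto simp: S_def intro!: sum_nonneg geow_nonneg)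
  qed
  also have "\<dots> = (real p * (2 * real H * (2 + ln (real H)))) ^ card I * real N ^ (CARD('n) - card I)"
    by (simp add: prod.If_cases Compl_eq_Diff_UNIV card_Diff_subset)
  finally show ?thesis unfolding g
    by (simp add: \<Phi>_def mult_left_mono)
qed

section \<open>The exponential sum bound\<close>

lemma dbound_mono_B: "dbound B k w u \<Longrightarrow> B' \<le> B \<Longrightarrow> dbound B' k w u"
proof (induction k arbitrary: w u)
  case (Suc k)
  have "\<forall>h. (\<forall>i. h i \<le> B' + Suc k) \<longrightarrow> norm (u h) \<le> w 0"
    using Suc.prems by (meson add_right_mono dboundD order_trans)
  then show ?case using Suc by simp
qed (auto intro: order.trans)

lemma difs_sum: "difs s ks (\<lambda>y. \<Sum>r\<in>J. c r * f r y) = (\<lambda>y. \<Sum>r\<in>J. c r * difs s ks (f r) y)"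
proof (induction ks arbitrary: f)
  case (Cons i ks)
  have "dif s i (\<lambda>y. \<Sum>r\<in>J. c r * f r y) = (\<lambda>y. \<Sum>r\<in>J. c r * dif s i (f r) y)"
    by (auto simp: dif_def sum_subtractf algebra_simps)
  then show ?case using Cons by simp
qed auto

text \<open>Division with remainder in each coordinate; the last box of a row may be cut off, whence
  the minimum.\<close>

lemma sum_lbox_div_mod:
  fixes G :: "('n::finite \<Rightarrow> nat) \<Rightarrow> 'a::comm_monoid_add"
  assumes "\<And>i. Hs i > 0"
  shows "(\<Sum>t\<in>lbox UNIV N z. G t) = (\<Sum>c\<in>{c. \<forall>i. Hs i * c i < N i}.
     \<Sum>h\<in>lbox UNIV (\<lambda>i. min (Hs i) (N i - Hs i * c i)) z'. G (\<lambda>i. Hs i * c i + h i))"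
proof -
  let ?C = "{c. \<forall>i. Hs i * c i < N i}"
  let ?B = "\<lambda>c. lbox UNIV (\<lambda>i. min (Hs i) (N i - Hs i * c i)) z'"
  have "?C \<subseteq> lbox UNIV N z"
  proof
    fix c assume c: "c \<in> ?C"
    have "c i < N i" for i
    proof -
      have "1 * c i \<le> Hs i * c i" using assms[of i] by (intro mult_right_mono) auto
      moreover have "Hs i * c i < N i" using c by simp
      ultimately show ?thesis by linarith
    qed
    then show "c \<in> lbox UNIV N z" by (simp add: lbox_def)
  qed
  then have fin: "finite ?C" by (rule finite_subset) (simp add: finite_lbox)
  have "(\<Sum>c\<in>?C. \<Sum>h\<in>?B c. G (\<lambda>i. Hs i * c i + h i)) = (\<Sum>(c, h)\<in>Sigma ?C ?B. G (\<lambda>i. Hs i * c i + h i))"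
    using fin by (intro sum.Sigma) (auto simp: finite_lbox)
  also have "\<dots> = (\<Sum>t\<in>lbox UNIV N z. G t)"
  proof (rule sum.reindex_bij_witness[of _ "\<lambda>t. (\<lambda>i. t i div Hs i, \<lambda>i. t i mod Hs i)" "\<lambda>(c, h) i. Hs i * c i + h i"])
    fix t assume t: "t \<in> lbox UNIV N z"
    show "(\<lambda>i. t i div Hs i, \<lambda>i. t i mod Hs i) \<in> Sigma ?C ?B"
    proof -
      have a: "Hs i * (t i div Hs i) + t i mod Hs i = t i" for i by simp
      have tN: "t i < N i" for i using t by (simp add: lbox_def)
      have "Hs i * (t i div Hs i) < N i" for i
        using tN[of i] a[of i] by linarith
      moreover have "t i mod Hs i < N i - Hs i * (t i div Hs i)" for i
        using tN[of i] a[of i] by linarith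
      ultimately show ?thesis using assms by (auto simp: lbox_def)
    qed
    show "(case (\<lambda>i. t i div Hs i, \<lambda>i. t i mod Hs i) of (c, h) \<Rightarrow> \<lambda>i. Hs i * c i + h i) = t" by auto
  next
    fix p assume p: "p \<in> Sigma ?C ?B"
    obtain c h where ch: "p = (c, h)" by (cases p)
    have 1: "h i < Hs i" "h i < N i - Hs i * c i" for i using p by (auto simp: ch lbox_def)
    show "(case p of (c, h) \<Rightarrow> \<lambda>i. Hs i * c i + h i) \<in> lbox UNIV N z"
      using 1(2) by (auto simp: ch lbox_def less_diff_conv add.commute)
    show "(\<lambda>i. (case p of (c, h) \<Rightarrow> \<lambda>i. Hs i * c i + h i) i div Hs i,
          \<lambda>i. (case p of (c, h) \<Rightarrow> \<lambda>i. Hs i * c i + h i) i mod Hs i) = p"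
      using 1(1) assms by (auto simp: ch div_mult_self1)
  qed (auto split: prod.splits)
  finally show ?thesis by simp
qed

text \<open>\<open>nondegenerate\<close> is the quantitative form of a nonzero principal minor: on
  vectors supported in \<open>I\<close>, the \<open>I\<close>-block of the Hessian at
  \<open>x0\<close> expands the sup norm by at least \<kappa>. Its parameter \<open>t\<close> will
  be j/J with J the largest |j r|, whence the normalisation. \<open>hess_osc\<close> is tuned so
  that, summed over n columns and R functions, the Hessian moves by at most \<kappa>/2 and half of
  the expansion survives on the whole cube.\<close>

locale curved_graph =
  fixes f :: "'r::finite \<Rightarrow> real ^ 'n::finite \<Rightarrow> real" and x0 :: "real ^ 'n" and \<rho> M \<kappa> :: real
  assumes n3: "CARD('n) \<ge> 3"
    and smooth: "C_k CARD('n) (f r)"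
    and rho: "0 < \<rho>" "\<rho> \<le> 1" and M_pos: "M > 0" and kappa_pos: "\<kappa> > 0"
    and pders_le: "length ks \<le> CARD('n) \<Longrightarrow> (\<And>i. \<bar>y $ i - x0 $ i\<bar> \<le> \<rho>) \<Longrightarrow> \<bar>pders ks (f r) y\<bar> \<le> M"
    and hess_osc: "(\<And>i. \<bar>y $ i - x0 $ i\<bar> \<le> \<rho>) \<Longrightarrow>
       \<bar>partial_deriv i (partial_deriv k (f r)) y - partial_deriv i (partial_deriv k (f r)) x0\<bar>
         \<le> \<kappa> / (2 * real CARD('n) * real CARD('r))"
    and nondegenerate: "(\<And>r. \<bar>t r\<bar> \<le> 1) \<Longrightarrow> \<bar>t r0\<bar> = 1 \<Longrightarrow>
       \<exists>I. card I \<ge> CARD('n) - 1 \<and> (\<forall>v k. (\<forall>i. i \<notin> I \<longrightarrow> v i = 0) \<longrightarrow>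
         (\<exists>i\<in>I. \<kappa> * \<bar>v k\<bar> \<le> \<bar>\<Sum>k'\<in>UNIV. (\<Sum>r\<in>UNIV. t r * partial_deriv i (partial_deriv k' (f r)) x0) * v k'\<bar>))"
begin

definition phase :: "('r \<Rightarrow> int) \<Rightarrow> nat \<Rightarrow> real ^ 'n \<Rightarrow> real" where
  "phase j q x = (\<Sum>r\<in>UNIV. (of_int (j r) * real q) * f r x)"

definition phase_grad :: "('r \<Rightarrow> int) \<Rightarrow> nat \<Rightarrow> 'n \<Rightarrow> real ^ 'n \<Rightarrow> real" where
  "phase_grad j q k x = (\<Sum>r\<in>UNIV. (of_int (j r) * real q) * partial_deriv k (f r) x)"

lemma smooth2: "C_k (Suc (Suc (Suc 0))) (f r)"
  by (rule C_k_mono[OF smooth]) (use n3 in simp)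

lemma difs_phase_le:
  assumes "q > 0" "\<And>r. \<bar>j r\<bar> \<le> J" "length ks \<le> CARD('n)"
    and "\<And>i. \<bar>y $ i - x0 $ i\<bar> \<le> \<rho> - (1 / real q) * real (length ks)"
  shows "\<bar>difs (1 / real q) ks (phase j q) y\<bar> \<le> real CARD('r) * M * of_int J * real q * (1 / real q) ^ length ks"
proof -
  have "\<bar>difs (1 / real q) ks (f r) y\<bar> \<le> M * (1 / real q) ^ length ks" for r
    by (rule difs_bound[where ?x0.0 = x0 and \<rho> = \<rho>])
      (use assms C_k_mono[OF smooth] pders_le in auto)
  moreover have "\<bar>real_of_int (j r) * real q\<bar> \<le> of_int J * real q" for r
    using assms(2)[of r] by (simp add: abs_mult mult_right_mono)
  ultimately have "\<bar>(of_int (j r) * real q) * difs (1 / real q) ks (f r) y\<bar>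
      \<le> (of_int J * real q) * (M * (1 / real q) ^ length ks)" for r
    by (subst abs_mult, intro mult_mono) (auto intro: order.trans[OF abs_ge_zero])
  then have "(\<Sum>r\<in>(UNIV::'r set). \<bar>(of_int (j r) * real q) * difs (1 / real q) ks (f r) y\<bar>)
     \<le> (\<Sum>r\<in>(UNIV::'r set). (of_int J * real q) * (M * (1 / real q) ^ length ks))"
    by (intro sum_mono) auto
  moreover have "\<bar>difs (1 / real q) ks (phase j q) y\<bar> \<le> (\<Sum>r\<in>(UNIV::'r set). \<bar>(of_int (j r) * real q) * difs (1 / real q) ks (f r) y\<bar>)"
    unfolding phase_def[abs_def] difs_sum by (rule sum_abs)
  ultimately show ?thesis by (simp add: algebra_simps)
qed

text \<open>With the discrete gradient \<open>\<theta>\<close>, the remainder and its first differences vanish at the origin, so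
  that everything follows from the second and higher differences, which are small because
  \<open>J H\<^sup>2 \<le> q\<close>.\<close>

lemma remainder_dbound:
  assumes H: "H \<ge> 1" "J * int (H\<^sup>2) \<le> int q" and J: "J \<ge> 1" "\<And>r. \<bar>j r\<bar> \<le> J"
    and x: "\<And>i. \<bar>x $ i - x0 $ i\<bar> \<le> \<rho> / 2" and q: "real (H + 2 * CARD('n) + 2) / real q \<le> \<rho> / 2"
  defines "\<theta> \<equiv> \<lambda>i. dif (1 / real q) i (phase j q) x"
  shows "dbound H CARD('n) (\<lambda>m. (real (CARD('n) * (CARD('n) + 1)))\<^sup>2 * (real CARD('r) * M) / real H ^ m)
     (\<lambda>h. lat x (1 / real q) (phase j q) h - phase j q x - (\<Sum>i\<in>UNIV. \<theta> i * real (h i)))"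
proof -
  define s where "s = 1 / real q"
  define r where "r = (\<lambda>h. lat x s (phase j q) h - phase j q x - (\<Sum>i\<in>UNIV. \<theta> i * real (h i)))"
  have Hq: "int (H\<^sup>2) \<le> int q"
  proof -
    have "1 * int (H\<^sup>2) \<le> J * int (H\<^sup>2)" using J(1) by (intro mult_right_mono) auto
    then show ?thesis using H(2) by linarith
  qed
  have "H * 1 \<le> H * H" using H by (intro mult_left_mono) auto
  then have "H \<le> H\<^sup>2" by (simp add: power2_eq_square)
  then have Hq1: "H \<le> q" using Hq by linarith
  then have q0: "q > 0" using H by simp
  define A where "A = real CARD('r) * M"
  have A0: "A > 0" unfolding A_def using M_pos by (simp add: card_gt_0_iff)
  have fr: "fdiff i r = (\<lambda>h. lat x s (dif s i (phase j q)) h - \<theta> i)" for i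
  proof -
    have "fdiff i r = (\<lambda>h. fdiff i (lat x s (phase j q)) h - \<theta> i)"
    proof
      fix h
      have "(\<Sum>k\<in>UNIV. \<theta> k * real ((h(i := Suc (h i))) k)) = (\<Sum>k\<in>UNIV. \<theta> k * real (h k)) + (\<Sum>k\<in>UNIV. if k = i then \<theta> i else 0)"
        unfolding sum.distrib[symmetric] by (intro sum.cong) (auto simp: algebra_simps)
      then show "fdiff i r h = fdiff i (lat x s (phase j q)) h - \<theta> i"
        by (simp add: fdiff_def r_def)
    qed
    then show ?thesis by (simp add: fdiff_lat)
  qed
  have ffr: "fdiff k (fdiff i r) = lat x s (dif s k (dif s i (phase j q)))" for i k
  proof -
    have "fdiff k (fdiff i r) = fdiff k (lat x s (dif s i (phase j q)))"
      unfolding fr by (simp add: fdiff_def fun_eq_iff)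
    then show ?thesis by (simp only: fdiff_lat)
  qed
  obtain k0 where nk: "CARD('n) = Suc (Suc k0)"
  proof
    show "CARD('n) = Suc (Suc (CARD('n) - 2))" using n3 by simp
  qed
  \<comment> \<open>A second difference kills the linear part, so only the phase remains. The box
    \<open>H + 2\<close> with \<open>k0\<close> further orders reaches all points up to
    \<open>H + CARD('n)\<close>, through which the two telescopings below run.\<close>
  have second: "dbound (H + 2) k0 (\<lambda>m. A / real H ^ Suc (Suc m)) (fdiff k (fdiff i r))" for i k
    unfolding ffr
  proof (rule dbound_lat)
    fix ks :: "'n list" and h :: "'n \<Rightarrow> nat"
    assume ks: "length ks \<le> k0" and h: "\<And>i. h i \<le> H + 2 + k0 - length ks"
    define y where "y = x + s *\<^sub>R (\<chi> i. real (h i))"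
    have "\<bar>difs s (i # k # ks) (phase j q) y\<bar> \<le> real CARD('r) * M * of_int J * real q * s ^ length (i # k # ks)"
      unfolding s_def
    proof (rule difs_phase_le)
      fix l
      have "h l + length (i # k # ks) \<le> H + 2 * CARD('n) + 2"
        using h[of l] ks nk by auto
      then have "real (h l + length (i # k # ks)) \<le> real (H + 2 * CARD('n) + 2)"
        by (simp only: of_nat_le_iff)
      then have "real (h l) + real (length (i # k # ks)) \<le> real (H + 2 * CARD('n) + 2)" by simp
      then have "s * (real (h l) + real (length (i # k # ks))) \<le> s * real (H + 2 * CARD('n) + 2)"
        using q0 by (intro mult_left_mono) (auto simp: s_def)
      also have "\<dots> \<le> \<rho> / 2" using q by (simp add: s_def)
      finally have 1: "s * real (h l) \<le> \<rho> / 2 - s * real (length (i # k # ks))" by (simp add: algebra_simps)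
      have "y $ l = x $ l + s * real (h l)" "s * real (h l) \<ge> 0" by (auto simp: y_def s_def)
      then have "\<bar>y $ l - x0 $ l\<bar> \<le> \<bar>x $ l - x0 $ l\<bar> + s * real (h l)"
        by linarith
      then show "\<bar>y $ l - x0 $ l\<bar> \<le> \<rho> - 1 / real q * real (length (i # k # ks))"
        using 1 x[of l] unfolding s_def by linarith
    qed (use q0 J ks nk in auto)
    also have "real CARD('r) * M * of_int J * real q * s ^ length (i # k # ks) = A * (of_int J / real q * s ^ length ks)"
      using q0 by (simp add: A_def s_def field_simps)
    \<comment> \<open>The first two orders use J/q \<le> 1/H^2; every further order uses only 1/q
      \<le> 1/H.\<close>
    also have "\<dots> \<le> A * (1 / real H ^ 2 * (1 / real H) ^ length ks)"
    proof (intro mult_left_mono mult_mono power_mono)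
      have "real_of_int (J * int (H\<^sup>2)) \<le> real_of_int (int q)" using H(2) by (simp only: of_int_le_iff)
      then show "of_int J / real q \<le> 1 / real H ^ 2" using q0 H by (simp add: field_simps)
      show "s \<le> 1 / real H" using Hq1 H by (simp add: s_def frac_le)
    qed (use A0 J H in \<open>auto simp: s_def\<close>)
    also have "\<dots> = A / real H ^ Suc (Suc (length ks))" by (simp add: field_simps power2_eq_square)
    finally show "\<bar>difs s ks (dif s k (dif s i (phase j q))) (x + s *\<^sub>R (\<chi> i. real (h i)))\<bar> \<le> A / real H ^ Suc (Suc (length ks))"
      by (simp add: y_def)
  qed
  have second': "norm (fdiff k (fdiff i r) h) \<le> A / (real H)\<^sup>2" if "\<And>i. h i \<le> H + CARD('n)" for i k h
    using dboundD[OF second, of h k i] that nk by (simp add: power2_eq_square)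
  have sumh: "real (\<Sum>i\<in>UNIV. h i) \<le> real (CARD('n) * (CARD('n) + 1)) * real H" if "\<And>i. h i \<le> H + CARD('n)" for h :: "'n \<Rightarrow> nat"
  proof -
    have "(\<Sum>i\<in>UNIV. h i) \<le> (\<Sum>i\<in>(UNIV::'n set). (CARD('n) + 1) * H)"
    proof (intro sum_mono)
      fix i
      have "CARD('n) * 1 \<le> CARD('n) * H" using H by (intro mult_left_mono) auto
      moreover have "(CARD('n) + 1) * H = CARD('n) * H + H" by (simp add: algebra_simps)
      ultimately show "h i \<le> (CARD('n) + 1) * H" using that[of i] by linarith
    qed
    also have "\<dots> = CARD('n) * (CARD('n) + 1) * H" by (simp add: algebra_simps)
    finally have "real (\<Sum>i\<in>UNIV. h i) \<le> real (CARD('n) * (CARD('n) + 1) * H)" by (simp only: of_nat_le_iff)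
    then show ?thesis by simp
  qed
  have first: "norm (fdiff i r h) \<le> (real (CARD('n) * (CARD('n) + 1))) * A / real H" if h: "\<And>i. h i \<le> H + CARD('n)" for i h
  proof -
    have "norm (fdiff i r h) \<le> real (\<Sum>i\<in>UNIV. h i) * (A / (real H)\<^sup>2)"
    proof (rule norm_le_telescope[where B = "H + CARD('n)"])
      show "fdiff i r (\<lambda>_. 0) = 0"
        by (simp add: fr lat_def \<theta>_def s_def zero_vec_def[symmetric])
    qed (use h second' in auto)
    also have "\<dots> \<le> (real (CARD('n) * (CARD('n) + 1)) * real H) * (A / (real H)\<^sup>2)"
      using sumh[OF h] A0 by (intro mult_right_mono) auto
    also have "\<dots> = (real (CARD('n) * (CARD('n) + 1))) * A / real H" using H by (simp add: power2_eq_square)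
    finally show ?thesis .
  qed
  have zeroth: "norm (r h) \<le> (real (CARD('n) * (CARD('n) + 1)))\<^sup>2 * A" if h: "\<And>i. h i \<le> H + CARD('n)" for h
  proof -
    have "norm (r h) \<le> real (\<Sum>i\<in>UNIV. h i) * ((real (CARD('n) * (CARD('n) + 1))) * A / real H)"
    proof (rule norm_le_telescope[where B = "H + CARD('n)"])
      show "r (\<lambda>_. 0) = 0"
        by (simp add: r_def lat_def s_def zero_vec_def[symmetric])
    qed (use h first in auto)
    also have "\<dots> \<le> (real (CARD('n) * (CARD('n) + 1)) * real H) * ((real (CARD('n) * (CARD('n) + 1))) * A / real H)"
      using sumh[OF h] A0 by (intro mult_right_mono) auto
    also have "\<dots> = (real (CARD('n) * (CARD('n) + 1)))\<^sup>2 * A" using H by (simp add: power2_eq_square)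
    finally show ?thesis .
  qed
  have c1: "1 \<le> real (CARD('n) * (CARD('n) + 1))"
  proof -
    have "1 * 1 \<le> CARD('n) * (CARD('n) + 1)" using n3 by (intro mult_le_mono) auto
    then have "real 1 \<le> real (CARD('n) * (CARD('n) + 1))" by (simp only: of_nat_le_iff mult_1)
    then show ?thesis by simp
  qed
  have c2: "real (CARD('n) * (CARD('n) + 1)) \<le> (real (CARD('n) * (CARD('n) + 1)))\<^sup>2" using c1 by (simp add: power2_eq_square)
  let ?S = "(real (CARD('n) * (CARD('n) + 1)))\<^sup>2 * A"
  have S1: "real (CARD('n) * (CARD('n) + 1)) * A \<le> ?S" using c2 A0 by (intro mult_right_mono) auto
  have S2: "A \<le> ?S" using mult_right_mono[OF order.trans[OF c1 c2], of A] A0 by simp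
  have "dbound H (Suc (Suc k0)) (\<lambda>m. ?S / real H ^ m) r"
    unfolding dbound.simps(2)
  proof (intro conjI allI impI)
    fix h :: "'n \<Rightarrow> nat" assume "\<forall>i. h i \<le> H + Suc (Suc k0)"
    then show "norm (r h) \<le> ?S / real H ^ 0" using zeroth[of h] nk by simp
  next
    fix i and h :: "'n \<Rightarrow> nat" assume "\<forall>i. h i \<le> H + Suc k0"
    then have "norm (fdiff i r h) \<le> (real (CARD('n) * (CARD('n) + 1))) * A / real H"
      unfolding add_Suc_right by (intro first) (simp add: nk le_SucI)
    also have "\<dots> \<le> ?S / real H ^ Suc 0" using S1 H by (simp add: divide_right_mono)
    finally show "norm (fdiff i r h) \<le> ?S / real H ^ Suc 0" .
  next
    fix i k
    have "dbound H k0 (\<lambda>m. A / real H ^ Suc (Suc m)) (fdiff k (fdiff i r))"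
      by (rule dbound_mono_B[OF second]) simp
    then show "dbound H k0 (\<lambda>m. ?S / real H ^ Suc (Suc m)) (fdiff k (fdiff i r))"
      by (rule dbound_mono) (use S2 in \<open>intro divide_right_mono; simp\<close>)
  qed
  then show ?thesis unfolding r_def A_def s_def nk by simp
qed

lemma phase_has_derivative:
  "((\<lambda>t. phase j q (y + t *\<^sub>R axis k 1)) has_real_derivative
     phase_grad j q k (y + t *\<^sub>R axis k 1)) (at t)"
  unfolding phase_def phase_grad_def
  by (intro DERIV_sum DERIV_cmult C_k_Suc_deriv[OF smooth2])

text \<open>The step 1/q cancels the factor \<open>q\<close> of the phase, so differences of its
  gradient have size J. Each \<open>f r\<close> has its own intermediate point. The comparison
  values \<open>m r\<close> are left open: they become the Hessian at \<open>x0\<close> for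
  separation and 0 for the range.\<close>

lemma dif_phase_grad:
  assumes "q > 0" "\<And>r. \<bar>j r\<bar> \<le> J"
    and m: "\<And>r y. (\<And>i. \<bar>y $ i - x0 $ i\<bar> \<le> \<rho>) \<Longrightarrow> \<bar>partial_deriv i (partial_deriv k (f r)) y - m r\<bar> \<le> w"
    and x: "\<And>i. \<bar>\<xi> $ i - x0 $ i\<bar> \<le> \<rho> / 2" and q: "1 / real q \<le> \<rho> / 2"
  shows "\<bar>dif (1 / real q) i (phase_grad j q k) \<xi> - (\<Sum>r\<in>UNIV. of_int (j r) * m r)\<bar> \<le> of_int J * (real CARD('r) * w)"
proof -
  have "\<exists>y. (\<forall>i. \<bar>y $ i - x0 $ i\<bar> \<le> \<rho>) \<and>
      dif (1 / real q) i (partial_deriv k (f r)) \<xi> = (1 / real q) * partial_deriv i (partial_deriv k (f r)) y" for r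
  proof -
    have "C_k (Suc 0) (partial_deriv k (f r))" using smooth2[of r] C_k_Suc C_k_partial by blast
    from difs_MVT[OF this, of "1 / real q" i "[]" \<xi>] assms(1) obtain z where
      z: "0 < z" "z < 1 / real q" "dif (1 / real q) i (partial_deriv k (f r)) \<xi> =
        (1 / real q) * partial_deriv i (partial_deriv k (f r)) (\<xi> + z *\<^sub>R axis i 1)" by auto
    have "\<bar>(\<xi> + z *\<^sub>R axis i 1) $ l - x0 $ l\<bar> \<le> \<rho>" for l
    proof -
      have "\<bar>(\<xi> + z *\<^sub>R axis i 1) $ l - x0 $ l\<bar> \<le> \<bar>\<xi> $ l - x0 $ l\<bar> + z"
        using z(1) by (auto simp: axis_def)
      then show ?thesis using x[of l] z(2) q by linarith
    qed
    then show ?thesis using z(3) by blast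
  qed
  then obtain y where y: "\<And>r i. \<bar>y r $ i - x0 $ i\<bar> \<le> \<rho>"
    "\<And>r. dif (1 / real q) i (partial_deriv k (f r)) \<xi> = (1 / real q) * partial_deriv i (partial_deriv k (f r)) (y r)"
    by metis
  have "dif (1 / real q) i (phase_grad j q k) \<xi> = (\<Sum>r\<in>UNIV. (of_int (j r) * real q) * dif (1 / real q) i (partial_deriv k (f r)) \<xi>)"
    by (simp add: dif_def phase_grad_def sum_subtractf[symmetric] algebra_simps)
  also have "\<dots> = (\<Sum>r\<in>UNIV. of_int (j r) * partial_deriv i (partial_deriv k (f r)) (y r))"
    using assms(1) by (intro sum.cong) (auto simp: y(2))
  finally have "\<bar>dif (1 / real q) i (phase_grad j q k) \<xi> - (\<Sum>r\<in>UNIV. of_int (j r) * m r)\<bar>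
     = \<bar>\<Sum>r\<in>UNIV. of_int (j r) * (partial_deriv i (partial_deriv k (f r)) (y r) - m r)\<bar>"
    by (simp add: sum_subtractf algebra_simps)
  also have "\<dots> \<le> (\<Sum>r\<in>(UNIV::'r set). of_int J * w)"
  proof (rule order.trans[OF sum_abs], rule sum_mono)
    fix r
    have "\<bar>of_int (j r)\<bar> * \<bar>partial_deriv i (partial_deriv k (f r)) (y r) - m r\<bar> \<le> of_int J * w"
      using assms(2)[of r] m[of "y r" r] y(1) by (intro mult_mono) auto
    then show "\<bar>of_int (j r) * (partial_deriv i (partial_deriv k (f r)) (y r) - m r)\<bar> \<le> of_int J * w"
      by (simp add: abs_mult)
  qed
  also have "\<dots> = of_int J * (real CARD('r) * w)" by simp
  finally show ?thesis .
qed

lemma dif_phase_linearize: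
  assumes "q > 0" "\<And>r. \<bar>j r\<bar> \<le> J"
    and m: "\<And>k r y. (\<And>i. \<bar>y $ i - x0 $ i\<bar> \<le> \<rho>) \<Longrightarrow> \<bar>partial_deriv i (partial_deriv k (f r)) y - m k r\<bar> \<le> w"
    and x: "\<And>i. \<bar>x $ i - x0 $ i\<bar> \<le> \<rho> / 2" and y: "\<And>i. \<bar>y $ i - x0 $ i\<bar> \<le> \<rho> / 2" and q: "1 / real q \<le> \<rho> / 2"
  shows "\<bar>dif (1 / real q) i (phase j q) x - dif (1 / real q) i (phase j q) y
      - (\<Sum>k\<in>UNIV. (\<Sum>r\<in>UNIV. of_int (j r) * m k r) * (x $ k - y $ k))\<bar>
    \<le> of_int J * (real CARD('r) * w) * (\<Sum>k\<in>UNIV. \<bar>x $ k - y $ k\<bar>)"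
proof (rule coordinatewise_MVT[where lo = "\<lambda>i. x0 $ i - \<rho> / 2" and hi = "\<lambda>i. x0 $ i + \<rho> / 2"
      and g = "\<lambda>k. dif (1 / real q) i (phase_grad j q k)"])
  show "((\<lambda>t. dif (1 / real q) i (phase j q) (y + t *\<^sub>R axis k 1)) has_real_derivative
      dif (1 / real q) i (phase_grad j q k) (y + t *\<^sub>R axis k 1)) (at t)" for k y t
    using difs_has_derivative[of "phase j q" k "phase_grad j q k" "1 / real q" "[i]" y t] phase_has_derivative by simp
  show "\<bar>dif (1 / real q) i (phase_grad j q k) \<xi> - (\<Sum>r\<in>UNIV. of_int (j r) * m k r)\<bar> \<le> of_int J * (real CARD('r) * w)"
    if "\<And>i. x0 $ i - \<rho> / 2 \<le> \<xi> $ i \<and> \<xi> $ i \<le> x0 $ i + \<rho> / 2" for k \<xi>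
  proof (rule dif_phase_grad[OF assms(1,2) m _ q])
    show "\<bar>\<xi> $ i - x0 $ i\<bar> \<le> \<rho> / 2" for i using that[of i] by linarith
  qed
  show "x0 $ i - \<rho> / 2 \<le> x $ i \<and> x $ i \<le> x0 $ i + \<rho> / 2" for i using x[of i] by linarith
  show "x0 $ i - \<rho> / 2 \<le> y $ i \<and> y $ i \<le> x0 $ i + \<rho> / 2" for i using y[of i] by linarith
qed

text \<open>The discrete gradient expands distances between points that agree outside
  \<open>I\<close>: the linear part at \<open>x0\<close> contributes \<kappa> J times the largest
  coordinate difference, and the variation of the Hessian takes back at most half of it. The same
  \<open>I\<close> serves all \<open>q\<close>, \<open>x\<close> and \<open>y\<close>.\<close>

lemma dif_phase_separated:
  assumes J: "J \<ge> 1" "\<And>r. \<bar>j r\<bar> \<le> J" "\<bar>j r0\<bar> = J"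
  shows "\<exists>I. card I \<ge> CARD('n) - 1 \<and> (\<forall>q x y k. q > 0 \<longrightarrow> 1 / real q \<le> \<rho> / 2 \<longrightarrow> (\<forall>i. \<bar>x $ i - x0 $ i\<bar> \<le> \<rho> / 2) \<longrightarrow>
     (\<forall>i. \<bar>y $ i - x0 $ i\<bar> \<le> \<rho> / 2) \<longrightarrow> (\<forall>i. i \<notin> I \<longrightarrow> x $ i = y $ i) \<longrightarrow>
     (\<exists>i\<in>I. \<kappa> / 2 * of_int J * \<bar>x $ k - y $ k\<bar> \<le> \<bar>dif (1 / real q) i (phase j q) x - dif (1 / real q) i (phase j q) y\<bar>))"
proof -
  define t where "t r = real_of_int (j r) / real_of_int J" for r
  have t1: "\<bar>t r\<bar> \<le> 1" for r using J(1) J(2)[of r] by (simp add: t_def abs_mult)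
  have t2: "\<bar>t r0\<bar> = 1" using J(1,3) by (simp add: t_def flip: of_int_abs)
  have tJ: "of_int (j r) = of_int J * t r" for r using J(1) by (simp add: t_def)
  let ?D = "\<lambda>i k r. partial_deriv i (partial_deriv k (f r)) x0"
  from nondegenerate[of t, OF t1 t2] obtain I where I: "card I \<ge> CARD('n) - 1"
    "\<And>v k. (\<forall>i. i \<notin> I \<longrightarrow> v i = 0) \<Longrightarrow> \<exists>i\<in>I. \<kappa> * \<bar>v k\<bar> \<le> \<bar>\<Sum>k'\<in>UNIV. (\<Sum>r\<in>UNIV. t r * ?D i k' r) * v k'\<bar>"
    by blast
  have "\<exists>i\<in>I. \<kappa> / 2 * of_int J * \<bar>x $ k - y $ k\<bar> \<le> \<bar>dif (1 / real q) i (phase j q) x - dif (1 / real q) i (phase j q) y\<bar>"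
    if q: "q > 0" "1 / real q \<le> \<rho> / 2" and x: "\<And>i. \<bar>x $ i - x0 $ i\<bar> \<le> \<rho> / 2" and y: "\<And>i. \<bar>y $ i - x0 $ i\<bar> \<le> \<rho> / 2"
      and xy: "\<And>i. i \<notin> I \<Longrightarrow> x $ i = y $ i" for q x y k
  proof -
    define v where "v i = x $ i - y $ i" for i
    \<comment> \<open>Testing at the largest coordinate difference gives one \<open>i\<close> that
      serves every \<open>k\<close>.\<close>
    define X where "X = Max (range (\<lambda>i. \<bar>v i\<bar>))"
    have "X \<in> range (\<lambda>i. \<bar>v i\<bar>)" unfolding X_def by (intro Max_in) auto
    then obtain k1 where k1: "X = \<bar>v k1\<bar>" by blast
    have vX: "\<bar>v i\<bar> \<le> X" for i unfolding X_def by (intro Max_ge) auto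
    have "\<forall>i. i \<notin> I \<longrightarrow> v i = 0" using xy by (simp add: v_def)
    from I(2)[OF this, of k1] obtain i where i: "i \<in> I"
      "\<kappa> * \<bar>v k1\<bar> \<le> \<bar>\<Sum>k'\<in>UNIV. (\<Sum>r\<in>UNIV. t r * ?D i k' r) * v k'\<bar>" by blast
    have "\<bar>dif (1 / real q) i (phase j q) x - dif (1 / real q) i (phase j q) y
        - (\<Sum>k\<in>UNIV. (\<Sum>r\<in>UNIV. of_int (j r) * ?D i k r) * (x $ k - y $ k))\<bar>
      \<le> of_int J * (real CARD('r) * (\<kappa> / (2 * real CARD('n) * real CARD('r)))) * (\<Sum>k\<in>UNIV. \<bar>x $ k - y $ k\<bar>)"
      by (rule dif_phase_linearize[OF q(1) J(2) hess_osc x y q(2)])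
    also have "real CARD('r) * (\<kappa> / (2 * real CARD('n) * real CARD('r))) = \<kappa> / (2 * real CARD('n))"
      by simp
    also have "of_int J * (\<kappa> / (2 * real CARD('n))) * (\<Sum>k\<in>UNIV. \<bar>x $ k - y $ k\<bar>) \<le> of_int J * (\<kappa> / (2 * real CARD('n))) * (\<Sum>k\<in>(UNIV::'n set). X)"
      using vX J kappa_pos by (intro mult_left_mono sum_mono) (auto simp: v_def)
    also have "\<dots> = of_int J * (\<kappa> / 2) * X" by simp
    finally have 1: "\<bar>dif (1 / real q) i (phase j q) x - dif (1 / real q) i (phase j q) y
        - (\<Sum>k\<in>UNIV. (\<Sum>r\<in>UNIV. of_int (j r) * ?D i k r) * (x $ k - y $ k))\<bar> \<le> of_int J * (\<kappa> / 2) * X" .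
    have "(\<Sum>k\<in>UNIV. (\<Sum>r\<in>UNIV. of_int (j r) * ?D i k r) * (x $ k - y $ k)) = of_int J * (\<Sum>k'\<in>UNIV. (\<Sum>r\<in>UNIV. t r * ?D i k' r) * v k')"
      unfolding tJ v_def by (simp add: sum_distrib_left sum_distrib_right mult.assoc)
    then have "\<bar>\<Sum>k\<in>UNIV. (\<Sum>r\<in>UNIV. of_int (j r) * ?D i k r) * (x $ k - y $ k)\<bar> \<ge> of_int J * (\<kappa> * X)"
      using i(2) J(1) unfolding k1 by (simp add: abs_mult)
    then have "\<bar>dif (1 / real q) i (phase j q) x - dif (1 / real q) i (phase j q) y\<bar> \<ge> of_int J * (\<kappa> * X) - of_int J * (\<kappa> / 2) * X"
      using 1 by linarith
    also have "of_int J * (\<kappa> * X) - of_int J * (\<kappa> / 2) * X = \<kappa> / 2 * of_int J * X" by (simp add: algebra_simps)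
    finally have "\<kappa> / 2 * of_int J * X \<le> \<bar>dif (1 / real q) i (phase j q) x - dif (1 / real q) i (phase j q) y\<bar>" .
    moreover have "\<kappa> / 2 * of_int J * \<bar>x $ k - y $ k\<bar> \<le> \<kappa> / 2 * of_int J * X"
      using vX[of k] J kappa_pos by (intro mult_left_mono) (auto simp: v_def)
    ultimately show ?thesis using i(1) by (intro bexI[of _ i]) linarith
  qed
  then show ?thesis using I(1) by blast
qed

text \<open>The frequencies stay in an interval of length O(J), so H times a frequency runs through
  O(J) periods of the weight \<open>geow\<close>.\<close>

lemma dif_phase_range:
  assumes "q > 0" "\<And>r. \<bar>j r\<bar> \<le> J" "1 / real q \<le> \<rho> / 2" and x: "\<And>i. \<bar>x $ i - x0 $ i\<bar> \<le> \<rho> / 2"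
  shows "\<bar>dif (1 / real q) i (phase j q) x - dif (1 / real q) i (phase j q) x0\<bar> \<le> of_int J * (real CARD('r) * M * real CARD('n))"
proof -
  have J0: "J \<ge> 0" using assms(2)[of undefined] by linarith
  have "\<bar>dif (1 / real q) i (phase j q) x - dif (1 / real q) i (phase j q) x0
      - (\<Sum>k\<in>UNIV. (\<Sum>r\<in>UNIV. of_int (j r) * 0) * (x $ k - x0 $ k))\<bar>
    \<le> of_int J * (real CARD('r) * M) * (\<Sum>k\<in>UNIV. \<bar>x $ k - x0 $ k\<bar>)"
  proof (rule dif_phase_linearize[OF assms(1,2) _ x _ assms(3)])
    show "\<bar>partial_deriv i (partial_deriv k (f r)) y - 0\<bar> \<le> M" if "\<And>i. \<bar>y $ i - x0 $ i\<bar> \<le> \<rho>" for k r y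
      using pders_le[of "[k, i]" y r] that n3 by simp
  qed (use rho in auto)
  also have "\<dots> \<le> of_int J * (real CARD('r) * M) * (\<Sum>k\<in>(UNIV::'n set). 1)"
    using x rho J0 M_pos by (intro mult_left_mono sum_mono) (auto intro: order.trans[OF x])
  finally show ?thesis by (simp add: algebra_simps)
qed

end

lemma prod_ecis: "(\<Prod>i\<in>I. ecis (g i)) = ecis (\<Sum>i\<in>I. g i)"
  by (induction I rule: infinite_finite_induct) (auto simp: ecis_add)

context curved_graph
begin

text \<open>The remainder is removed by Abel summation in all coordinates, which is where
  \<open>CARD('n)\<close> orders of differences are spent. Outside \<open>I\<close> the box has side
  at most 1 and the geometric sum is at most 1; inside \<open>I\<close> it is bounded by its
  weight.\<close>

lemma box_sum_le:
  assumes C: "\<And>B H. \<And>s :: ('n \<Rightarrow> nat) \<Rightarrow> real. H \<ge> 1 \<Longrightarrow>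
     dbound B CARD('n) (\<lambda>m. (real (CARD('n) * (CARD('n) + 1)))\<^sup>2 * (real CARD('r) * M) / H ^ m) s \<Longrightarrow>
     dbound B CARD('n) (\<lambda>m. C / H ^ m) (\<lambda>h. ecis (s h))" and C0: "C \<ge> 0"
    and H: "H \<ge> 1" "J * int (H\<^sup>2) \<le> int q" and J: "J \<ge> 1" "\<And>r. \<bar>j r\<bar> \<le> J"
    and x: "\<And>i. \<bar>x $ i - x0 $ i\<bar> \<le> \<rho> / 2" and q: "real (H + 2 * CARD('n) + 2) / real q \<le> \<rho> / 2"
    and m: "\<And>i. m i \<le> (if i \<in> I then H else 1)"
  shows "norm (\<Sum>h\<in>lbox UNIV m (\<lambda>_. 0). ecis (lat x (1 / real q) (phase j q) h))
     \<le> 2 ^ CARD('n) * C * (\<Prod>i\<in>I. geow H \<lfloor>real H * dif (1 / real q) i (phase j q) x\<rfloor>)"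
proof -
  define \<theta> where "\<theta> i = dif (1 / real q) i (phase j q) x" for i
  define r where "r h = lat x (1 / real q) (phase j q) h - phase j q x - (\<Sum>i\<in>UNIV. \<theta> i * real (h i))" for h
  have d: "dbound H CARD('n) (\<lambda>m. C / real H ^ m) (\<lambda>h. ecis (r h))"
    using remainder_dbound[OF H J x q] H(1) unfolding r_def \<theta>_def by (intro C) auto
  have "norm (\<Sum>h\<in>lbox UNIV m (\<lambda>_. 0). ecis (r h) * (\<Prod>i\<in>UNIV. ecis (\<theta> i * real (h i))))
     \<le> 2 ^ CARD('n) * C * (\<Prod>i\<in>UNIV. if i \<in> I then geow H \<lfloor>real H * \<theta> i\<rfloor> else 1)"
  proof (rule multi_abel_bound[where B = H and H = "real H", OF d])
    show "m i \<le> H \<and> real (m i) \<le> real H" for i using m[of i] H(1) by (auto split: if_splits)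
    show "norm (\<Sum>j<k. ecis (\<theta> i * real j)) \<le> (if i \<in> I then geow H \<lfloor>real H * \<theta> i\<rfloor> else 1)"
      if "k \<le> m i" for i k
    proof (cases "i \<in> I")
      case True
      then show ?thesis using geometric_ecis_le_geow[of H k "\<theta> i"] m[of i] that H(1) by auto
    next
      case False
      then show ?thesis using norm_geometric_ecis_le[of "\<theta> i" k] m[of i] that by auto
    qed
  qed (use C0 H in auto)
  also have "(\<Prod>i\<in>UNIV. if i \<in> I then geow H \<lfloor>real H * \<theta> i\<rfloor> else 1) = (\<Prod>i\<in>I. geow H \<lfloor>real H * \<theta> i\<rfloor>)"
    by (simp add: prod.If_cases)
  also have "(\<Sum>h\<in>lbox UNIV m (\<lambda>_. 0). ecis (r h) * (\<Prod>i\<in>UNIV. ecis (\<theta> i * real (h i))))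
    = (\<Sum>h\<in>lbox UNIV m (\<lambda>_. 0). ecis (- phase j q x) * ecis (lat x (1 / real q) (phase j q) h))"
    unfolding prod_ecis r_def ecis_add[symmetric] by (intro sum.cong) (auto simp: algebra_simps)
  finally show ?thesis by (simp add: sum_distrib_left[symmetric] norm_mult \<theta>_def)
qed

lemma exponential_sum_main:
  "\<exists>C>0. \<exists>q0. \<forall>q j J r0 A N. q \<ge> q0 \<longrightarrow> q > 0 \<longrightarrow> J \<ge> 1 \<longrightarrow> (\<forall>r. \<bar>j r\<bar> \<le> J) \<longrightarrow> \<bar>j r0\<bar> = J \<longrightarrow> J \<le> int q \<longrightarrow>
     (\<forall>i. N i \<le> 2 * q) \<longrightarrow>
     (\<forall>t\<in>lbox UNIV N (\<lambda>_. 0). \<forall>i. \<bar>(of_int (A i) + real (t i)) / real q - x0 $ i\<bar> \<le> \<rho> / 2) \<longrightarrow>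
     norm (\<Sum>t\<in>lbox UNIV N (\<lambda>_. 0). ecis (phase j q (\<chi> i. (of_int (A i) + real (t i)) / real q)))
       \<le> C * sqrt (of_int J * real q) ^ (CARD('n) - 1) * real q * (2 + ln (real q)) ^ CARD('n)"
proof -
  \<comment> \<open>\<open>S\<close> is the constant of \<open>remainder_dbound\<close>. Fixing the
    resulting \<open>C\<close> before \<open>q\<close>, \<open>j\<close> and \<open>H\<close> makes
    the final bound uniform in them.\<close>
  define S where "S = (real (CARD('n) * (CARD('n) + 1)))\<^sup>2 * (real CARD('r) * M)"
  have "S \<ge> 0" unfolding S_def using M_pos by simp
  from dbound_ecis[OF this, of "CARD('n)"] obtain C where C0: "C \<ge> 0" and C: "\<And>B H. \<And>s :: ('n \<Rightarrow> nat) \<Rightarrow> real. H \<ge> 1 \<Longrightarrow>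
     dbound B CARD('n) (\<lambda>m. S / H ^ m) s \<Longrightarrow> dbound B CARD('n) (\<lambda>m. C / H ^ m) (\<lambda>h. ecis (s h))" by blast
  define C1 where "C1 = real CARD('r) * M * real CARD('n)"
  have C1: "C1 > 0" unfolding C1_def using M_pos by (simp add: card_gt_0_iff)
  \<comment> \<open>Divided by \<open>J\<close>, the frequencies vary by at most 2 C1; the extra 2
    covers the rounding of the lower end to an integer.\<close>
  define p1 where "p1 = nat \<lceil>2 * C1\<rceil> + 2"
  \<comment> \<open>Two boxes whose frequencies share their cells satisfy \<kappa> |c k - c' k| J
    H^2 < 2 q \<le> 8 J H^2, whence 8/\<kappa>.\<close>
  define P where "P = nat \<lceil>8 / \<kappa>\<rceil>"
  \<comment> \<open>Room for the differences: a margin of H + 2n + 2 steps of length 1/q has to stay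
    below \<rho>/2, and H \<le> sqrt q.\<close>
  have "((\<lambda>q. (sqrt (real q) + real (2 * CARD('n) + 2)) / real q) \<longlongrightarrow> 0) sequentially"
    by real_asymp
  then have "\<forall>\<^sub>F q in sequentially. (sqrt (real q) + real (2 * CARD('n) + 2)) / real q < \<rho> / 2"
    using rho by (intro order_tendstoD) auto
  then obtain q0 where q0: "\<And>q. q \<ge> q0 \<Longrightarrow> (sqrt (real q) + real (2 * CARD('n) + 2)) / real q < \<rho> / 2"
    unfolding eventually_sequentially by blast
  define K where "K = 2 ^ CARD('n) * C * real ((2 * P + 1) ^ CARD('n)) * (2 * real p1) ^ CARD('n) * 2"
  have K0: "K \<ge> 0" unfolding K_def using C0 by simp
  have main: "norm (\<Sum>t\<in>lbox UNIV N (\<lambda>_. 0). ecis (phase j q (\<chi> i. (of_int (A i) + real (t i)) / real q)))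
       \<le> K * sqrt (of_int J * real q) ^ (CARD('n) - 1) * real q * (2 + ln (real q)) ^ CARD('n)"
    if q: "q \<ge> q0" "q > 0" and J: "J \<ge> 1" "\<And>r. \<bar>j r\<bar> \<le> J" "\<bar>j r0\<bar> = J" "J \<le> int q"
      and N: "\<And>i. N i \<le> 2 * q"
      and reg: "\<And>t i. t\<in>lbox UNIV N (\<lambda>_. 0) \<Longrightarrow> \<bar>(of_int (A i) + real (t i)) / real q - x0 $ i\<bar> \<le> \<rho> / 2"
    for q j J r0 A N
  proof -
    \<comment> \<open>The side that balances two demands: J H^2 \<le> q keeps the remainder bounded
      on a box, and q \<le> 4 J H^2 keeps the frequencies of neighbouring boxes a distance of order
      1/H apart.\<close>
    define H where "H = nat \<lfloor>sqrt (real q / of_int J)\<rfloor>"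
    have J0: "real_of_int J \<ge> 1" "real_of_int J \<le> real q" using J by auto
    have "sqrt (real q / of_int J) \<ge> 1" using J0 by simp
    then have H1: "H \<ge> 1" unfolding H_def by (simp add: le_nat_floor)
    have Hle: "real H \<le> sqrt (real q / of_int J)" unfolding H_def using J0 by simp
    have Hge: "sqrt (real q / of_int J) < real H + 1" unfolding H_def using J0 by linarith
    have "(real H)\<^sup>2 \<le> real q / of_int J" using power_mono[OF Hle, of 2] J0 by simp
    then have H2r: "of_int J * (real H)\<^sup>2 \<le> real q" using J0 by (simp add: field_simps)
    then have "real_of_int (J * int (H\<^sup>2)) \<le> real_of_int (int q)" by simp
    then have H2: "J * int (H\<^sup>2) \<le> int q" by (simp only: of_int_le_iff)
    have H4: "real q \<le> 4 * (real H)\<^sup>2 * of_int J"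
    proof -
      have "sqrt (real q / of_int J) \<le> 2 * real H" using Hge H1 by linarith
      then have "real q / of_int J \<le> (2 * real H)\<^sup>2" by (rule sqrt_le_D)
      then show ?thesis using J0 by (simp add: field_simps power2_eq_square)
    qed
    have "real q / of_int J \<le> real q" using J0 by (simp add: divide_le_eq mult_left_mono[of 1, simplified])
    then have Hsq: "real H \<le> sqrt (real q)" using Hle by (meson order_trans real_sqrt_le_mono)
    have qr: "real (H + 2 * CARD('n) + 2) / real q \<le> \<rho> / 2"
    proof -
      have "real (H + 2 * CARD('n) + 2) / real q \<le> (sqrt (real q) + real (2 * CARD('n) + 2)) / real q"
        using Hsq by (intro divide_right_mono) auto
      then show ?thesis using q0[OF q(1)] by linarith
    qed
    have "1 / real q \<le> real (H + 2 * CARD('n) + 2) / real q" by (intro divide_right_mono) auto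
    then have qr1: "1 / real q \<le> \<rho> / 2" using qr by linarith
    from dif_phase_separated[of J j r0, OF J(1-3)] obtain I where I: "card I \<ge> CARD('n) - 1" and
      sep: "\<And>x y k. (\<forall>i. \<bar>x $ i - x0 $ i\<bar> \<le> \<rho> / 2) \<Longrightarrow> (\<forall>i. \<bar>y $ i - x0 $ i\<bar> \<le> \<rho> / 2) \<Longrightarrow> (\<forall>i. i \<notin> I \<longrightarrow> x $ i = y $ i) \<Longrightarrow>
       \<exists>i\<in>I. \<kappa> / 2 * of_int J * \<bar>x $ k - y $ k\<bar> \<le> \<bar>dif (1 / real q) i (phase j q) x - dif (1 / real q) i (phase j q) y\<bar>"
      using q(2) qr1 by metis
    define Hs where "Hs i = (if i \<in> I then H else 1)" for i
    have Hs0: "Hs i > 0" for i using H1 by (simp add: Hs_def)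
    define Cs where "Cs = {c. \<forall>i. Hs i * c i < N i}"
    define X where "X c = (\<chi> i. (of_int (A i) + real (Hs i * c i)) / real q)" for c
    define \<theta> where "\<theta> c i = dif (1 / real q) i (phase j q) (X c)" for c i
    have X: "\<bar>X c $ i - x0 $ i\<bar> \<le> \<rho> / 2" if "c \<in> Cs" for c i
      using reg[of "\<lambda>i. Hs i * c i" i] that by (simp add: X_def Cs_def lbox_def)
    have Cs_lt: "c i < N i" if "c \<in> Cs" for c i
    proof -
      have "1 * c i \<le> Hs i * c i" using Hs0[of i] by (intro mult_right_mono) auto
      moreover have "Hs i * c i < N i" using that by (simp add: Cs_def)
      ultimately show ?thesis by linarith
    qed
    have "Cs \<subseteq> lbox UNIV N (\<lambda>_. 0)" using Cs_lt by (auto simp: lbox_def)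
    then have finC: "finite Cs" by (rule finite_subset) (simp add: finite_lbox)
    have "norm (\<Sum>t\<in>lbox UNIV N (\<lambda>_. 0). ecis (phase j q (\<chi> i. (of_int (A i) + real (t i)) / real q)))
      = norm (\<Sum>c\<in>Cs. \<Sum>h\<in>lbox UNIV (\<lambda>i. min (Hs i) (N i - Hs i * c i)) (\<lambda>_. 0). ecis (lat (X c) (1 / real q) (phase j q) h))"
    proof -
      have "(\<chi> i. (of_int (A i) + real (Hs i * c i + h i)) / real q) = X c + (1 / real q) *\<^sub>R (\<chi> i. real (h i))" for c h
        by (simp add: vec_eq_iff X_def add_divide_distrib)
      note eq = this
      have 1: "(\<Sum>t\<in>lbox UNIV N (\<lambda>_. 0). ecis (phase j q (\<chi> i. (of_int (A i) + real (t i)) / real q)))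
        = (\<Sum>c\<in>Cs. \<Sum>h\<in>lbox UNIV (\<lambda>i. min (Hs i) (N i - Hs i * c i)) (\<lambda>_. 0).
             ecis (phase j q (\<chi> i. (of_int (A i) + real (Hs i * c i + h i)) / real q)))"
        unfolding Cs_def by (rule sum_lbox_div_mod[OF Hs0])
      show ?thesis by (simp only: 1 eq lat_def)
    qed
    also have "\<dots> \<le> (\<Sum>c\<in>Cs. 2 ^ CARD('n) * C * (\<Prod>i\<in>I. geow H \<lfloor>real H * \<theta> c i\<rfloor>))"
    proof (rule order.trans[OF norm_sum], rule sum_mono)
      fix c assume c: "c \<in> Cs"
      show "norm (\<Sum>h\<in>lbox UNIV (\<lambda>i. min (Hs i) (N i - Hs i * c i)) (\<lambda>_. 0). ecis (lat (X c) (1 / real q) (phase j q) h))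
         \<le> 2 ^ CARD('n) * C * (\<Prod>i\<in>I. geow H \<lfloor>real H * \<theta> c i\<rfloor>)"
        unfolding \<theta>_def
        by (rule box_sum_le[OF C[unfolded S_def] C0 H1 H2 J(1,2) X[OF c] qr]) (auto simp: Hs_def)
    qed
    also have "\<dots> = 2 ^ CARD('n) * C * (\<Sum>c\<in>Cs. \<Prod>i\<in>I. geow H \<lfloor>real H * \<theta> c i\<rfloor>)"
      by (simp add: sum_distrib_left)
    also have "\<dots> \<le> 2 ^ CARD('n) * C * (real ((2 * P + 1) ^ CARD('n)) *
       ((real (nat J * p1) * (2 * real H * (2 + ln (real H)))) ^ card I * real (2 * q) ^ (CARD('n) - card I)))"
    proof (intro mult_left_mono sum_prod_geow_le)
      fix c i assume c: "c \<in> Cs"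
      show "i \<notin> I \<Longrightarrow> c i < 2 * q" using Cs_lt[OF c, of i] N[of i] by simp
      have r: "\<bar>\<theta> c i - dif (1 / real q) i (phase j q) x0\<bar> \<le> of_int J * C1"
        unfolding \<theta>_def C1_def by (rule dif_phase_range[OF q(2) J(2) qr1 X[OF c]])
      define a where "a = \<lfloor>dif (1 / real q) i (phase j q) x0 - of_int J * C1\<rfloor>"
      have a: "of_int a \<le> dif (1 / real q) i (phase j q) x0 - of_int J * C1"
        "dif (1 / real q) i (phase j q) x0 - of_int J * C1 < of_int a + 1" unfolding a_def by linarith+
      have "2 * C1 + 2 \<le> real p1" unfolding p1_def using C1 by linarith
      then have "of_int J * (2 * C1 + 2) \<le> of_int J * real p1" using J0 by (intro mult_left_mono) auto
      moreover have "of_int J * real p1 = of_int (int (nat J * p1))" using J by simp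
      ultimately have "of_int J * (2 * C1 + 2) \<le> real_of_int (int (nat J * p1))" by simp
      then have "2 * (of_int J * C1) + 2 \<le> real_of_int (int (nat J * p1))" using J0 by (simp add: algebra_simps)
      then show "of_int a \<le> \<theta> c i \<and> \<theta> c i < of_int (a + int (nat J * p1))"
        using a r unfolding of_int_add by linarith
    next
      fix c c' assume c: "c \<in> Cs" "c' \<in> Cs" and out: "\<And>i. i \<notin> I \<Longrightarrow> c i = c' i"
        and fl: "\<And>i. i \<in> I \<Longrightarrow> \<lfloor>real H * \<theta> c i\<rfloor> = \<lfloor>real H * \<theta> c' i\<rfloor>"
      show "\<forall>i. \<bar>int (c i) - int (c' i)\<bar> \<le> int P"
      proof
        fix k
        show "\<bar>int (c k) - int (c' k)\<bar> \<le> int P"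
        proof (cases "k \<in> I")
          case False
          then show ?thesis using out by simp
        next
          case True
          obtain i where i: "i \<in> I" "\<kappa> / 2 * of_int J * \<bar>X c $ k - X c' $ k\<bar> \<le> \<bar>\<theta> c i - \<theta> c' i\<bar>"
            unfolding \<theta>_def using sep[of "X c" "X c'" k] X c out by (auto simp: X_def)
          have "real H * \<bar>\<theta> c i - \<theta> c' i\<bar> = \<bar>real H * \<theta> c i - real H * \<theta> c' i\<bar>"
            by (simp add: abs_mult right_diff_distrib[symmetric])
          also have "\<dots> < 1" using fl[OF i(1)] by linarith
          finally have lt: "real H * \<bar>\<theta> c i - \<theta> c' i\<bar> < 1" .
          define D where "D = \<bar>real (c k) - real (c' k)\<bar>"
          have "X c $ k - X c' $ k = real H * (real (c k) - real (c' k)) / real q"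
            using True by (simp add: X_def Hs_def diff_divide_distrib[symmetric] right_diff_distrib)
          then have XD: "\<bar>X c $ k - X c' $ k\<bar> = real H * D / real q" by (simp add: D_def abs_mult)
          have "real H * (\<kappa> / 2 * of_int J * (real H * D / real q)) < 1"
            using mult_left_mono[OF i(2), of "real H"] lt unfolding XD by linarith
          then have "\<kappa> * D * (of_int J * (real H)\<^sup>2) < 2 * real q"
            using q(2) by (simp add: field_simps power2_eq_square)
          also have "\<dots> \<le> 8 * (of_int J * (real H)\<^sup>2)" using H4 by (simp add: algebra_simps)
          finally have "\<kappa> * D < 8" using J0 H1 by (simp add: mult_less_cancel_right)
          then have "D < 8 / \<kappa>" using kappa_pos by (simp add: field_simps)
          then have "D \<le> real P" unfolding P_def by linarith
          then have "real_of_int \<bar>int (c k) - int (c' k)\<bar> \<le> real_of_int (int P)" unfolding D_def by simp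
          then show ?thesis by (simp only: of_int_le_iff)
        qed
      qed
    qed (use C0 finC H1 in auto)
    finally have bound: "norm (\<Sum>t\<in>lbox UNIV N (\<lambda>_. 0). ecis (phase j q (\<chi> i. (of_int (A i) + real (t i)) / real q)))
      \<le> 2 ^ CARD('n) * C * (real ((2 * P + 1) ^ CARD('n)) *
       ((real (nat J * p1) * (2 * real H * (2 + ln (real H)))) ^ card I * real (2 * q) ^ (CARD('n) - card I)))" .
    define s where "s = sqrt (of_int J * real q)"
    define L where "L = 2 + ln (real q)"
    define W where "W = real (nat J * p1) * (2 * real H * (2 + ln (real H)))"
    have L1: "L \<ge> 1" using q(2) by (simp add: L_def)
    have s0: "s \<ge> 0" using J0 by (simp add: s_def)
    have sq: "s \<le> real q"
    proof -
      have "of_int J * real q \<le> (real q)\<^sup>2" using J0 by (simp add: power2_eq_square mult_right_mono)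
      then show ?thesis unfolding s_def by (simp add: real_le_lsqrt)
    qed
    have JH: "of_int J * real H \<le> s"
    proof -
      have "(of_int J * real H)\<^sup>2 = of_int J * (of_int J * (real H)\<^sup>2)" by (simp add: power2_eq_square)
      also have "\<dots> \<le> of_int J * real q" using H2r J0 by (intro mult_left_mono) auto
      finally show ?thesis unfolding s_def by (rule real_le_rsqrt)
    qed
    have Hq: "real H \<le> real q"
    proof -
      have "sqrt (real q) \<le> real q" using q(2) by (simp add: real_le_lsqrt power2_eq_square)
      then show ?thesis using Hsq by linarith
    qed
    then have lnH: "ln (real H) \<le> ln (real q)" using H1 by simp
    have lnH0: "ln (real H) \<ge> 0" using H1 by simp
    have W0: "W \<ge> 0" unfolding W_def using lnH0 by simp
    have p11: "2 * real p1 \<ge> 1" by (simp add: p1_def)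
    have "W = (2 * real p1) * ((of_int J * real H) * (2 + ln (real H)))"
      unfolding W_def using J by (simp add: algebra_simps)
    also have "\<dots> \<le> (2 * real p1) * (s * L)"
      using JH lnH lnH0 J0 s0 unfolding L_def by (intro mult_left_mono mult_mono) auto
    finally have WV: "W ^ k \<le> (2 * real p1) ^ k * (s ^ k * L ^ k)" for k
      using power_mono[OF _ W0, of "(2 * real p1) * (s * L)" k] by (simp add: power_mult_distrib)
    have pL: "(2 * real p1) ^ k \<le> (2 * real p1) ^ CARD('n)" "L ^ k \<le> L ^ CARD('n)" if "k \<le> CARD('n)" for k
      using power_increasing[OF that p11] power_increasing[OF that L1] by auto
    have Wk: "W ^ k \<le> (2 * real p1) ^ CARD('n) * (s ^ k * L ^ CARD('n))" if "k \<le> CARD('n)" for k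
      using pL[OF that] s0 L1 by (intro order.trans[OF WV] mult_mono mult_left_mono) auto
    \<comment> \<open>If \<open>I\<close> is everything, one factor \<open>s\<close> is estimated by
      \<open>q\<close>; otherwise the missing direction has at most 2q points. Either way s^(n-1) q
      results.\<close>
    have "card I \<le> CARD('n)" by (intro card_mono) auto
    with I consider "card I = CARD('n)" | "card I = CARD('n) - 1" by linarith
    then have key: "W ^ card I * real (2 * q) ^ (CARD('n) - card I) \<le> (2 * real p1) ^ CARD('n) * ((s ^ (CARD('n) - 1) * real q) * L ^ CARD('n)) * 2"
    proof cases
      case 1
      have "s ^ CARD('n) = s ^ (CARD('n) - 1) * s" using power_minus_mult[of "CARD('n)" s] n3 by simp
      also have "\<dots> \<le> s ^ (CARD('n) - 1) * real q" using sq s0 by (intro mult_left_mono) auto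
      finally have "(2 * real p1) ^ CARD('n) * (s ^ CARD('n) * L ^ CARD('n)) \<le> (2 * real p1) ^ CARD('n) * ((s ^ (CARD('n) - 1) * real q) * L ^ CARD('n))"
        using L1 by (intro mult_left_mono mult_right_mono) auto
      moreover have "\<dots> \<le> \<dots> * 2" using L1 s0 by simp
      moreover have "W ^ card I * real (2 * q) ^ (CARD('n) - card I) = W ^ CARD('n)" using 1 by simp
      ultimately show ?thesis using Wk[of "CARD('n)"] by linarith
    next
      case 2
      then have "CARD('n) - card I = 1" using n3 by linarith
      then have "W ^ card I * real (2 * q) ^ (CARD('n) - card I) = W ^ (CARD('n) - 1) * (2 * real q)" using 2 by simp
      also have "\<dots> \<le> (2 * real p1) ^ CARD('n) * (s ^ (CARD('n) - 1) * L ^ CARD('n)) * (2 * real q)"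
        using Wk[of "CARD('n) - 1"] by (intro mult_right_mono) auto
      finally show ?thesis by (simp add: algebra_simps)
    qed
    have "2 ^ CARD('n) * C * (real ((2 * P + 1) ^ CARD('n)) * (W ^ card I * real (2 * q) ^ (CARD('n) - card I)))
      \<le> 2 ^ CARD('n) * C * (real ((2 * P + 1) ^ CARD('n)) * ((2 * real p1) ^ CARD('n) * ((s ^ (CARD('n) - 1) * real q) * L ^ CARD('n)) * 2))"
      by (intro mult_left_mono key) (use C0 in auto)
    also have "\<dots> = K * s ^ (CARD('n) - 1) * real q * L ^ CARD('n)" by (simp add: K_def algebra_simps)
    finally show ?thesis using bound unfolding W_def[symmetric] s_def[symmetric] L_def[symmetric] by linarith
  qed
  show ?thesis
  proof (intro exI[of _ "K + 1"] conjI exI[of _ q0] allI impI)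
    fix q :: nat and j :: "'r \<Rightarrow> int" and J r0 and A :: "'n \<Rightarrow> int" and N :: "'n \<Rightarrow> nat"
    assume *: "q \<ge> q0" "q > 0" "J \<ge> 1" "\<forall>r. \<bar>j r\<bar> \<le> J" "\<bar>j r0\<bar> = J" "J \<le> int q" "\<forall>i. N i \<le> 2 * q"
      "\<forall>t\<in>lbox UNIV N (\<lambda>_. 0). \<forall>i. \<bar>(of_int (A i) + real (t i)) / real q - x0 $ i\<bar> \<le> \<rho> / 2"
    have "norm (\<Sum>t\<in>lbox UNIV N (\<lambda>_. 0). ecis (phase j q (\<chi> i. (of_int (A i) + real (t i)) / real q)))
       \<le> K * sqrt (of_int J * real q) ^ (CARD('n) - 1) * real q * (2 + ln (real q)) ^ CARD('n)"
      by (rule main[of q J j r0 N A]) (use * in blast)+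
    also have "\<dots> \<le> (K + 1) * sqrt (of_int J * real q) ^ (CARD('n) - 1) * real q * (2 + ln (real q)) ^ CARD('n)"
      using * by (intro mult_right_mono) auto
    finally show "norm (\<Sum>t\<in>lbox UNIV N (\<lambda>_. 0). ecis (phase j q (\<chi> i. (of_int (A i) + real (t i)) / real q)))
       \<le> (K + 1) * sqrt (of_int J * real q) ^ (CARD('n) - 1) * real q * (2 + ln (real q)) ^ CARD('n)" .
  qed (use K0 in auto)
qed

text \<open>For J > q the right-hand side dominates the trivial bound (2q)^n up to the factor 2^n,
  because then sqrt(J q) \<ge> q; the finitely many small \<open>q\<close> go into the constant. The
  restrictions of \<open>exponential_sum_main\<close> thus disappear.\<close>

theorem exponential_sum_bound:
  "\<exists>C>0. \<forall>q j J r0 A N. q > 0 \<longrightarrow> J \<ge> 1 \<longrightarrow> (\<forall>r. \<bar>j r\<bar> \<le> J) \<longrightarrow> \<bar>j r0\<bar> = J \<longrightarrow>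
     (\<forall>i. N i \<le> 2 * q) \<longrightarrow>
     (\<forall>t\<in>lbox UNIV N (\<lambda>_. 0). \<forall>i. \<bar>(of_int (A i) + real (t i)) / real q - x0 $ i\<bar> \<le> \<rho> / 2) \<longrightarrow>
     norm (\<Sum>t\<in>lbox UNIV N (\<lambda>_. 0). ecis (phase j q (\<chi> i. (of_int (A i) + real (t i)) / real q)))
       \<le> C * sqrt (of_int J * real q) ^ (CARD('n) - 1) * real q * (2 + ln (real q)) ^ CARD('n)"
proof -
  obtain C q0 where C: "C > 0" and main: "\<And>q j J r0 A N. q \<ge> q0 \<Longrightarrow> q > 0 \<Longrightarrow> J \<ge> 1 \<Longrightarrow> (\<forall>r. \<bar>j r\<bar> \<le> J) \<Longrightarrow> \<bar>j r0\<bar> = J \<Longrightarrow> J \<le> int q \<Longrightarrow>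
     (\<forall>i. N i \<le> 2 * q) \<Longrightarrow>
     (\<forall>t\<in>lbox UNIV N (\<lambda>_. 0). \<forall>i. \<bar>(of_int (A i) + real (t i)) / real q - x0 $ i\<bar> \<le> \<rho> / 2) \<Longrightarrow>
     norm (\<Sum>t\<in>lbox UNIV N (\<lambda>_. 0). ecis (phase j q (\<chi> i. (of_int (A i) + real (t i)) / real q)))
       \<le> C * sqrt (of_int J * real q) ^ (CARD('n) - 1) * real q * (2 + ln (real q)) ^ CARD('n)"
    using exponential_sum_main by blast
  define C' where "C' = max C ((2 * real (max 1 q0)) ^ CARD('n))"
  show ?thesis
  proof (intro exI[of _ C'] conjI allI impI)
    show "C' > 0" using C by (simp add: C'_def)
    fix q :: nat and j :: "'r \<Rightarrow> int" and J r0 and A :: "'n \<Rightarrow> int" and N :: "'n \<Rightarrow> nat"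
    assume *: "q > 0" "J \<ge> 1" "\<forall>r. \<bar>j r\<bar> \<le> J" "\<bar>j r0\<bar> = J" "\<forall>i. N i \<le> 2 * q"
      "\<forall>t\<in>lbox UNIV N (\<lambda>_. 0). \<forall>i. \<bar>(of_int (A i) + real (t i)) / real q - x0 $ i\<bar> \<le> \<rho> / 2"
    let ?S = "norm (\<Sum>t\<in>lbox UNIV N (\<lambda>_. 0). ecis (phase j q (\<chi> i. (of_int (A i) + real (t i)) / real q)))"
    let ?s = "sqrt (of_int J * real q) ^ (CARD('n) - 1) * real q * (2 + ln (real q)) ^ CARD('n)"
    have J1: "real_of_int J \<ge> 1" using *(2) by simp
    have q1: "real q \<ge> 1" using *(1) by simp
    have L: "(2 + ln (real q)) ^ CARD('n) \<ge> 1" using q1 by (intro one_le_power) auto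
    have Jq: "of_int J * real q \<ge> 1" using mult_mono[OF J1 q1] J1 by simp
    have s0: "?s \<ge> 0" using Jq L by simp
    have "lbox UNIV N (\<lambda>_. 0) = PiE UNIV (\<lambda>i. {..<N i})" by (auto simp: lbox_def PiE_def)
    then have "card (lbox UNIV N (\<lambda>_. 0)) = (\<Prod>i\<in>UNIV. N i)" by (simp add: card_PiE)
    also have "\<dots> \<le> (\<Prod>i\<in>(UNIV::'n set). 2 * q)" using * by (intro prod_mono) auto
    finally have "card (lbox UNIV N (\<lambda>_. 0)) \<le> (2 * q) ^ CARD('n)" by simp
    then have "real (card (lbox UNIV N (\<lambda>_. 0))) \<le> (2 * real q) ^ CARD('n)"
      by (metis of_nat_le_iff of_nat_mult of_nat_numeral of_nat_power)
    moreover have "?S \<le> real (card (lbox UNIV N (\<lambda>_. 0)))"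
      by (rule order.trans[OF norm_sum]) simp
    ultimately have triv: "?S \<le> (2 * real q) ^ CARD('n)" by linarith
    have "?S \<le> C' * ?s"
    proof (cases "q \<ge> q0 \<and> J \<le> int q")
      case True
      have "?S \<le> C * ?s" using main[of q J j r0 N A] True * by (simp add: mult.assoc)
      also have "\<dots> \<le> C' * ?s" using s0 by (intro mult_right_mono) (auto simp: C'_def)
      finally show ?thesis .
    next
      case False
      then consider "q < q0" | "J > int q" by linarith
      then show ?thesis
      proof cases
        case 1
        have "(2 * real q) ^ CARD('n) \<le> (2 * real (max 1 q0)) ^ CARD('n)"
          using 1 by (intro power_mono) auto
        then have "?S \<le> (2 * real (max 1 q0)) ^ CARD('n) * 1" using triv by linarith
        also have "\<dots> \<le> C' * ?s"
        proof (rule mult_mono)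
          have "sqrt (of_int J * real q) ^ (CARD('n) - 1) \<ge> 1" using Jq by (intro one_le_power) simp
          from mult_mono[OF this q1] this have "sqrt (of_int J * real q) ^ (CARD('n) - 1) * real q \<ge> 1" by simp
          from mult_mono[OF this L] this show "1 \<le> ?s" by simp
        qed (use C in \<open>auto simp: C'_def\<close>)
        finally show ?thesis .
      next
        case 2
        then have "real q \<le> of_int J" by linarith
        then have "(real q)\<^sup>2 \<le> of_int J * real q" by (simp add: power2_eq_square mult_right_mono)
        then have qs: "real q \<le> sqrt (of_int J * real q)" by (rule real_le_rsqrt)
        have "(2 * real q) ^ CARD('n) = 2 ^ CARD('n) * (real q ^ (CARD('n) - 1) * real q)"
          using power_minus_mult[of "CARD('n)" "real q"] n3 by (simp add: power_mult_distrib)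
        also have "\<dots> \<le> 2 ^ CARD('n) * (sqrt (of_int J * real q) ^ (CARD('n) - 1) * real q)"
          using qs by (intro mult_left_mono mult_right_mono power_mono) auto
        also have "\<dots> \<le> 2 ^ CARD('n) * ?s"
        proof (rule mult_left_mono)
          have "sqrt (of_int J * real q) ^ (CARD('n) - 1) * real q \<ge> 0" using Jq by simp
          from mult_left_mono[OF L this] show "sqrt (of_int J * real q) ^ (CARD('n) - 1) * real q \<le> ?s" by simp
        qed simp
        also have "\<dots> \<le> C' * ?s"
        proof (rule mult_right_mono[OF _ s0])
          have "(2::real) ^ CARD('n) \<le> (2 * real (max 1 q0)) ^ CARD('n)" by (intro power_mono) auto
          then show "2 ^ CARD('n) \<le> C'" unfolding C'_def by (rule max.coboundedI2)
        qed
        finally show ?thesis using triv by linarith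
      qed
    qed
    then show "?S \<le> C' * sqrt (of_int J * real q) ^ (CARD('n) - 1) * real q * (2 + ln (real q)) ^ CARD('n)"
      by (simp add: mult.assoc)
  qed
qed

end

section \<open>Trigonometric approximation of intervals modulo one\<close>

definition trig_poly :: "nat \<Rightarrow> (int \<Rightarrow> complex) \<Rightarrow> real \<Rightarrow> complex" where
  "trig_poly D c y = (\<Sum>k\<in>{- int D..int D}. c k * ecis (of_int k * y))"

lemma trig_poly_mult: "\<exists>c. \<forall>y. trig_poly D1 c1 y * trig_poly D2 c2 y = trig_poly (D1 + D2) c y"
proof -
  define S where "S = {- int D1..int D1} \<times> {- int D2..int D2}"
  define c where "c k = (\<Sum>p\<in>{p \<in> S. fst p + snd p = k}. c1 (fst p) * c2 (snd p))" for k
  have "trig_poly D1 c1 y * trig_poly D2 c2 y = trig_poly (D1 + D2) c y" for y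
  proof -
    have "trig_poly D1 c1 y * trig_poly D2 c2 y = (\<Sum>p\<in>S. (c1 (fst p) * c2 (snd p)) * ecis (of_int (fst p + snd p) * y))"
      unfolding trig_poly_def S_def sum_product sum.cartesian_product
      by (intro sum.cong) (auto simp: ecis_add algebra_simps)
    also have "\<dots> = (\<Sum>k\<in>{- int (D1 + D2)..int (D1 + D2)}. \<Sum>p\<in>{p \<in> S. fst p + snd p = k}. (c1 (fst p) * c2 (snd p)) * ecis (of_int (fst p + snd p) * y))"
      by (rule sum.group[symmetric]) (auto simp: S_def)
    also have "\<dots> = trig_poly (D1 + D2) c y"
      unfolding trig_poly_def c_def sum_distrib_right by (intro sum.cong) auto
    finally show ?thesis .
  qed
  then show ?thesis by blast
qed

lemma trig_poly_power: "\<exists>c'. \<forall>y. trig_poly D c y ^ m = trig_poly (m * D) c' y"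
proof (induction m)
  case 0
  show ?case by (intro exI[of _ "\<lambda>_. 1"]) (simp add: trig_poly_def)
next
  case (Suc m)
  then obtain c' where "\<forall>y. trig_poly D c y ^ m = trig_poly (m * D) c' y" by blast
  then show ?case using trig_poly_mult[of D c "m * D" c'] by simp
qed

lemma geometric_is_trig_poly: "\<exists>c. \<forall>y. (\<Sum>j<N. ecis (s * y * real j)) = trig_poly N c y" if "s = 1 \<or> s = -1"
proof -
  define c where "c k = (if s * of_int k \<ge> 0 \<and> \<bar>k\<bar> < int N then 1 else 0 :: complex)" for k :: int
  have "(\<Sum>j<N. ecis (s * y * real j)) = trig_poly N c y" for y
  proof -
    have "trig_poly N c y = (\<Sum>k\<in>{k. s * of_int k \<ge> 0 \<and> \<bar>k\<bar> < int N}. ecis (of_int k * y))"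
      unfolding trig_poly_def c_def by (rule sum.mono_neutral_cong_right) auto
    also have "\<dots> = (\<Sum>j<N. ecis (s * y * real j))"
      using that
    proof
      assume s: "s = 1"
      show ?thesis
        by (rule sum.reindex_bij_witness[of _ int nat]) (auto simp: s mult.commute)
    next
      assume s: "s = -1"
      show ?thesis
        by (rule sum.reindex_bij_witness[of _ "\<lambda>j. - int j" "\<lambda>k. nat (- k)"]) (auto simp: s mult.commute)
    qed
    finally show ?thesis by simp
  qed
  then show ?thesis by blast
qed

lemma ecis_orthogonal:
  assumes "L > 0" "\<bar>k\<bar> < int L"
  shows "(\<Sum>l<L. ecis (of_int k * (real l / real L))) = (if k = 0 then of_nat L else 0)"
proof (cases "k = 0")
  case False
  define \<theta> where "\<theta> = of_int k / real L"
  have "(ecis \<theta> - 1) * (\<Sum>j<L. ecis (\<theta> * real j)) = ecis (\<theta> * real L) - 1"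
    for L by (induction L) (auto simp: algebra_simps ecis_add[symmetric])
  moreover have "ecis (\<theta> * real L) = 1" using assms by (simp add: \<theta>_def)
  moreover have "ecis \<theta> - 1 \<noteq> 0"
  proof -
    have "\<bar>\<theta>\<bar> < 1" using assms by (simp add: \<theta>_def)
    moreover have "\<theta> \<noteq> 0" using assms False by (simp add: \<theta>_def)
    ultimately have "0 < pi * \<bar>\<theta>\<bar>" "pi * \<bar>\<theta>\<bar> < pi" by auto
    then have "sin (pi * \<bar>\<theta>\<bar>) > 0" by (intro sin_gt_zero) auto
    then have "norm (ecis \<theta> - 1) \<noteq> 0" unfolding norm_ecis_minus_1 by (auto simp: abs_if split: if_splits)
    then show ?thesis by simp
  qed
  ultimately have "(ecis \<theta> - 1) * (\<Sum>j<L. ecis (\<theta> * real j)) = 0" by (simp only: cancel_comm_monoid_add_class.diff_cancel)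
  then have "(\<Sum>j<L. ecis (\<theta> * real j)) = 0" using \<open>ecis \<theta> - 1 \<noteq> 0\<close> by (simp only: mult_eq_0_iff) simp
  then show ?thesis using False by (simp add: \<theta>_def)
qed auto

lemma ecis_uminus: "ecis (- x) = cnj (ecis x)"
  by (simp add: ecis_def cis_cnj)

text \<open>An unnormalised power of the Fejer kernel; m = 2 is Jackson's. An even power of a
  modulus is nonnegative and, written as a power of \<open>T y * cnj (T y)\<close>, a trigonometric
  polynomial. Its ratio of tail to peak is (N d)^(-2m), so a large \<open>m\<close> beats any fixed
  power of \<open>Q\<close>.\<close>

lemma jackson_kernel:
  assumes "N > 0"
  obtains c :: "int \<Rightarrow> complex" and K :: "real \<Rightarrow> real"
  where "\<And>y. complex_of_real (K y) = trig_poly (m * (2 * N)) c y" "\<And>y. K y \<ge> 0" "K 0 = real N ^ (2 * m)"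
    "\<And>y d. d > 0 \<Longrightarrow> (\<And>b. \<bar>y - of_int b\<bar> \<ge> d) \<Longrightarrow> K y \<le> 1 / d ^ (2 * m)"
proof -
  define T where "T y = (\<Sum>j<N. ecis (y * real j))" for y
  define K where "K y = norm (T y) ^ (2 * m)" for y
  obtain c1 where c1: "\<And>y. T y = trig_poly N c1 y"
    using geometric_is_trig_poly[of 1 N] by (auto simp: T_def)
  obtain c2 where c2: "\<And>y. cnj (T y) = trig_poly N c2 y"
    using geometric_is_trig_poly[of "-1" N] by (auto simp: T_def ecis_uminus)
  obtain c3 where c3: "\<And>y. T y * cnj (T y) = trig_poly (N + N) c3 y"
    using trig_poly_mult[of N c1 N c2] unfolding c1[symmetric] c2[symmetric] by blast
  obtain c where c: "\<And>y. (T y * cnj (T y)) ^ m = trig_poly (m * (N + N)) c y"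
    using trig_poly_power[of "N + N" c3 m] unfolding c3[symmetric] by blast
  show thesis
  proof (rule that)
    show "complex_of_real (K y) = trig_poly (m * (2 * N)) c y" for y
    proof -
      have "complex_of_real (K y) = (T y * cnj (T y)) ^ m"
        unfolding K_def complex_norm_square[symmetric] by (simp add: power_mult)
      then show ?thesis by (simp add: c mult_2)
    qed
    show "K y \<ge> 0" for y by (simp add: K_def)
    show "K 0 = real N ^ (2 * m)" by (simp add: K_def T_def)
    show "K y \<le> 1 / d ^ (2 * m)" if "d > 0" "\<And>b. \<bar>y - of_int b\<bar> \<ge> d" for y d
    proof -
      have "\<bar>sin (pi * y)\<bar> \<ge> d"
      proof (rule abs_sin_pi_ge)
        show "d \<le> frac y" using that(2)[of "\<lfloor>y\<rfloor>"] by (simp add: frac_def)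
        show "frac y \<le> 1 - d" using that(2)[of "\<lfloor>y\<rfloor> + 1"] unfolding frac_def by linarith
      qed (use that in simp)
      then have "norm (T y) \<le> 1 / \<bar>sin (pi * y)\<bar>" "1 / \<bar>sin (pi * y)\<bar> \<le> 1 / d"
        using that(1) unfolding T_def
        by (intro norm_geometric_ecis, force, intro divide_left_mono mult_pos_pos, auto)
      then have "norm (T y) ^ (2 * m) \<le> (1 / d) ^ (2 * m)" by (intro power_mono) auto
      then show ?thesis by (simp add: K_def power_one_over)
    qed
  qed
qed

text \<open>The points near the integer 1 wrap around to the upper end of the grid, so there are
  2F+1 of them with F = \<lfloor>w L\<rfloor>.\<close>

lemma grid_near_int_card:
  assumes "0 < w" "w < 1 / 2" "L > 0"
  defines "\<Lambda> \<equiv> {l. l < L \<and> (\<exists>b::int. \<bar>real l / real L - of_int b\<bar> \<le> w)}"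
  shows "2 * w * real L - 1 \<le> real (card \<Lambda>)" "real (card \<Lambda>) \<le> 2 * w * real L + 1"
proof -
  define F where "F = nat \<lfloor>w * real L\<rfloor>"
  have F: "real F \<le> w * real L" "w * real L < real F + 1" unfolding F_def using assms by (auto simp: of_nat_nat) 
  have "w * real L < 1 / 2 * real L" using assms by (intro mult_strict_right_mono) auto
  then have F2: "2 * F < L" using F(1) by linarith
  have "\<Lambda> = {0..F} \<union> {L - F..<L}"
  proof (intro equalityI subsetI)
    fix l assume "l \<in> \<Lambda>"
    then obtain b where l: "l < L" and b: "\<bar>real l / real L - of_int b\<bar> \<le> w" by (auto simp: \<Lambda>_def)
    have r: "0 \<le> real l / real L" "real l / real L < 1" using l by auto
    have "real_of_int b < 2" "-1 < real_of_int b" using r b assms(1,2) by linarith+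
    then have "b = 0 \<or> b = 1" by linarith
    then show "l \<in> {0..F} \<union> {L - F..<L}"
    proof
      assume "b = 0"
      then have "real l / real L \<le> w" using b by simp
      then have "real l \<le> w * real L" using assms by (simp add: field_simps)
      then have "l \<le> F" using F by linarith
      then show ?thesis by simp
    next
      assume "b = 1"
      then have "1 - w \<le> real l / real L" using b by simp
      then have "real L - w * real L \<le> real l" using assms by (simp add: field_simps)
      then have "L \<le> l + F" using F by linarith
      then show ?thesis using l by auto
    qed
  next
    fix l assume "l \<in> {0..F} \<union> {L - F..<L}"
    then show "l \<in> \<Lambda>"
    proof
      assume "l \<in> {0..F}"
      then have "real l \<le> w * real L" "l < L" using F F2 by auto
      then have "\<bar>real l / real L - of_int 0\<bar> \<le> w" using assms by (simp add: field_simps)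
      then show ?thesis using \<open>l < L\<close> unfolding \<Lambda>_def by blast
    next
      assume "l \<in> {L - F..<L}"
      then have l: "l < L" "L \<le> l + F" by auto
      then have "real L - w * real L \<le> real l" using F by linarith
      then have "1 - w \<le> real l / real L" using assms by (simp add: field_simps)
      moreover have "real l / real L \<le> 1" using l by simp
      ultimately have "\<bar>real l / real L - of_int 1\<bar> \<le> w" by simp
      then show ?thesis using \<open>l < L\<close> unfolding \<Lambda>_def by blast
    qed
  qed
  moreover have "card ({0..F} \<union> {L - F..<L}) = 2 * F + 1"
    using F2 by (subst card_Un_disjoint) auto
  ultimately have "real (card \<Lambda>) = 2 * real F + 1" by simp
  then show "2 * w * real L - 1 \<le> real (card \<Lambda>)" "real (card \<Lambda>) \<le> 2 * w * real L + 1" using F by linarith+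
qed

text \<open>\<open>P\<close> is the convolution of the Jackson kernel with the indicator of the points \<open>l/L\<close> at distance at
  most \<open>w\<close> from the integers; on a finite grid, orthogonality of characters takes the place of
  integration.\<close>

lemma trig_poly_indicator_approx:
  assumes N: "N > 0" and d: "d > 0" and L: "L > 2 * (m * (2 * N))" and w: "0 < w" "w < 1 / 2"
  defines "D \<equiv> m * (2 * N)"
  defines "\<tau> \<equiv> (2 * real D + 1) / (real N * d) ^ (2 * m)"
  obtains p :: "int \<Rightarrow> complex" and P :: "real \<Rightarrow> real" and p0 :: real
  where "\<And>y. complex_of_real (P y) = trig_poly D p y" "\<And>y. 0 \<le> P y" "\<And>y. P y \<le> 1"
    "p 0 = of_real p0" "\<And>k. norm (p k) \<le> p0" "\<bar>p0 - 2 * w\<bar> \<le> 1 / real L"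
    "\<And>y b. \<bar>y - of_int b\<bar> \<le> w - d \<Longrightarrow> P y \<ge> 1 - \<tau>"
    "\<And>y. \<forall>b::int. \<bar>y - of_int b\<bar> \<ge> w + d \<Longrightarrow> P y \<le> \<tau>"
proof -
  have ecis_mult_diff: "ecis (of_int (k' - k) * u) = ecis (of_int k' * u) * ecis (- of_int k * u)" for k k' u
    by (simp add: ecis_add[symmetric] left_diff_distrib)
  have ecis_mult_diff': "ecis (of_int k * (y - u)) = ecis (of_int k * y) * ecis (of_int (- k) * u)" for k y u
    by (simp add: ecis_add[symmetric] right_diff_distrib)
  have L0: "L > 0" using L by simp
  \<comment> \<open>\<open>L\<close> exceeds the span 2D of all frequency differences, so distinct
    frequencies remain distinct on the grid.\<close>
  have L2: "2 * D < L" using L by (simp add: D_def)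
  from jackson_kernel[OF N, of m] obtain c K where
    cK: "\<And>y. complex_of_real (K y) = trig_poly D c y" and K0: "\<And>y. K y \<ge> 0" and KN: "K 0 = real N ^ (2 * m)"
    and Kd: "\<And>y. (\<And>b. \<bar>y - of_int b\<bar> \<ge> d) \<Longrightarrow> K y \<le> 1 / d ^ (2 * m)"
    using d unfolding D_def by metis
  define c0 where "c0 = (\<Sum>l<L. K (real l / real L)) / real L"
  have coef: "of_nat L * c k = (\<Sum>l<L. complex_of_real (K (real l / real L)) * ecis (- of_int k * (real l / real L)))"
    if k: "k \<in> {- int D..int D}" for k
  proof -
    have "(\<Sum>l<L. complex_of_real (K (real l / real L)) * ecis (- of_int k * (real l / real L)))
      = (\<Sum>l<L. \<Sum>k'\<in>{- int D..int D}. c k' * ecis (of_int (k' - k) * (real l / real L)))"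
      unfolding cK trig_poly_def sum_distrib_right
      by (intro sum.cong) (simp_all only: mult.assoc ecis_mult_diff)
    also have "\<dots> = (\<Sum>k'\<in>{- int D..int D}. c k' * (\<Sum>l<L. ecis (of_int (k' - k) * (real l / real L))))"
      by (subst sum.swap) (simp add: sum_distrib_left)
    also have "\<dots> = (\<Sum>k'\<in>{- int D..int D}. if k' = k then c k * of_nat L else 0)"
    proof (intro sum.cong refl)
      fix k' assume "k' \<in> {- int D..int D}"
      then have "\<bar>k' - k\<bar> < int L" using k L2 by auto
      from ecis_orthogonal[OF L0 this] show "c k' * (\<Sum>l<L. ecis (of_int (k' - k) * (real l / real L))) = (if k' = k then c k * of_nat L else 0)"
        by auto
    qed
    also have "\<dots> = of_nat L * c k" using k by simp
    finally show ?thesis by simp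
  qed
  have c0: "c 0 = of_real c0"
  proof -
    have "of_nat L * c 0 = complex_of_real (\<Sum>l<L. K (real l / real L))" using coef[of 0] by simp
    then show ?thesis using L0 by (simp add: c0_def field_simps)
  qed
  have ck: "norm (c k) \<le> c0" if "k \<in> {- int D..int D}" for k
  proof -
    have "real L * norm (c k) = norm (of_nat L * c k)" by (simp add: norm_mult)
    also have "\<dots> \<le> (\<Sum>l<L. norm (complex_of_real (K (real l / real L)) * ecis (- of_int k * (real l / real L))))"
      unfolding coef[OF that] by (rule norm_sum)
    also have "\<dots> = (\<Sum>l<L. K (real l / real L))" using K0 by (simp add: norm_mult)
    finally show ?thesis using L0 by (simp add: c0_def field_simps)
  qed
  \<comment> \<open>Since the kernel is nonnegative, its mean is its largest coefficient; hence the
    peak is at most 2D+1 times the mean, and this is the numerator of \<tau>.\<close>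
  have c0N: "real N ^ (2 * m) \<le> (2 * real D + 1) * c0"
  proof -
    have "real N ^ (2 * m) = norm (complex_of_real (K 0))" by (simp add: KN norm_power)
    also have "\<dots> \<le> (\<Sum>k\<in>{- int D..int D}. norm (c k * ecis (of_int k * 0)))"
      unfolding cK trig_poly_def by (rule norm_sum)
    also have "\<dots> \<le> (\<Sum>k\<in>{- int D..int D}. c0)" using ck by (intro sum_mono) (simp add: norm_mult)
    finally show ?thesis by simp
  qed
  have "real N ^ (2 * m) > 0" using N by simp
  then have "(2 * real D + 1) * c0 > 0" using c0N by linarith
  then have c0pos: "c0 > 0" by (simp add: zero_less_mult_iff)
  have shift: "(\<Sum>l<L. K (y - real l / real L)) = real L * c0" for y
  proof -
    have "complex_of_real (\<Sum>l<L. K (y - real l / real L)) = (\<Sum>l<L. \<Sum>k\<in>{- int D..int D}. c k * ecis (of_int k * y) * ecis (of_int (- k) * (real l / real L)))"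
      unfolding of_real_sum cK trig_poly_def
      by (intro sum.cong) (simp_all only: mult.assoc ecis_mult_diff')
    also have "\<dots> = (\<Sum>k\<in>{- int D..int D}. c k * ecis (of_int k * y) * (\<Sum>l<L. ecis (of_int (- k) * (real l / real L))))"
      by (subst sum.swap) (simp add: sum_distrib_left)
    also have "\<dots> = (\<Sum>k\<in>{- int D..int D}. if k = 0 then c 0 * of_nat L else 0)"
    proof (intro sum.cong refl)
      fix k assume "k \<in> {- int D..int D}"
      then have "\<bar>- k\<bar> < int L" using L2 by auto
      from ecis_orthogonal[OF L0 this] show "c k * ecis (of_int k * y) * (\<Sum>l<L. ecis (of_int (- k) * (real l / real L))) = (if k = 0 then c 0 * of_nat L else 0)"
        by auto
    qed
    also have "\<dots> = complex_of_real (real L * c0)" by (simp add: c0)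
    finally show ?thesis by (simp only: of_real_eq_iff)
  qed
  define \<Lambda> where "\<Lambda> = {l. l < L \<and> (\<exists>b::int. \<bar>real l / real L - of_int b\<bar> \<le> w)}"
  have fin: "finite \<Lambda>" "\<Lambda> \<subseteq> {..<L}" unfolding \<Lambda>_def by auto
  define P where "P y = (\<Sum>l\<in>\<Lambda>. K (y - real l / real L)) / (real L * c0)" for y
  define p where "p k = (if k \<in> {- int D..int D} then c k * (\<Sum>l\<in>\<Lambda>. ecis (of_int (- k) * (real l / real L))) / (of_nat L * of_real c0) else 0)" for k
  define p0 where "p0 = real (card \<Lambda>) / real L"
  have far: "(\<Sum>l\<in>X. K (y - real l / real L)) / (real L * c0) \<le> \<tau>"
    if "X \<subseteq> {..<L}" "\<And>l b. l \<in> X \<Longrightarrow> \<bar>y - real l / real L - of_int b\<bar> \<ge> d" for X y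
  proof -
    have "(\<Sum>l\<in>X. K (y - real l / real L)) \<le> (\<Sum>l\<in>X. 1 / d ^ (2 * m))"
      by (intro sum_mono Kd that(2))
    also have "\<dots> = real (card X) * (1 / d ^ (2 * m))" by simp
    also have "\<dots> \<le> real L * (1 / d ^ (2 * m))"
      using card_mono[OF _ that(1)] d by (intro mult_right_mono) auto
    finally have "(\<Sum>l\<in>X. K (y - real l / real L)) / (real L * c0) \<le> real L * (1 / d ^ (2 * m)) / (real L * c0)"
      using c0pos by (intro divide_right_mono) auto
    also have "\<dots> = 1 / d ^ (2 * m) / c0" using L0 by simp
    also have "\<dots> \<le> \<tau>"
      unfolding \<tau>_def power_mult_distrib using c0N c0pos N d by (simp add: field_simps)
    finally show ?thesis .
  qed
  show thesis
  proof (rule that)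
    show "complex_of_real (P y) = trig_poly D p y" for y
    proof -
      have "complex_of_real (\<Sum>l\<in>\<Lambda>. K (y - real l / real L)) = (\<Sum>l\<in>\<Lambda>. \<Sum>k\<in>{- int D..int D}. c k * ecis (of_int k * y) * ecis (of_int (- k) * (real l / real L)))"
        unfolding of_real_sum cK trig_poly_def
        by (intro sum.cong) (simp_all only: mult.assoc ecis_mult_diff')
      also have "\<dots> = (\<Sum>k\<in>{- int D..int D}. c k * ecis (of_int k * y) * (\<Sum>l\<in>\<Lambda>. ecis (of_int (- k) * (real l / real L))))"
        by (subst sum.swap) (simp add: sum_distrib_left)
      finally have "complex_of_real (P y) = (\<Sum>k\<in>{- int D..int D}. c k * ecis (of_int k * y) * (\<Sum>l\<in>\<Lambda>. ecis (of_int (- k) * (real l / real L)))) / (of_nat L * of_real c0)"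
        unfolding P_def by simp
      also have "\<dots> = trig_poly D p y"
        unfolding trig_poly_def p_def sum_divide_distrib by (intro sum.cong) auto
      finally show ?thesis .
    qed
    show P0: "0 \<le> P y" for y unfolding P_def using K0 c0pos by (intro divide_nonneg_nonneg sum_nonneg) auto
    \<comment> \<open>The total mass is 1, so \<open>P y\<close> is close to 1 as soon as all grid
      points outside \<open>\<Lambda>\<close> are far from \<open>y\<close>.\<close>
    have split: "P y + (\<Sum>l\<in>{..<L} - \<Lambda>. K (y - real l / real L)) / (real L * c0) = 1" for y
    proof -
      have "(\<Sum>l\<in>\<Lambda>. K (y - real l / real L)) + (\<Sum>l\<in>{..<L} - \<Lambda>. K (y - real l / real L)) = real L * c0"
        unfolding shift[of y, symmetric] using sum.subset_diff[OF fin(2), of "\<lambda>l. K (y - real l / real L)"] by simp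
      then show ?thesis unfolding P_def add_divide_distrib[symmetric] using L0 c0pos by simp
    qed
    show "P y \<le> 1" for y
    proof -
      have "(\<Sum>l\<in>{..<L} - \<Lambda>. K (y - real l / real L)) / (real L * c0) \<ge> 0"
        using K0 c0pos by (intro divide_nonneg_nonneg sum_nonneg) auto
      then show ?thesis using split[of y] by linarith
    qed
    show "p 0 = of_real p0" using L0 c0pos by (simp add: p_def c0 p0_def)
    show "norm (p k) \<le> p0" for k
    proof (cases "k \<in> {- int D..int D}")
      case True
      have "norm (\<Sum>l\<in>\<Lambda>. ecis (of_int (- k) * (real l / real L))) \<le> real (card \<Lambda>)"
        by (rule order.trans[OF norm_sum]) simp
      then have "norm (c k) * norm (\<Sum>l\<in>\<Lambda>. ecis (of_int (- k) * (real l / real L))) \<le> c0 * real (card \<Lambda>)"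
        using ck[OF True] c0pos by (intro mult_mono) auto
      then have "norm (c k) * norm (\<Sum>l\<in>\<Lambda>. ecis (of_int (- k) * (real l / real L))) / (real L * c0) \<le> c0 * real (card \<Lambda>) / (real L * c0)"
        using c0pos by (intro divide_right_mono) auto
      also have "\<dots> = p0" using c0pos by (simp add: p0_def)
      finally show ?thesis using True c0pos by (simp add: p_def norm_mult norm_divide)
    qed (auto simp: p_def p0_def)
    have "\<bar>real (card \<Lambda>) - 2 * w * real L\<bar> \<le> 1"
      using grid_near_int_card[OF w L0] unfolding \<Lambda>_def[symmetric] by linarith
    moreover have "p0 - 2 * w = (real (card \<Lambda>) - 2 * w * real L) / real L"
      using L0 by (simp add: p0_def field_simps)
    ultimately show "\<bar>p0 - 2 * w\<bar> \<le> 1 / real L" using L0 by (simp add: divide_right_mono)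
    show "P y \<ge> 1 - \<tau>" if "\<bar>y - of_int b\<bar> \<le> w - d" for y b
    proof -
      have "(\<Sum>l\<in>{..<L} - \<Lambda>. K (y - real l / real L)) / (real L * c0) \<le> \<tau>"
      proof (rule far)
        fix l b' assume "l \<in> {..<L} - \<Lambda>"
        then have "\<not> \<bar>real l / real L - of_int (b - b')\<bar> \<le> w" unfolding \<Lambda>_def by blast
        then show "\<bar>y - real l / real L - of_int b'\<bar> \<ge> d" using that by simp
      qed auto
      then show ?thesis using split[of y] by linarith
    qed
    show "P y \<le> \<tau>" if "\<forall>b::int. \<bar>y - of_int b\<bar> \<ge> w + d" for y
      unfolding P_def
    proof (rule far[OF fin(2)])
      fix l b assume "l \<in> \<Lambda>"
      then obtain b1 where b1: "\<bar>real l / real L - of_int b1\<bar> \<le> w" unfolding \<Lambda>_def by blast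
      then show "\<bar>y - real l / real L - of_int b\<bar> \<ge> d" using that[rule_format, of "b + b1"] by simp
    qed
  qed
qed

section \<open>Equidistribution in grid cubes\<close>

text \<open>Half-open, so that the cubes of one mesh partition the space.\<close>

definition grid_cube :: "real \<Rightarrow> ('c \<Rightarrow> int) \<Rightarrow> (real ^ 'c::finite) set" where
  "grid_cube \<eta> k = {z. \<forall>c. \<eta> * of_int (k c) \<le> z $ c \<and> z $ c < \<eta> * (of_int (k c) + 1)}"

text \<open>Factors in [0,1] make the errors of the single factors add up.\<close>

lemma prod_le_prod_plus:
  fixes a b :: "'a \<Rightarrow> real"
  assumes "finite I" "\<And>i. i \<in> I \<Longrightarrow> 0 \<le> a i \<and> a i \<le> 1" "\<And>i. i \<in> I \<Longrightarrow> 0 \<le> b i \<and> b i \<le> 1"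
    "\<And>i. i \<in> I \<Longrightarrow> a i \<le> b i + \<tau>" "\<tau> \<ge> 0"
  shows "(\<Prod>i\<in>I. a i) \<le> (\<Prod>i\<in>I. b i) + real (card I) * \<tau>"
  using assms
proof (induction I rule: finite_induct)
  case (insert i I)
  define A where "A = prod a I"
  define B where "B = prod b I"
  have A: "0 \<le> A" "A \<le> 1"
    unfolding A_def using insert.prems(1) by (auto intro!: prod_nonneg prod_le_1)
  have IH: "A \<le> B + real (card I) * \<tau>" unfolding A_def B_def using insert by auto
  have "a i * A \<le> (b i + \<tau>) * A" using insert.prems A by (intro mult_right_mono) auto
  also have "\<dots> = b i * A + \<tau> * A" by (simp add: algebra_simps)
  also have "\<dots> \<le> b i * (B + real (card I) * \<tau>) + \<tau> * 1"
    using IH insert.prems A by (intro add_mono mult_left_mono) auto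
  also have "\<dots> = b i * B + b i * (real (card I) * \<tau>) + \<tau>" by (simp add: algebra_simps)
  also have "\<dots> \<le> b i * B + 1 * (real (card I) * \<tau>) + \<tau>"
  proof -
    have "b i * (real (card I) * \<tau>) \<le> 1 * (real (card I) * \<tau>)"
      using insert.prems by (intro mult_right_mono) auto
    then show ?thesis by linarith
  qed
  finally show ?case using insert.hyps unfolding A_def B_def by (simp add: algebra_simps)
qed simp

text \<open>The half-open window comes from the grid cubes, while the approximating polynomials see
  only distances to the integers; hence a strict inequality in one direction and a weak one in the
  other. A width below 1 leaves room for at most one integer.\<close>

lemma card_int_window:
  fixes w z :: real
  assumes "0 < w" "w < 1 / 2"
  defines "X \<equiv> {b::int. - w \<le> of_int b - z \<and> of_int b - z < w}"
  shows "finite X" "card X \<le> 1" "(\<exists>b::int. \<bar>z - of_int b\<bar> < w) \<Longrightarrow> card X = 1" "card X = 1 \<Longrightarrow> \<exists>b::int. \<bar>z - of_int b\<bar> \<le> w"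
proof -
  have "X \<subseteq> {\<lfloor>z\<rfloor> - 1..\<lfloor>z\<rfloor> + 2}"
  proof
    fix b assume "b \<in> X"
    then have "- w \<le> of_int b - z" "of_int b - z < w" by (auto simp: X_def)
    then show "b \<in> {\<lfloor>z\<rfloor> - 1..\<lfloor>z\<rfloor> + 2}" using assms(2) by simp linarith
  qed
  then show fin: "finite X" by (rule finite_subset) simp
  have "b = b'" if "b \<in> X" "b' \<in> X" for b b'
  proof -
    have "of_int b - z < w" "- w \<le> of_int b - z" "of_int b' - z < w" "- w \<le> of_int b' - z" using that by (auto simp: X_def)
    then have "real_of_int b < of_int b' + 1" "real_of_int b' < of_int b + 1" using assms(2) by linarith+
    then show ?thesis by linarith
  qed
  then show le: "card X \<le> 1" by (metis One_nat_def card_le_Suc0_iff_eq fin)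
  show "card X = 1" if "\<exists>b::int. \<bar>z - of_int b\<bar> < w"
  proof -
    from that obtain b :: int where "\<bar>z - of_int b\<bar> < w" by blast
    then have "b \<in> X" unfolding X_def by (simp add: abs_if split: if_splits)
    then have "card X > 0" using fin by (auto simp: card_gt_0_iff)
    then show ?thesis using le by linarith
  qed
  show "\<exists>b::int. \<bar>z - of_int b\<bar> \<le> w" if "card X = 1"
  proof -
    from that obtain b where "b \<in> X" by (metis card.empty ex_in_conv zero_neq_one)
    then have "\<bar>z - of_int b\<bar> \<le> w" by (simp add: X_def abs_if)
    then show ?thesis by blast
  qed
qed

section \<open>Rational points in a grid cube and their Fourier expansion\<close>

context curved_graph
begin

definition rpt :: "real \<Rightarrow> nat \<Rightarrow> int ^ ('n + 'r) \<Rightarrow> real ^ ('n + 'r)" where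
  "rpt \<delta> q a = (\<chi> c. case c of Inl i \<Rightarrow> of_int (a $ Inl i) / real q
     | Inr r \<Rightarrow> (of_int (a $ Inr r) - real q * f r (\<chi> i. of_int (a $ Inl i) / real q)) / \<delta>)"

text \<open>The numerators \<open>a\<close> with a/q in a side of the cube form an integer interval,
  with first element \<open>cstart\<close> and length \<open>clen\<close>; ceilings at both ends
  match the half-open side.\<close>

definition cstart :: "real \<Rightarrow> ('n + 'r \<Rightarrow> int) \<Rightarrow> nat \<Rightarrow> 'n \<Rightarrow> int" where
  "cstart \<eta> k q i = \<lceil>real q * (\<eta> * of_int (k (Inl i)))\<rceil>"

definition clen :: "real \<Rightarrow> ('n + 'r \<Rightarrow> int) \<Rightarrow> nat \<Rightarrow> 'n \<Rightarrow> nat" where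
  "clen \<eta> k q i = nat (\<lceil>real q * (\<eta> * (of_int (k (Inl i)) + 1))\<rceil> - cstart \<eta> k q i)"

definition cpoint :: "real \<Rightarrow> ('n + 'r \<Rightarrow> int) \<Rightarrow> nat \<Rightarrow> ('n \<Rightarrow> nat) \<Rightarrow> real ^ 'n" where
  "cpoint \<eta> k q t = (\<chi> i. (of_int (cstart \<eta> k q i) + real (t i)) / real q)"

definition cwin :: "real \<Rightarrow> real \<Rightarrow> ('n + 'r \<Rightarrow> int) \<Rightarrow> nat \<Rightarrow> ('n \<Rightarrow> nat) \<Rightarrow> 'r \<Rightarrow> int set" where
  "cwin \<delta> \<eta> k q t r = {b. \<eta> * of_int (k (Inr r)) \<le> (of_int b - real q * f r (cpoint \<eta> k q t)) / \<delta> \<and>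
      (of_int b - real q * f r (cpoint \<eta> k q t)) / \<delta> < \<eta> * (of_int (k (Inr r)) + 1)}"

text \<open>The centre of the vertical window in the unscaled variable b - q f; relative to it the
  window is symmetric with half-width \<delta> \<eta> / 2.\<close>

definition cshift :: "real \<Rightarrow> real \<Rightarrow> ('n + 'r \<Rightarrow> int) \<Rightarrow> 'r \<Rightarrow> real" where
  "cshift \<delta> \<eta> k r = \<delta> * \<eta> * (of_int (k (Inr r)) + 1 / 2)"

lemma cwin_eq:
  assumes "\<delta> > 0"
  shows "cwin \<delta> \<eta> k q t r = {b. - (\<delta> * \<eta> / 2) \<le> of_int b - (real q * f r (cpoint \<eta> k q t) + cshift \<delta> \<eta> k r) \<and>
     of_int b - (real q * f r (cpoint \<eta> k q t) + cshift \<delta> \<eta> k r) < \<delta> * \<eta> / 2}"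
proof -
  have "\<eta> * x \<le> y / \<delta> \<longleftrightarrow> - (\<delta> * \<eta> / 2) \<le> y - \<delta> * \<eta> * (x + 1 / 2)" for x y :: real
  proof -
    have "\<eta> * x * \<delta> = \<delta> * \<eta> * x" "\<delta> * \<eta> * (x + 1 / 2) = \<delta> * \<eta> * x + \<delta> * \<eta> / 2"
      by (simp_all add: algebra_simps)
    then show ?thesis unfolding pos_le_divide_eq[OF assms] by linarith
  qed
  moreover have "y / \<delta> < \<eta> * (x + 1) \<longleftrightarrow> y - \<delta> * \<eta> * (x + 1 / 2) < \<delta> * \<eta> / 2" for x y :: real
  proof -
    have "\<eta> * (x + 1) * \<delta> = \<delta> * \<eta> + \<delta> * \<eta> * x" "\<delta> * \<eta> * (x + 1 / 2) = \<delta> * \<eta> * x + \<delta> * \<eta> / 2"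
      by (simp_all add: algebra_simps)
    then show ?thesis unfolding pos_divide_less_eq[OF assms] by linarith
  qed
  ultimately show ?thesis unfolding cwin_def cshift_def by (simp add: diff_diff_eq)
qed

lemma cpoint_iff:
  assumes "q > 0"
  shows "\<eta> * of_int (k (Inl i)) \<le> of_int a / real q \<and> of_int a / real q < \<eta> * (of_int (k (Inl i)) + 1)
     \<longleftrightarrow> cstart \<eta> k q i \<le> a \<and> nat (a - cstart \<eta> k q i) < clen \<eta> k q i"
proof -
  have "\<eta> * of_int (k (Inl i)) \<le> of_int a / real q \<longleftrightarrow> real q * (\<eta> * of_int (k (Inl i))) \<le> of_int a"
    using assms by (simp add: pos_le_divide_eq mult.commute)
  also have "\<dots> \<longleftrightarrow> cstart \<eta> k q i \<le> a" unfolding cstart_def by (simp add: ceiling_le_iff)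
  finally have 1: "\<eta> * of_int (k (Inl i)) \<le> of_int a / real q \<longleftrightarrow> cstart \<eta> k q i \<le> a" .
  have "of_int a / real q < \<eta> * (of_int (k (Inl i)) + 1) \<longleftrightarrow> of_int a < real q * (\<eta> * (of_int (k (Inl i)) + 1))"
    using assms by (simp add: pos_divide_less_eq mult.commute)
  also have "\<dots> \<longleftrightarrow> a < \<lceil>real q * (\<eta> * (of_int (k (Inl i)) + 1))\<rceil>" by (simp add: less_ceiling_iff)
  finally have 2: "of_int a / real q < \<eta> * (of_int (k (Inl i)) + 1) \<longleftrightarrow> a < \<lceil>real q * (\<eta> * (of_int (k (Inl i)) + 1))\<rceil>" .
  show ?thesis unfolding 1 2 clen_def by linarith
qed

text \<open>Once the horizontal numerators are fixed, the vertical ones are chosen independently of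
  each other, so each horizontal point contributes a product of window counts.\<close>

lemma rpt_count:
  assumes "q > 0" "\<delta> > 0" "0 < \<delta> * \<eta> / 2" "\<delta> * \<eta> / 2 < 1 / 2"
  shows "finite {a. rpt \<delta> q a \<in> grid_cube \<eta> k}"
    "card {a. rpt \<delta> q a \<in> grid_cube \<eta> k} = (\<Sum>t\<in>lbox UNIV (clen \<eta> k q) (\<lambda>_. 0). \<Prod>r\<in>UNIV. card (cwin \<delta> \<eta> k q t r))"
proof -
  define g where "g = (\<lambda>(t :: 'n \<Rightarrow> nat, b :: 'r \<Rightarrow> int). (\<chi> c. case c of Inl i \<Rightarrow> cstart \<eta> k q i + int (t i) | Inr r \<Rightarrow> b r) :: int ^ ('n + 'r))"
  define S where "S = (SIGMA t : lbox UNIV (clen \<eta> k q) (\<lambda>_. 0). PiE UNIV (cwin \<delta> \<eta> k q t))"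
  have fw: "finite (cwin \<delta> \<eta> k q t r)" for t r
    unfolding cwin_eq[OF assms(2)] by (rule card_int_window) (use assms in auto)
  have inj: "inj_on g S"
  proof (rule inj_onI)
    fix p p' assume "p \<in> S" "p' \<in> S" and eq: "g p = g p'"
    obtain t b t' b' where p: "p = (t, b)" "p' = (t', b')" by (cases p, cases p')
    have "t i = t' i" for i using arg_cong[OF eq, of "\<lambda>v. v $ Inl i"] by (simp add: g_def p)
    moreover have "b r = b' r" for r using arg_cong[OF eq, of "\<lambda>v. v $ Inr r"] by (simp add: g_def p)
    ultimately show "p = p'" by (simp add: p fun_eq_iff)
  qed
  have img: "{a. rpt \<delta> q a \<in> grid_cube \<eta> k} = g ` S"
  proof (intro equalityI subsetI)
    fix a assume "a \<in> {a. rpt \<delta> q a \<in> grid_cube \<eta> k}"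
    then have a: "\<eta> * of_int (k c) \<le> rpt \<delta> q a $ c \<and> rpt \<delta> q a $ c < \<eta> * (of_int (k c) + 1)" for c
      by (simp add: grid_cube_def)
    define t where "t i = nat (a $ Inl i - cstart \<eta> k q i)" for i
    define b where "b r = a $ Inr r" for r
    have 1: "cstart \<eta> k q i \<le> a $ Inl i" "t i < clen \<eta> k q i" for i
      using a[of "Inl i"] cpoint_iff[OF assms(1), of \<eta> k i "a $ Inl i"] by (auto simp: rpt_def t_def)
    have ai: "a $ Inl i = cstart \<eta> k q i + int (t i)" for i using 1(1)[of i] by (simp add: t_def)
    have x: "cpoint \<eta> k q t = (\<chi> i. of_int (a $ Inl i) / real q)"
      by (simp add: cpoint_def ai)
    have "b r \<in> cwin \<delta> \<eta> k q t r" for r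
      using a[of "Inr r"] unfolding cwin_def x b_def by (simp add: rpt_def)
    then have "(t, b) \<in> S" using 1(2) by (auto simp: S_def lbox_def)
    moreover have "a = g (t, b)"
      unfolding vec_eq_iff g_def by (auto simp: ai b_def split: sum.splits)
    ultimately show "a \<in> g ` S" by blast
  next
    fix a assume "a \<in> g ` S"
    then obtain t b where tb: "(t, b) \<in> S" "a = g (t, b)" by auto
    have ai: "a $ Inl i = cstart \<eta> k q i + int (t i)" for i by (simp add: tb g_def)
    have br: "a $ Inr r = b r" for r by (simp add: tb g_def)
    have x: "cpoint \<eta> k q t = (\<chi> i. of_int (a $ Inl i) / real q)"
      by (simp add: cpoint_def ai)
    have t: "t i < clen \<eta> k q i" and b: "b r \<in> cwin \<delta> \<eta> k q t r" for i r using tb(1) by (auto simp: S_def lbox_def)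
    have "\<eta> * of_int (k c) \<le> rpt \<delta> q a $ c \<and> rpt \<delta> q a $ c < \<eta> * (of_int (k c) + 1)" for c
    proof (cases c)
      case (Inl i)
      have "cstart \<eta> k q i \<le> a $ Inl i \<and> nat (a $ Inl i - cstart \<eta> k q i) < clen \<eta> k q i" using t[of i] by (simp add: ai)
      then show ?thesis unfolding Inl cpoint_iff[OF assms(1), symmetric] by (simp add: rpt_def)
    next
      case (Inr r)
      then show ?thesis using b[of r] unfolding cwin_def x br[symmetric] by (simp add: rpt_def)
    qed
    then show "a \<in> {a. rpt \<delta> q a \<in> grid_cube \<eta> k}" by (simp add: grid_cube_def)
  qed
  have finS: "finite S" unfolding S_def
    by (intro finite_SigmaI finite_lbox finite_PiE fw) auto
  then show "finite {a. rpt \<delta> q a \<in> grid_cube \<eta> k}" unfolding img by simp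
  have "card {a. rpt \<delta> q a \<in> grid_cube \<eta> k} = card S" unfolding img by (rule card_image[OF inj])
  also have "\<dots> = (\<Sum>t\<in>lbox UNIV (clen \<eta> k q) (\<lambda>_. 0). card (PiE UNIV (cwin \<delta> \<eta> k q t)))"
    unfolding S_def by (rule card_SigmaI) (auto simp: finite_lbox intro: finite_PiE fw)
  also have "\<dots> = (\<Sum>t\<in>lbox UNIV (clen \<eta> k q) (\<lambda>_. 0). \<Prod>r\<in>UNIV. card (cwin \<delta> \<eta> k q t r))"
    by (simp add: card_PiE)
  finally show "card {a. rpt \<delta> q a \<in> grid_cube \<eta> k} = (\<Sum>t\<in>lbox UNIV (clen \<eta> k q) (\<lambda>_. 0). \<Prod>r\<in>UNIV. card (cwin \<delta> \<eta> k q t r))" .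
qed

text \<open>The zero frequency gives the main term. All other frequencies, fewer than (2D+1)^R,
  carry coefficients of modulus at most \<open>p0\<close>, so the factor p0^R, which will be of
  order (\<delta> \<eta>)^R, stays in front of the error. The shifts \<open>s r\<close> change only
  arguments, not moduli.\<close>

lemma fourier_sum_bound:
  fixes p :: "int \<Rightarrow> complex" and P :: "real \<Rightarrow> real" and T :: "('n \<Rightarrow> nat) set" and x :: "('n \<Rightarrow> nat) \<Rightarrow> real ^ 'n"
  assumes P: "\<And>y. complex_of_real (P y) = trig_poly D p y" and p0: "p 0 = of_real p0" "\<And>k. norm (p k) \<le> p0"
    and T: "finite T"
    and E: "\<And>j r0 J. J \<ge> 1 \<Longrightarrow> J \<le> int D \<Longrightarrow> (\<forall>r. \<bar>j r\<bar> \<le> J) \<Longrightarrow> \<bar>j r0\<bar> = J \<Longrightarrow>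
       norm (\<Sum>t\<in>T. ecis (phase j q (x t))) \<le> E" and E0: "E \<ge> 0"
  shows "\<bar>(\<Sum>t\<in>T. \<Prod>r\<in>UNIV. P (real q * f r (x t) + s r)) - p0 ^ CARD('r) * real (card T)\<bar>
     \<le> p0 ^ CARD('r) * ((2 * real D + 1) ^ CARD('r) * E)"
proof -
  have p00: "p0 \<ge> 0" using p0(2)[of 0] by (rule order.trans[OF norm_ge_zero])
  define Js where "Js = PiE (UNIV :: 'r set) (\<lambda>_. {- int D..int D})"
  have finJ: "finite Js" unfolding Js_def by (intro finite_PiE) auto
  define z where "z = (\<lambda>_::'r. 0::int)"
  have zJ: "z \<in> Js" by (auto simp: Js_def z_def)
  define a where "a j = (\<Prod>r\<in>UNIV. p (j r)) * ecis (\<Sum>r\<in>UNIV. of_int (j r) * s r) * (\<Sum>t\<in>T. ecis (phase j q (x t)))" for j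
  have "complex_of_real (\<Prod>r\<in>UNIV. P (real q * f r y + s r)) =
     (\<Sum>j\<in>Js. (\<Prod>r\<in>UNIV. p (j r)) * ecis (\<Sum>r\<in>UNIV. of_int (j r) * s r) * ecis (phase j q y))" for y
  proof -
    have "complex_of_real (\<Prod>r\<in>UNIV. P (real q * f r y + s r)) = (\<Prod>r\<in>UNIV. \<Sum>k\<in>{- int D..int D}. p k * ecis (of_int k * (real q * f r y + s r)))"
      by (simp only: of_real_prod P trig_poly_def)
    also have "\<dots> = (\<Sum>j\<in>Js. \<Prod>r\<in>UNIV. p (j r) * ecis (of_int (j r) * (real q * f r y + s r)))"
      unfolding Js_def by (rule prod_sum_PiE) auto
    also have "\<dots> = (\<Sum>j\<in>Js. (\<Prod>r\<in>UNIV. p (j r)) * ecis (\<Sum>r\<in>UNIV. of_int (j r) * s r) * ecis (phase j q y))"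
    proof (intro sum.cong refl)
      fix j
      have "(\<Sum>r\<in>UNIV. of_int (j r) * (real q * f r y + s r)) = (\<Sum>r\<in>UNIV. of_int (j r) * s r) + phase j q y"
        unfolding phase_def sum.distrib[symmetric] by (intro sum.cong) (auto simp: algebra_simps)
      then show "(\<Prod>r\<in>UNIV. p (j r) * ecis (of_int (j r) * (real q * f r y + s r)))
        = (\<Prod>r\<in>UNIV. p (j r)) * ecis (\<Sum>r\<in>UNIV. of_int (j r) * s r) * ecis (phase j q y)"
        by (simp add: prod.distrib prod_ecis ecis_add)
    qed
    finally show ?thesis .
  qed
  then have "complex_of_real (\<Sum>t\<in>T. \<Prod>r\<in>UNIV. P (real q * f r (x t) + s r)) =
     (\<Sum>t\<in>T. \<Sum>j\<in>Js. (\<Prod>r\<in>UNIV. p (j r)) * ecis (\<Sum>r\<in>UNIV. of_int (j r) * s r) * ecis (phase j q (x t)))"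
    by (simp only: of_real_sum)
  also have "\<dots> = (\<Sum>j\<in>Js. a j)"
    unfolding a_def by (subst sum.swap) (simp add: sum_distrib_left)
  also have "\<dots> = a z + (\<Sum>j\<in>Js - {z}. a j)"
    using finJ zJ by (rule sum.remove)
  also have "a z = complex_of_real (p0 ^ CARD('r) * real (card T))"
    by (simp add: a_def z_def p0 phase_def)
  finally have eq: "complex_of_real (\<Sum>t\<in>T. \<Prod>r\<in>UNIV. P (real q * f r (x t) + s r)) =
    complex_of_real (p0 ^ CARD('r) * real (card T)) + (\<Sum>j\<in>Js - {z}. a j)" .
  have "complex_of_real ((\<Sum>t\<in>T. \<Prod>r\<in>UNIV. P (real q * f r (x t) + s r)) - p0 ^ CARD('r) * real (card T)) = (\<Sum>j\<in>Js - {z}. a j)"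
    unfolding of_real_diff eq by (rule add_diff_cancel_left')
  then have "\<bar>(\<Sum>t\<in>T. \<Prod>r\<in>UNIV. P (real q * f r (x t) + s r)) - p0 ^ CARD('r) * real (card T)\<bar> = norm (\<Sum>j\<in>Js - {z}. a j)"
    unfolding norm_of_real[where ?'a = complex, symmetric] by (rule arg_cong)
  also have "\<dots> \<le> (\<Sum>j\<in>Js - {z}. p0 ^ CARD('r) * E)"
  proof (rule order.trans[OF norm_sum], rule sum_mono)
    fix j assume j: "j \<in> Js - {z}"
    define J where "J = Max (range (\<lambda>r. \<bar>j r\<bar>))"
    have "J \<in> range (\<lambda>r. \<bar>j r\<bar>)" unfolding J_def by (intro Max_in) auto
    then obtain r0 where r0: "\<bar>j r0\<bar> = J" by blast
    have le: "\<bar>j r\<bar> \<le> J" for r unfolding J_def by (intro Max_ge) auto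
    have "j r0 \<in> {- int D..int D}" using j unfolding Js_def by blast
    then have JD: "J \<le> int D" using r0 by auto
    obtain r1 where "j r1 \<noteq> 0" using j by (auto simp: z_def fun_eq_iff)
    then have "J \<ge> 1" using le[of r1] by linarith
    then have S: "norm (\<Sum>t\<in>T. ecis (phase j q (x t))) \<le> E" using E[of J j r0] JD le r0 by blast
    have "(\<Prod>r\<in>UNIV. norm (p (j r))) \<le> (\<Prod>r\<in>(UNIV :: 'r set). p0)" by (intro prod_mono) (auto simp: p0)
    then show "norm (a j) \<le> p0 ^ CARD('r) * E"
      unfolding a_def norm_mult prod_norm[symmetric] using S p00 by (simp add: mult_mono)
  qed
  also have "\<dots> = real (card (Js - {z})) * (p0 ^ CARD('r) * E)" by simp
  also have "\<dots> \<le> real (card Js) * (p0 ^ CARD('r) * E)"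
    using p00 E0 finJ by (intro mult_right_mono) (auto intro: card_mono)
  also have "card Js = (2 * D + 1) ^ CARD('r)"
  proof -
    have "card {- int D..int D} = 2 * D + 1" by simp
    then show ?thesis unfolding Js_def by (subst card_PiE) auto
  qed
  finally show ?thesis by (simp add: algebra_simps)
qed

end

section \<open>Cardinality of lattice boxes and sums of powers\<close>

lemma card_lbox_UNIV: "card (lbox (UNIV :: 'n::finite set) N z) = (\<Prod>i\<in>UNIV. N i)"
proof -
  have "lbox (UNIV :: 'n set) N z = PiE UNIV (\<lambda>i. {..<N i})" by (auto simp: lbox_def PiE_def)
  then show ?thesis by (simp add: card_PiE)
qed

lemma power_diff_bounds:
  fixes x :: real
  assumes "x \<ge> 0"
  shows "real (Suc n) * x ^ n \<le> (x + 1) ^ Suc n - x ^ Suc n" "(x + 1) ^ Suc n - x ^ Suc n \<le> real (Suc n) * (x + 1) ^ n"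
proof -
  have eq: "(x + 1) ^ Suc n - x ^ Suc n = (\<Sum>p<Suc n. (x + 1) ^ p * x ^ (n - p))"
    using diff_power_eq_sum[of "x + 1" n x] by simp
  have "(\<Sum>p<Suc n. x ^ n) \<le> (\<Sum>p<Suc n. (x + 1) ^ p * x ^ (n - p))"
  proof (rule sum_mono)
    fix p assume "p \<in> {..<Suc n}"
    then have "x ^ n = x ^ p * x ^ (n - p)" by (simp add: power_add[symmetric])
    also have "\<dots> \<le> (x + 1) ^ p * x ^ (n - p)" using assms by (intro mult_right_mono power_mono) auto
    finally show "x ^ n \<le> (x + 1) ^ p * x ^ (n - p)" .
  qed
  then show "real (Suc n) * x ^ n \<le> (x + 1) ^ Suc n - x ^ Suc n" unfolding eq by simp
  have "(\<Sum>p<Suc n. (x + 1) ^ p * x ^ (n - p)) \<le> (\<Sum>p<Suc n. (x + 1) ^ n)"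
  proof (rule sum_mono)
    fix p assume "p \<in> {..<Suc n}"
    then have "(x + 1) ^ n = (x + 1) ^ p * (x + 1) ^ (n - p)" by (simp add: power_add[symmetric])
    moreover have "(x + 1) ^ p * x ^ (n - p) \<le> (x + 1) ^ p * (x + 1) ^ (n - p)" using assms by (intro mult_left_mono power_mono) auto
    ultimately show "(x + 1) ^ p * x ^ (n - p) \<le> (x + 1) ^ n" by simp
  qed
  then show "(x + 1) ^ Suc n - x ^ Suc n \<le> real (Suc n) * (x + 1) ^ n" unfolding eq by simp
qed

lemma sum_power_bounds:
  assumes "n > 0"
  shows "real Q ^ Suc n / real (Suc n) \<le> (\<Sum>q\<in>{1..Q}. real q ^ n)
   \<and> (\<Sum>q\<in>{1..Q}. real q ^ n) \<le> real Q ^ Suc n / real (Suc n) + real Q ^ n"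
proof (induction Q)
  case (Suc Q)
  have 1: "real (Suc Q) ^ Suc n / real (Suc n) - real Q ^ Suc n / real (Suc n) = ((real Q + 1) ^ Suc n - real Q ^ Suc n) / real (Suc n)"
    by (simp add: diff_divide_distrib add.commute)
  have "real Q ^ n \<le> ((real Q + 1) ^ Suc n - real Q ^ Suc n) / real (Suc n)"
    "((real Q + 1) ^ Suc n - real Q ^ Suc n) / real (Suc n) \<le> (real Q + 1) ^ n"
    using power_diff_bounds[of "real Q" n] by (simp_all only: pos_le_divide_eq pos_divide_le_eq of_nat_0_less_iff zero_less_Suc mult.commute of_nat_0_le_iff)
  moreover have "(\<Sum>q\<in>{1..Suc Q}. real q ^ n) = (\<Sum>q\<in>{1..Q}. real q ^ n) + (real Q + 1) ^ n"
    by (simp add: add.commute)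
  moreover have "real (Suc Q) ^ n = (real Q + 1) ^ n" by (simp add: add.commute)
  ultimately show ?case using Suc 1 by linarith
qed (use assms in simp)

section \<open>Two-sided bounds for one denominator, and the number of horizontal points\<close>

context curved_graph
begin

text \<open>Only the horizontal sides are confined to the neighbourhood of \<open>x0\<close>; the
  vertical position of a cube enters the Fourier side as a phase shift.\<close>

definition cube_ok :: "real \<Rightarrow> ('n + 'r \<Rightarrow> int) \<Rightarrow> bool" where
  "cube_ok \<eta> k \<longleftrightarrow> 0 < \<eta> \<and> \<eta> \<le> 1 \<and> (\<forall>i. x0 $ i - \<rho> / 2 \<le> \<eta> * of_int (k (Inl i)) \<and> \<eta> * (of_int (k (Inl i)) + 1) \<le> x0 $ i + \<rho> / 2)"

definition cvol :: "real \<Rightarrow> ('n + 'r \<Rightarrow> int) \<Rightarrow> nat \<Rightarrow> real" where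
  "cvol \<eta> k q = real (card (lbox UNIV (clen \<eta> k q) (\<lambda>_. 0)))"

definition ccount :: "real \<Rightarrow> real \<Rightarrow> ('n + 'r \<Rightarrow> int) \<Rightarrow> nat \<Rightarrow> nat" where
  "ccount \<delta> \<eta> k Q = (\<Sum>q\<in>{1..Q}. card {a. rpt \<delta> q a \<in> grid_cube \<eta> k})"

text \<open>The error factor of the Fourier expansion: the number of frequencies times the
  exponential sum bound at the top frequency \<open>D\<close>.\<close>

definition gain :: "real \<Rightarrow> nat \<Rightarrow> nat \<Rightarrow> real" where
  "gain C D q = (2 * real D + 1) ^ CARD('r) * (C * sqrt (real D * real q) ^ (CARD('n) - 1) * real q * (2 + ln (real q)) ^ CARD('n))"

lemma clen_bounds:
  assumes "\<eta> > 0"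
  shows "\<bar>real (clen \<eta> k q i) - real q * \<eta>\<bar> \<le> 1"
proof -
  define a where "a = real q * (\<eta> * of_int (k (Inl i)))"
  have b: "real q * (\<eta> * (of_int (k (Inl i)) + 1)) = a + real q * \<eta>" by (simp add: a_def algebra_simps)
  have "real q * \<eta> \<ge> 0" using assms by simp
  then have "\<lceil>a\<rceil> \<le> \<lceil>a + real q * \<eta>\<rceil>" by (intro ceiling_mono) simp
  then have "real (clen \<eta> k q i) = of_int \<lceil>a + real q * \<eta>\<rceil> - of_int \<lceil>a\<rceil>"
    unfolding clen_def cstart_def b a_def[symmetric] by simp
  then show ?thesis by linarith
qed

lemma clen_le:
  assumes "cube_ok \<eta> k" "q > 0"
  shows "clen \<eta> k q i \<le> 2 * q"
proof -
  have "\<eta> > 0" "\<eta> \<le> 1" using assms by (auto simp: cube_ok_def)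
  then have "real q * \<eta> \<le> real q * 1" by (intro mult_left_mono) auto
  then have "real (clen \<eta> k q i) \<le> real q + 1" using clen_bounds[OF \<open>\<eta> > 0\<close>, of k q i] by linarith
  then have "clen \<eta> k q i \<le> q + 1" by linarith
  then show ?thesis using assms(2) by linarith
qed

lemma cpoint_region:
  assumes "cube_ok \<eta> k" "q > 0" "t \<in> lbox UNIV (clen \<eta> k q) (\<lambda>_. 0)"
  shows "\<bar>(of_int (cstart \<eta> k q i) + real (t i)) / real q - x0 $ i\<bar> \<le> \<rho> / 2"
proof -
  have "t i < clen \<eta> k q i" using assms(3) by (simp add: lbox_def)
  then have "\<eta> * of_int (k (Inl i)) \<le> of_int (cstart \<eta> k q i + int (t i)) / real q \<and>
     of_int (cstart \<eta> k q i + int (t i)) / real q < \<eta> * (of_int (k (Inl i)) + 1)"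
    by (subst cpoint_iff[OF assms(2)]) auto
  moreover have "x0 $ i - \<rho> / 2 \<le> \<eta> * of_int (k (Inl i))" "\<eta> * (of_int (k (Inl i)) + 1) \<le> x0 $ i + \<rho> / 2"
    using assms(1) by (auto simp: cube_ok_def)
  ultimately show ?thesis unfolding of_int_add of_int_of_nat_eq by linarith
qed

text \<open>The window of half-width \<open>w\<close> is compared with polynomials for half-width w
  + d from above and w - d from below, where d = \<kappa>' w. Their means deviate from twice the
  half-width by at most 2d, which produces the factors 1 + 2 \<kappa>' and 1 - 2 \<kappa>'; \<tau>
  accounts for the tails of the kernel.\<close>

lemma count_q_bounds:
  fixes m :: nat
  assumes ok: "cube_ok \<eta> k" and \<delta>: "0 < \<delta>" "\<delta> \<le> 1 / 2" and \<kappa>': "0 < \<kappa>'" "\<kappa>' \<le> 1 / 2" and q: "q > 0" and N: "N > 0" and C0: "C > 0"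
    and ES: "\<And>q j J r0 A N. q > 0 \<Longrightarrow> J \<ge> 1 \<Longrightarrow> (\<forall>r. \<bar>j r\<bar> \<le> J) \<Longrightarrow> \<bar>j r0\<bar> = J \<Longrightarrow>
     (\<forall>i. N i \<le> 2 * q) \<Longrightarrow>
     (\<forall>t\<in>lbox UNIV N (\<lambda>_. 0). \<forall>i. \<bar>(of_int (A i) + real (t i)) / real q - x0 $ i\<bar> \<le> \<rho> / 2) \<Longrightarrow>
     norm (\<Sum>t\<in>lbox UNIV N (\<lambda>_. 0). ecis (phase j q (\<chi> i. (of_int (A i) + real (t i)) / real q)))
       \<le> C * sqrt (of_int J * real q) ^ (CARD('n) - 1) * real q * (2 + ln (real q)) ^ CARD('n)"
  defines "D \<equiv> m * (2 * N)"
  defines "\<tau> \<equiv> (2 * real D + 1) / (real N * (\<kappa>' * (\<delta> * \<eta> / 2))) ^ (2 * m)"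
  shows "real (card {a. rpt \<delta> q a \<in> grid_cube \<eta> k}) \<le>
      (\<delta> * \<eta> * (1 + 2 * \<kappa>')) ^ CARD('r) * cvol \<eta> k q + (2 * \<delta> * \<eta>) ^ CARD('r) * gain C D q + real CARD('r) * \<tau> * cvol \<eta> k q"
    "real (card {a. rpt \<delta> q a \<in> grid_cube \<eta> k}) \<ge>
      (\<delta> * \<eta> * (1 - 2 * \<kappa>')) ^ CARD('r) * cvol \<eta> k q - (2 * \<delta> * \<eta>) ^ CARD('r) * gain C D q - real CARD('r) * \<tau> * cvol \<eta> k q"
proof -
  have \<eta>: "0 < \<eta>" "\<eta> \<le> 1" using ok by (auto simp: cube_ok_def)
  define w where "w = \<delta> * \<eta> / 2"
  define d where "d = \<kappa>' * w"
  have w0: "0 < w" using \<delta> \<eta> by (simp add: w_def)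
  have "\<delta> * \<eta> \<le> 1 / 2 * 1" using \<delta> \<eta> by (intro mult_mono) auto
  then have w1: "w \<le> 1 / 4" by (simp add: w_def)
  have d0: "d > 0" using w0 \<kappa>' by (simp add: d_def)
  have "d \<le> 1 / 2 * w" unfolding d_def using w0 \<kappa>' by (intro mult_right_mono) auto
  then have d1: "d \<le> w / 2" by simp
  have w2: "w < 1 / 2" using w1 by simp
  have \<tau>: "\<tau> = (2 * real D + 1) / (real N * d) ^ (2 * m)" by (simp add: \<tau>_def d_def w_def)
  have \<tau>0: "\<tau> \<ge> 0" unfolding \<tau> using d0 by simp
  \<comment> \<open>Fine enough both to keep the frequencies apart and to make the discretisation
    error 1/L at most 2d.\<close>
  define L where "L = nat \<lceil>1 / (2 * d)\<rceil> + 2 * D + 1"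
  have L: "L > 2 * D" by (simp add: L_def)
  have "1 / (2 * d) \<le> real L" unfolding L_def by linarith
  then have Ld: "1 / real L \<le> 2 * d" using d0 L by (simp add: field_simps)
  define T where "T = lbox UNIV (clen \<eta> k q) (\<lambda>_. 0 :: nat)"
  have finT: "finite T" unfolding T_def by (simp add: finite_lbox)
  define E where "E = C * sqrt (real D * real q) ^ (CARD('n) - 1) * real q * (2 + ln (real q)) ^ CARD('n)"
  have lnq: "ln (real q) \<ge> 0" using q by simp
  have E0: "E \<ge> 0" unfolding E_def using C0 lnq by simp
  have gain: "gain C D q = (2 * real D + 1) ^ CARD('r) * E" by (simp add: gain_def E_def)
  have gain0: "gain C D q \<ge> 0" unfolding gain using E0 by simp
  have ESE: "norm (\<Sum>t\<in>T. ecis (phase j q (cpoint \<eta> k q t))) \<le> E"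
    if "J \<ge> 1" "J \<le> int D" "\<forall>r. \<bar>j r\<bar> \<le> J" "\<bar>j r0\<bar> = J" for j r0 J
  proof -
    have "norm (\<Sum>t\<in>T. ecis (phase j q (cpoint \<eta> k q t))) \<le> C * sqrt (of_int J * real q) ^ (CARD('n) - 1) * real q * (2 + ln (real q)) ^ CARD('n)"
      unfolding T_def cpoint_def using cpoint_region[OF ok q] clen_le[OF ok q] q that by (intro ES) auto
    also have "\<dots> \<le> E"
      unfolding E_def using that C0 lnq
      by (intro mult_right_mono mult_left_mono power_mono real_sqrt_le_mono) auto
    finally show ?thesis .
  qed
  define z where "z t r = real q * f r (cpoint \<eta> k q t) + cshift \<delta> \<eta> k r" for t r
  have win: "cwin \<delta> \<eta> k q t r = {b. - w \<le> of_int b - z t r \<and> of_int b - z t r < w}" for t r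
    unfolding cwin_eq[OF \<delta>(1)] w_def z_def ..
  note cw = card_int_window[OF w0 w2, of "z _ _", folded win]
  have count: "real (card {a. rpt \<delta> q a \<in> grid_cube \<eta> k}) = (\<Sum>t\<in>T. \<Prod>r\<in>UNIV. real (card (cwin \<delta> \<eta> k q t r)))"
    using rpt_count(2)[OF q \<delta>(1), of \<eta> k] w0 w2 by (simp add: w_def T_def)
  have p0_le: "(p0::real) ^ CARD('r) * gain C D q \<le> (2 * \<delta> * \<eta>) ^ CARD('r) * gain C D q" if "0 \<le> p0" "p0 \<le> 4 * w" for p0
    using that gain0 by (intro mult_right_mono power_mono) (auto simp: w_def)
  show "real (card {a. rpt \<delta> q a \<in> grid_cube \<eta> k}) \<le>
      (\<delta> * \<eta> * (1 + 2 * \<kappa>')) ^ CARD('r) * cvol \<eta> k q + (2 * \<delta> * \<eta>) ^ CARD('r) * gain C D q + real CARD('r) * \<tau> * cvol \<eta> k q"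
  proof -
    have wd: "0 < w + d" "w + d < 1 / 2" using w0 d0 w1 d1 by linarith+
    obtain p P p0 where P: "\<And>y. complex_of_real (P y) = trig_poly D p y" "\<And>y. 0 \<le> P y" "\<And>y. P y \<le> 1"
      "p 0 = of_real p0" "\<And>k. norm (p k) \<le> p0" "\<bar>p0 - 2 * (w + d)\<bar> \<le> 1 / real L"
      and low: "\<And>y b. \<bar>y - of_int b\<bar> \<le> w + d - d \<Longrightarrow> P y \<ge> 1 - \<tau>"
      and "\<And>y. \<forall>b::int. \<bar>y - of_int b\<bar> \<ge> w + d + d \<Longrightarrow> P y \<le> \<tau>"
      by (rule trig_poly_indicator_approx[OF N d0 L[unfolded D_def] wd, folded D_def, folded \<tau>]) (rule that)
    have p00: "p0 \<ge> 0" using P(5)[of 0] by (rule order.trans[OF norm_ge_zero])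
    have "2 * (w + d) + 2 * d = 2 * w * (1 + 2 * \<kappa>')" by (simp add: d_def algebra_simps)
    then have p0u: "p0 \<le> 2 * w * (1 + 2 * \<kappa>')" using P(6) Ld by linarith
    have "d + d \<le> w" using d1 by simp
    then have "2 * (w + d) + 2 * d \<le> 4 * w" by simp
    then have p0v: "p0 \<le> 4 * w" using P(6) Ld by linarith
    have "real (card {a. rpt \<delta> q a \<in> grid_cube \<eta> k}) \<le> (\<Sum>t\<in>T. (\<Prod>r\<in>UNIV. P (z t r)) + real CARD('r) * \<tau>)"
      unfolding count
    proof (intro sum_mono prod_le_prod_plus)
      fix t r
      show "real (card (cwin \<delta> \<eta> k q t r)) \<le> P (z t r) + \<tau>"
      proof (cases "card (cwin \<delta> \<eta> k q t r) = 1")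
        case True
        then obtain b :: int where "\<bar>z t r - of_int b\<bar> \<le> w" using cw(4) by blast
        then show ?thesis using True low[of "z t r" b] by simp
      next
        case False
        then have "card (cwin \<delta> \<eta> k q t r) = 0" using cw(2)[of t r] by linarith
        then show ?thesis using P(2)[of "z t r"] \<tau>0 by simp
      qed
    qed (use cw(2) P \<tau>0 in auto)
    also have "\<dots> = (\<Sum>t\<in>T. \<Prod>r\<in>UNIV. P (z t r)) + real CARD('r) * \<tau> * cvol \<eta> k q"
      by (simp add: sum.distrib cvol_def T_def)
    finally have 1: "real (card {a. rpt \<delta> q a \<in> grid_cube \<eta> k}) \<le> (\<Sum>t\<in>T. \<Prod>r\<in>UNIV. P (z t r)) + real CARD('r) * \<tau> * cvol \<eta> k q" .
    have "\<bar>(\<Sum>t\<in>T. \<Prod>r\<in>UNIV. P (z t r)) - p0 ^ CARD('r) * real (card T)\<bar> \<le> p0 ^ CARD('r) * ((2 * real D + 1) ^ CARD('r) * E)"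
      unfolding z_def by (rule fourier_sum_bound[OF P(1,4,5) finT ESE E0])
    then have "(\<Sum>t\<in>T. \<Prod>r\<in>UNIV. P (z t r)) \<le> p0 ^ CARD('r) * cvol \<eta> k q + p0 ^ CARD('r) * gain C D q"
      unfolding gain cvol_def T_def by linarith
    also have "p0 ^ CARD('r) * cvol \<eta> k q \<le> (\<delta> * \<eta> * (1 + 2 * \<kappa>')) ^ CARD('r) * cvol \<eta> k q"
      using p00 p0u by (intro mult_right_mono power_mono) (auto simp: cvol_def w_def)
    finally show ?thesis using 1 p0_le[OF p00 p0v] by linarith
  qed
  show "real (card {a. rpt \<delta> q a \<in> grid_cube \<eta> k}) \<ge>
      (\<delta> * \<eta> * (1 - 2 * \<kappa>')) ^ CARD('r) * cvol \<eta> k q - (2 * \<delta> * \<eta>) ^ CARD('r) * gain C D q - real CARD('r) * \<tau> * cvol \<eta> k q"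
  proof -
    have wd: "0 < w - d" "w - d < 1 / 2" using w0 d0 w1 d1 by linarith+
    obtain p P p0 where P: "\<And>y. complex_of_real (P y) = trig_poly D p y" "\<And>y. 0 \<le> P y" "\<And>y. P y \<le> 1"
      "p 0 = of_real p0" "\<And>k. norm (p k) \<le> p0" "\<bar>p0 - 2 * (w - d)\<bar> \<le> 1 / real L"
      and "\<And>y b. \<bar>y - of_int b\<bar> \<le> w - d - d \<Longrightarrow> P y \<ge> 1 - \<tau>"
      and high: "\<And>y. \<forall>b::int. \<bar>y - of_int b\<bar> \<ge> w - d + d \<Longrightarrow> P y \<le> \<tau>"
      by (rule trig_poly_indicator_approx[OF N d0 L[unfolded D_def] wd, folded D_def, folded \<tau>]) (rule that)
    have p00: "p0 \<ge> 0" using P(5)[of 0] by (rule order.trans[OF norm_ge_zero])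
    have "2 * (w - d) - 2 * d = 2 * w * (1 - 2 * \<kappa>')" by (simp add: d_def algebra_simps)
    then have p0u: "p0 \<ge> 2 * w * (1 - 2 * \<kappa>')" using P(6) Ld by linarith
    have "p0 - 2 * (w - d) \<le> 1 / real L" using P(6) by (simp only: abs_le_iff)
    then have "p0 - 2 * (w - d) \<le> 2 * d" using Ld by (rule order.trans)
    then have p0v: "p0 \<le> 4 * w" using w0 by (simp add: algebra_simps)
    have "(\<Sum>t\<in>T. \<Prod>r\<in>UNIV. P (z t r)) \<le> (\<Sum>t\<in>T. (\<Prod>r\<in>UNIV. real (card (cwin \<delta> \<eta> k q t r))) + real CARD('r) * \<tau>)"
    proof (intro sum_mono prod_le_prod_plus)
      fix t r
      show "P (z t r) \<le> real (card (cwin \<delta> \<eta> k q t r)) + \<tau>"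
      proof (cases "card (cwin \<delta> \<eta> k q t r) = 1")
        case True
        then show ?thesis using P(3)[of "z t r"] \<tau>0 by simp
      next
        case False
        then have "\<forall>b::int. \<bar>z t r - of_int b\<bar> \<ge> w - d + d" using cw(3)[of t r] by (auto simp: not_less[symmetric])
        then show ?thesis using high[of "z t r"] by simp
      qed
    qed (use cw(2) P \<tau>0 in auto)
    also have "\<dots> = real (card {a. rpt \<delta> q a \<in> grid_cube \<eta> k}) + real CARD('r) * \<tau> * cvol \<eta> k q"
      unfolding count by (simp add: sum.distrib cvol_def T_def)
    finally have 1: "(\<Sum>t\<in>T. \<Prod>r\<in>UNIV. P (z t r)) \<le> real (card {a. rpt \<delta> q a \<in> grid_cube \<eta> k}) + real CARD('r) * \<tau> * cvol \<eta> k q" .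
    have "\<bar>(\<Sum>t\<in>T. \<Prod>r\<in>UNIV. P (z t r)) - p0 ^ CARD('r) * real (card T)\<bar> \<le> p0 ^ CARD('r) * ((2 * real D + 1) ^ CARD('r) * E)"
      unfolding z_def by (rule fourier_sum_bound[OF P(1,4,5) finT ESE E0])
    then have 2: "(\<Sum>t\<in>T. \<Prod>r\<in>UNIV. P (z t r)) \<ge> p0 ^ CARD('r) * cvol \<eta> k q - p0 ^ CARD('r) * gain C D q"
      unfolding gain cvol_def T_def by linarith
    have "(\<delta> * \<eta> * (1 - 2 * \<kappa>')) ^ CARD('r) * cvol \<eta> k q \<le> p0 ^ CARD('r) * cvol \<eta> k q"
      using p0u \<kappa>' \<delta> \<eta> by (intro mult_right_mono power_mono) (auto simp: cvol_def w_def)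
    then show ?thesis using 1 2 p0_le[OF p00 p0v] by linarith
  qed
qed

lemma cvol_asymp:
  assumes "cube_ok \<eta> k"
  shows "(\<lambda>Q. (\<Sum>q\<in>{1..Q}. cvol \<eta> k q) / real Q ^ (CARD('n) + 1)) \<longlonglongrightarrow> \<eta> ^ CARD('n) / real (CARD('n) + 1)"
proof -
  have \<eta>: "0 < \<eta>" "\<eta> \<le> 1" using assms by (auto simp: cube_ok_def)
  define K where "K = real CARD('n) * 2 ^ CARD('n)"
  have q1: "\<bar>cvol \<eta> k q - \<eta> ^ CARD('n) * real q ^ CARD('n)\<bar> \<le> K * real q ^ (CARD('n) - 1)" if q: "q > 0" for q
  proof -
    \<comment> \<open>Division by 2q brings all factors into [0,1], as
      \<open>prod_le_prod_plus\<close> requires; rounding may push a side length above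
      \<open>q\<close>, but not above 2q.\<close>
    define a where "a i = real (clen \<eta> k q i) / (2 * real q)" for i
    define b where "b = \<eta> / 2"
    have ab: "\<bar>a i - b\<bar> \<le> 1 / (2 * real q)" for i
    proof -
      have "a i - b = (real (clen \<eta> k q i) - real q * \<eta>) / (2 * real q)" using q by (simp add: a_def b_def field_simps)
      then show ?thesis using clen_bounds[OF \<eta>(1), of k q i] q by (simp add: divide_right_mono)
    qed
    have a01: "0 \<le> a i \<and> a i \<le> 1" for i
    proof -
      have "real (clen \<eta> k q i) \<le> real (2 * q)" using clen_le[OF assms q, of i] by (simp only: of_nat_le_iff)
      then show ?thesis using q by (simp add: a_def)
    qed
    have b01: "0 \<le> b \<and> b \<le> 1" using \<eta> by (simp add: b_def)
    have "(\<Prod>i\<in>UNIV. a i) \<le> (\<Prod>i\<in>(UNIV::'n set). b) + real (card (UNIV :: 'n set)) * (1 / (2 * real q))"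
    proof (rule prod_le_prod_plus)
      show "a i \<le> b + 1 / (2 * real q)" for i using ab[of i] by linarith
    qed (use a01 b01 in auto)
    moreover have "(\<Prod>i\<in>(UNIV::'n set). b) \<le> (\<Prod>i\<in>UNIV. a i) + real (card (UNIV :: 'n set)) * (1 / (2 * real q))"
    proof (rule prod_le_prod_plus)
      show "b \<le> a i + 1 / (2 * real q)" for i using ab[of i] by linarith
    qed (use a01 b01 in auto)
    ultimately have "\<bar>(\<Prod>i\<in>UNIV. a i) - b ^ CARD('n)\<bar> \<le> real CARD('n) * (1 / (2 * real q))" by simp
    moreover have "(\<Prod>i\<in>UNIV. a i) = cvol \<eta> k q / (2 * real q) ^ CARD('n)"
      unfolding a_def cvol_def card_lbox_UNIV by (simp add: prod_dividef)
    moreover have "b ^ CARD('n) = \<eta> ^ CARD('n) * real q ^ CARD('n) / (2 * real q) ^ CARD('n)"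
      using q by (simp add: b_def power_mult_distrib power_divide)
    ultimately have "\<bar>cvol \<eta> k q / (2 * real q) ^ CARD('n) - \<eta> ^ CARD('n) * real q ^ CARD('n) / (2 * real q) ^ CARD('n)\<bar> \<le> real CARD('n) * (1 / (2 * real q))"
      by (simp only:)
    then have *: "\<bar>cvol \<eta> k q - \<eta> ^ CARD('n) * real q ^ CARD('n)\<bar> / (2 * real q) ^ CARD('n) \<le> real CARD('n) * (1 / (2 * real q))"
      unfolding diff_divide_distrib[symmetric] abs_divide by simp
    have "\<bar>cvol \<eta> k q - \<eta> ^ CARD('n) * real q ^ CARD('n)\<bar> \<le> real CARD('n) * (1 / (2 * real q)) * (2 * real q) ^ CARD('n)"
    proof -
      have pos: "(2 * real q) ^ CARD('n) > 0" using q by simp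
      from * show ?thesis unfolding pos_divide_le_eq[OF pos] .
    qed
    also have "(2 * real q) ^ CARD('n) = 2 ^ CARD('n) * (real q ^ (CARD('n) - 1) * real q)"
      using power_minus_mult[of "CARD('n)" "real q"] n3 by (simp add: power_mult_distrib)
    also have "real CARD('n) * (1 / (2 * real q)) * (2 ^ CARD('n) * (real q ^ (CARD('n) - 1) * real q)) = K / 2 * real q ^ (CARD('n) - 1)"
      using q by (simp add: K_def)
    also have "\<dots> \<le> K * real q ^ (CARD('n) - 1)" by (intro mult_right_mono) (auto simp: K_def)
    finally show ?thesis .
  qed
  have bound: "\<bar>(\<Sum>q\<in>{1..Q}. cvol \<eta> k q) / real Q ^ (CARD('n) + 1) - \<eta> ^ CARD('n) / real (CARD('n) + 1)\<bar> \<le> (K + 1) / real Q"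
    if Q: "Q > 0" for Q
  proof -
    define S where "S = (\<Sum>q\<in>{1..Q}. real q ^ CARD('n))"
    define V where "V = (\<Sum>q\<in>{1..Q}. cvol \<eta> k q)"
    have "\<bar>V - \<eta> ^ CARD('n) * S\<bar> = \<bar>\<Sum>q\<in>{1..Q}. cvol \<eta> k q - \<eta> ^ CARD('n) * real q ^ CARD('n)\<bar>"
      by (simp add: V_def S_def sum_subtractf sum_distrib_left)
    also have "\<dots> \<le> (\<Sum>q\<in>{1..Q}. K * real Q ^ (CARD('n) - 1))"
    proof (rule order.trans[OF sum_abs], rule sum_mono)
      fix q assume q: "q \<in> {1..Q}"
      then have "K * real q ^ (CARD('n) - 1) \<le> K * real Q ^ (CARD('n) - 1)"
        by (intro mult_left_mono power_mono) (auto simp: K_def)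
      then show "\<bar>cvol \<eta> k q - \<eta> ^ CARD('n) * real q ^ CARD('n)\<bar> \<le> K * real Q ^ (CARD('n) - 1)"
        using q1[of q] q by simp
    qed
    also have "\<dots> = K * real Q ^ CARD('n)"
      using power_minus_mult[of "CARD('n)" "real Q"] n3 by (simp add: mult.commute)
    finally have 1: "\<bar>V - \<eta> ^ CARD('n) * S\<bar> \<le> K * real Q ^ CARD('n)" .
    have "\<bar>S - real Q ^ Suc CARD('n) / real (Suc CARD('n))\<bar> \<le> real Q ^ CARD('n)"
      using sum_power_bounds[of "CARD('n)" Q] unfolding S_def by simp
    then have "\<eta> ^ CARD('n) * \<bar>S - real Q ^ Suc CARD('n) / real (Suc CARD('n))\<bar> \<le> 1 * real Q ^ CARD('n)"
      using \<eta> by (intro mult_mono power_le_one) auto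
    moreover define Y where "Y = \<eta> ^ CARD('n) * (real Q ^ Suc CARD('n) / real (Suc CARD('n)))"
    moreover have "\<eta> ^ CARD('n) * \<bar>S - real Q ^ Suc CARD('n) / real (Suc CARD('n))\<bar> = \<bar>\<eta> ^ CARD('n) * S - Y\<bar>"
    proof -
      have "\<bar>\<eta> ^ CARD('n) * S - Y\<bar> = \<bar>\<eta> ^ CARD('n) * (S - real Q ^ Suc CARD('n) / real (Suc CARD('n)))\<bar>"
        unfolding Y_def by (simp only: right_diff_distrib)
      then show ?thesis using \<eta> by (simp only: abs_mult) simp
    qed
    ultimately have "\<bar>\<eta> ^ CARD('n) * S - Y\<bar> \<le> real Q ^ CARD('n)" by simp
    moreover have "\<bar>V - Y\<bar> \<le> \<bar>V - \<eta> ^ CARD('n) * S\<bar> + \<bar>\<eta> ^ CARD('n) * S - Y\<bar>" by linarith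
    ultimately have "\<bar>V - Y\<bar> \<le> (K + 1) * real Q ^ CARD('n)"
      using 1 unfolding distrib_right by linarith
    then have 2: "\<bar>V - \<eta> ^ CARD('n) * (real Q ^ Suc CARD('n) / real (Suc CARD('n)))\<bar> \<le> (K + 1) * real Q ^ CARD('n)"
      unfolding Y_def .
    have "V / real Q ^ (CARD('n) + 1) - \<eta> ^ CARD('n) / real (CARD('n) + 1) = (V - \<eta> ^ CARD('n) * (real Q ^ Suc CARD('n) / real (Suc CARD('n)))) / real Q ^ Suc CARD('n)"
      using Q by (simp add: diff_divide_distrib)
    then have "\<bar>V / real Q ^ (CARD('n) + 1) - \<eta> ^ CARD('n) / real (CARD('n) + 1)\<bar> \<le> (K + 1) * real Q ^ CARD('n) / real Q ^ Suc CARD('n)"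
      using 2 by (simp add: divide_right_mono del: power_Suc)
    also have "\<dots> = (K + 1) / real Q" using Q by simp
    finally show ?thesis unfolding V_def .
  qed
  have "(\<lambda>Q. (K + 1) / real Q) \<longlonglongrightarrow> 0" by real_asymp
  then have "(\<lambda>Q. (\<Sum>q\<in>{1..Q}. cvol \<eta> k q) / real Q ^ (CARD('n) + 1) - \<eta> ^ CARD('n) / real (CARD('n) + 1)) \<longlonglongrightarrow> 0"
    by (rule Lim_null_comparison[rotated]) (use bound in \<open>auto intro!: eventually_sequentiallyI[of 1]\<close>)
  then show ?thesis by (simp only: LIM_zero_iff)
qed

end

section \<open>Choice of the degree, and equidistribution uniformly in \<delta>\<close>

context curved_graph
begin

text \<open>For D = Q^x, the error D^R (D Q)^((n-1)/2) Q^2, summed over all denominators, and the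
  main term Q^(n+1) balance at x = \<open>crit\<close>; the third claim of
  \<open>crit_bounds\<close> is this equation.\<close>

definition crit :: real where
  "crit = (real CARD('n) - 1) / (real CARD('n) + 2 * real CARD('r) - 1)"

lemma crit_bounds: "0 < crit" "crit < 1" "crit * (real CARD('r) + (real CARD('n) - 1) / 2) = (real CARD('n) - 1) / 2"
proof -
  have R: "real CARD('r) \<ge> 1" by (simp add: Suc_le_eq)
  have n: "real CARD('n) \<ge> 3" using n3 by simp
  show "0 < crit" unfolding crit_def using R n by simp
  show "crit < 1" unfolding crit_def using R n by simp
  have "real CARD('n) + 2 * real CARD('r) - 1 \<noteq> 0" using R n by linarith
  then show "crit * (real CARD('r) + (real CARD('n) - 1) / 2) = (real CARD('n) - 1) / 2"
    unfolding crit_def by (simp add: field_simps)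
qed

lemma gain_mono:
  assumes "C > 0" "0 < q" "q \<le> Q"
  shows "gain C D q \<le> gain C D Q"
proof -
  have "ln (real q) \<ge> 0" "ln (real q) \<le> ln (real Q)" using assms by auto
  then have "C * sqrt (real D * real q) ^ (CARD('n) - 1) * real q * (2 + ln (real q)) ^ CARD('n)
     \<le> C * sqrt (real D * real Q) ^ (CARD('n) - 1) * real Q * (2 + ln (real Q)) ^ CARD('n)"
    using assms by (intro mult_mono power_mono mult_left_mono real_sqrt_le_mono) auto
  then show ?thesis unfolding gain_def by (intro mult_left_mono) auto
qed

text \<open>Bookkeeping of exponents for a degree of order Q^\<beta>. The leading factor
  \<open>Q\<close> is the number of denominators, each of which is estimated by the last
  one.\<close>

lemma gain_le:
  assumes C: "C > 0" and Q: "Q > 0" and \<beta>: "\<beta> \<ge> 0" and m: "m \<ge> 1" and D: "real D \<le> 4 * real m * real Q powr \<beta>"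
  shows "real Q * gain C D Q / real Q ^ (CARD('n) + 1) \<le>
    (8 * real m + 1) ^ CARD('r) * C * sqrt (4 * real m) ^ (CARD('n) - 1) *
    (real Q powr (\<beta> * (real CARD('r) + (real CARD('n) - 1) / 2) - (real CARD('n) - 1) / 2) * (2 + ln (real Q)) ^ CARD('n))"
proof -
  define x where "x = real Q"
  have x1: "x \<ge> 1" using Q by (simp add: x_def)
  have b1: "x powr \<beta> \<ge> 1" using x1 \<beta> by (simp add: ge_one_powr_ge_zero)
  have L: "2 + ln x \<ge> 0" using x1 by (simp add: add_nonneg_nonneg)
  have D1: "2 * real D + 1 \<le> (8 * real m + 1) * x powr \<beta>"
    using D b1 unfolding x_def[symmetric] by (simp add: algebra_simps)
  have D2: "sqrt (real D * x) \<le> sqrt (4 * real m) * x powr ((\<beta> + 1) / 2)"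
  proof -
    have "real D * x \<le> 4 * real m * x powr \<beta> * x"
      using D x1 unfolding x_def[symmetric] by (intro mult_right_mono) auto
    also have "\<dots> = (4 * real m) * x powr (\<beta> + 1)" using x1 by (simp add: powr_add)
    finally have "sqrt (real D * x) \<le> sqrt (4 * real m) * sqrt (x powr (\<beta> + 1))"
      unfolding real_sqrt_mult[symmetric] by (rule real_sqrt_le_mono)
    also have "sqrt (x powr (\<beta> + 1)) = x powr ((\<beta> + 1) / 2)"
      by (simp add: powr_half_sqrt[symmetric] powr_powr)
    finally show ?thesis .
  qed
  have "gain C D Q \<le> ((8 * real m + 1) * x powr \<beta>) ^ CARD('r) * (C * (sqrt (4 * real m) * x powr ((\<beta> + 1) / 2)) ^ (CARD('n) - 1) * x * (2 + ln x) ^ CARD('n))"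
    unfolding gain_def x_def[symmetric] using C L x1 D1 D2
    by (intro mult_mono power_mono mult_left_mono mult_right_mono mult_nonneg_nonneg zero_le_power) auto
  then have "x * gain C D Q / x ^ (CARD('n) + 1) \<le> x * (((8 * real m + 1) * x powr \<beta>) ^ CARD('r) * (C * (sqrt (4 * real m) * x powr ((\<beta> + 1) / 2)) ^ (CARD('n) - 1) * x * (2 + ln x) ^ CARD('n))) / x ^ (CARD('n) + 1)"
    using x1 by (intro divide_right_mono mult_left_mono) auto
  also have "\<dots> = (8 * real m + 1) ^ CARD('r) * C * sqrt (4 * real m) ^ (CARD('n) - 1) *
     ((x powr \<beta>) ^ CARD('r) * (x powr ((\<beta> + 1) / 2)) ^ (CARD('n) - 1) * (x * x) / x ^ (CARD('n) + 1) * (2 + ln x) ^ CARD('n))"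
    by (simp add: power_mult_distrib mult_ac)
  also have "(x powr \<beta>) ^ CARD('r) * (x powr ((\<beta> + 1) / 2)) ^ (CARD('n) - 1) * (x * x) / x ^ (CARD('n) + 1)
     = x powr (\<beta> * (real CARD('r) + (real CARD('n) - 1) / 2) - (real CARD('n) - 1) / 2)"
  proof -
    have e1: "(x powr \<beta>) ^ CARD('r) = x powr (\<beta> * real CARD('r))" using x1 by (simp add: powr_realpow[symmetric] powr_powr)
    have e2: "(x powr ((\<beta> + 1) / 2)) ^ (CARD('n) - 1) = x powr ((\<beta> + 1) / 2 * (real CARD('n) - 1))"
      using x1 n3 by (simp add: powr_realpow[symmetric] powr_powr of_nat_diff)
    have e3: "x * x = x powr 2" using x1 by (simp add: powr_numeral power2_eq_square)
    have xpos: "x > 0" using x1 by simp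
    have e4: "x ^ (CARD('n) + 1) = x powr (real CARD('n) + 1)"
      by (simp only: powr_realpow[OF xpos, of "CARD('n) + 1", symmetric] of_nat_add of_nat_1)
    show ?thesis unfolding e1 e2 e3 e4 powr_add[symmetric] powr_diff[symmetric]
      by (rule arg_cong[where f = "\<lambda>e. x powr e"]) (simp add: field_simps)
  qed
  finally show ?thesis unfolding x_def .
qed

text \<open>The constants depend on the cube, \<epsilon> and \<kappa>', but on neither
  \<open>Q\<close> nor \<delta>; this is the source of the uniformity in \<delta>. With \<kappa>'
  fixed, the \<open>K1\<close> and \<open>K2\<close> terms tend to 0.\<close>

lemma ccount_bounds:
  assumes ok: "cube_ok \<eta> k" and \<epsilon>: "0 < \<epsilon>" "\<epsilon> < crit" and \<kappa>': "0 < \<kappa>'" "\<kappa>' \<le> 1 / 2"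
  obtains K1 K2 s :: real where "s > 0" "K1 \<ge> 0" "K2 \<ge> 0"
   "\<And>Q \<delta>. Q > 0 \<Longrightarrow> real Q powr (- crit + \<epsilon>) \<le> \<delta> \<Longrightarrow> \<delta> \<le> 1 / 2 \<Longrightarrow>
     real (ccount \<delta> \<eta> k Q) / (\<delta> ^ CARD('r) * real Q ^ (CARD('n) + 1)) \<le>
       (\<eta> * (1 + 2 * \<kappa>')) ^ CARD('r) * ((\<Sum>q\<in>{1..Q}. cvol \<eta> k q) / real Q ^ (CARD('n) + 1))
       + K1 * (real Q powr (- s) * (2 + ln (real Q)) ^ CARD('n)) + K2 / real Q * ((\<Sum>q\<in>{1..Q}. cvol \<eta> k q) / real Q ^ (CARD('n) + 1))
     \<and> real (ccount \<delta> \<eta> k Q) / (\<delta> ^ CARD('r) * real Q ^ (CARD('n) + 1)) \<ge>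
       (\<eta> * (1 - 2 * \<kappa>')) ^ CARD('r) * ((\<Sum>q\<in>{1..Q}. cvol \<eta> k q) / real Q ^ (CARD('n) + 1))
       - K1 * (real Q powr (- s) * (2 + ln (real Q)) ^ CARD('n)) - K2 / real Q * ((\<Sum>q\<in>{1..Q}. cvol \<eta> k q) / real Q ^ (CARD('n) + 1))"
proof -
  have \<eta>: "0 < \<eta>" "\<eta> \<le> 1" using ok by (auto simp: cube_ok_def)
  obtain C where C0: "C > 0" and ES: "\<And>q j J r0 A N. q > 0 \<Longrightarrow> J \<ge> 1 \<Longrightarrow> (\<forall>r. \<bar>j r\<bar> \<le> J) \<Longrightarrow> \<bar>j r0\<bar> = J \<Longrightarrow>
     (\<forall>i. N i \<le> 2 * q) \<Longrightarrow>
     (\<forall>t\<in>lbox UNIV N (\<lambda>_. 0). \<forall>i. \<bar>(of_int (A i) + real (t i)) / real q - x0 $ i\<bar> \<le> \<rho> / 2) \<Longrightarrow>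
     norm (\<Sum>t\<in>lbox UNIV N (\<lambda>_. 0). ecis (phase j q (\<chi> i. (of_int (A i) + real (t i)) / real q)))
       \<le> C * sqrt (of_int J * real q) ^ (CARD('n) - 1) * real q * (2 + ln (real q)) ^ CARD('n)"
    using exponential_sum_bound by blast
  \<comment> \<open>With this \<open>m\<close> the kernel tail Q^(-m \<epsilon>) outweighs Q^\<beta>
    \<le> Q and \<delta>^(-R) \<le> Q^R and still leaves a factor 1/Q.\<close>
  define m where "m = nat \<lceil>(real CARD('r) + 2) / \<epsilon>\<rceil> + 1"
  have m1: "m \<ge> 1" by (simp add: m_def)
  have "(real CARD('r) + 2) / \<epsilon> \<le> real m" unfolding m_def by linarith
  then have m\<epsilon>: "real m * \<epsilon> \<ge> real CARD('r) + 2" using \<epsilon> by (simp add: pos_divide_le_eq)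
  \<comment> \<open>Half of \<epsilon> is spent on the degree, Q^(\<epsilon>/2)/\<delta> with
    1/\<delta> \<le> Q^(crit - \<epsilon>); the other half becomes the saving
    \<open>s\<close>.\<close>
  define \<beta> where "\<beta> = crit - \<epsilon> / 2"
  have \<beta>: "\<beta> \<ge> 0" "\<beta> \<le> 1" using \<epsilon> crit_bounds by (auto simp: \<beta>_def)
  define h where "h = \<kappa>' * \<eta> / 2"
  have h0: "h > 0" using \<kappa>' \<eta> by (simp add: h_def)
  define K1 where "K1 = 2 ^ CARD('r) * ((8 * real m + 1) ^ CARD('r) * C * sqrt (4 * real m) ^ (CARD('n) - 1))"
  define K2 where "K2 = real CARD('r) * ((8 * real m + 1) / h ^ (2 * m))"
  define s where "s = \<epsilon> / 2 * (real CARD('r) + (real CARD('n) - 1) / 2)"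
  have "real CARD('n) \<ge> 3" using n3 by simp
  then have s0: "s > 0" unfolding s_def using \<epsilon> by (intro mult_pos_pos add_nonneg_pos) auto
  have sexp: "\<beta> * (real CARD('r) + (real CARD('n) - 1) / 2) - (real CARD('n) - 1) / 2 = - s"
    unfolding \<beta>_def s_def left_diff_distrib crit_bounds(3) by simp
  show thesis
  proof (rule that[OF s0, of K1 K2])
    show "K1 \<ge> 0" "K2 \<ge> 0" unfolding K1_def K2_def using C0 h0 by auto
    fix Q \<delta> assume Q: "Q > 0" and \<delta>: "real Q powr (- crit + \<epsilon>) \<le> \<delta>" "\<delta> \<le> 1 / 2"
    define x where "x = real Q"
    have x1: "x \<ge> 1" using Q by (simp add: x_def)
    have "x powr (- crit + \<epsilon>) > 0" using x1 by simp
    then have \<delta>0: "\<delta> > 0" using \<delta>(1) unfolding x_def by (rule less_le_trans)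
    define y where "y = x powr (\<epsilon> / 2)"
    have y1: "y \<ge> 1" unfolding y_def using x1 \<epsilon> by (intro ge_one_powr_ge_zero) auto
    \<comment> \<open>A kernel of length about 1/\<delta> resolves windows of width \<delta>; the
      surplus \<open>y\<close> makes its tails decay like y^(-2m) = Q^(-m \<epsilon>).\<close>
    define N where "N = nat \<lceil>y / \<delta>\<rceil>"
    have yd: "y / \<delta> \<ge> 1" using y1 \<delta> \<delta>0 by (simp add: pos_le_divide_eq)
    have N1: "y / \<delta> \<le> real N" "real N \<le> y / \<delta> + 1" unfolding N_def using yd by linarith+
    have N0: "N > 0" using N1 yd by (cases N) auto
    have invd: "1 / \<delta> \<le> x powr (crit - \<epsilon>)"
    proof -
      have "1 / \<delta> \<le> 1 / x powr (- crit + \<epsilon>)" using \<delta> \<delta>0 x1 by (intro divide_left_mono) (auto simp: x_def)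
      also have "\<dots> = x powr (- (- crit + \<epsilon>))" by (simp only: powr_minus_divide)
      finally show ?thesis by simp
    qed
    have "y / \<delta> \<le> x powr \<beta>"
    proof -
      have "y * (1 / \<delta>) \<le> y * x powr (crit - \<epsilon>)" using invd y1 by (intro mult_left_mono) auto
      also have "\<dots> = x powr \<beta>" unfolding y_def powr_add[symmetric] by (simp add: \<beta>_def)
      finally show ?thesis by simp
    qed
    then have N2: "real N \<le> 2 * x powr \<beta>" using N1 yd by linarith
    define D where "D = m * (2 * N)"
    have D: "real D \<le> 4 * real m * x powr \<beta>"
      unfolding D_def using mult_left_mono[OF N2, of "2 * real m"] by simp
    define \<tau> where "\<tau> = (2 * real D + 1) / (real N * (\<kappa>' * (\<delta> * \<eta> / 2))) ^ (2 * m)"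
    define V where "V = (\<Sum>q\<in>{1..Q}. cvol \<eta> k q)"
    have V0: "V \<ge> 0" unfolding V_def cvol_def by (intro sum_nonneg) auto
    define G where "G = (2 * \<delta> * \<eta>) ^ CARD('r) * (x * gain C D Q)"
    have Gq: "(\<Sum>q\<in>{1..Q}. (2 * \<delta> * \<eta>) ^ CARD('r) * gain C D q) \<le> G"
    proof -
      have "(\<Sum>q\<in>{1..Q}. (2 * \<delta> * \<eta>) ^ CARD('r) * gain C D q) \<le> (\<Sum>q\<in>{1..Q}. (2 * \<delta> * \<eta>) ^ CARD('r) * gain C D Q)"
        using \<delta>0 \<eta> gain_mono[OF C0] by (intro sum_mono mult_left_mono) auto
      then show ?thesis by (simp add: G_def x_def mult_ac)
    qed
    have upper: "real (ccount \<delta> \<eta> k Q) \<le> (\<delta> * \<eta> * (1 + 2 * \<kappa>')) ^ CARD('r) * V + G + real CARD('r) * \<tau> * V"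
    proof -
      have "real (ccount \<delta> \<eta> k Q) \<le> (\<Sum>q\<in>{1..Q}. (\<delta> * \<eta> * (1 + 2 * \<kappa>')) ^ CARD('r) * cvol \<eta> k q + (2 * \<delta> * \<eta>) ^ CARD('r) * gain C D q + real CARD('r) * \<tau> * cvol \<eta> k q)"
        unfolding ccount_def of_nat_sum \<tau>_def D_def
        by (intro sum_mono count_q_bounds(1)[OF ok \<delta>0 \<delta>(2) \<kappa>' _ N0 C0 ES]) auto
      then show ?thesis using Gq by (simp add: sum.distrib sum_distrib_left[symmetric] V_def)
    qed
    have lower: "real (ccount \<delta> \<eta> k Q) \<ge> (\<delta> * \<eta> * (1 - 2 * \<kappa>')) ^ CARD('r) * V - G - real CARD('r) * \<tau> * V"
    proof -
      have "real (ccount \<delta> \<eta> k Q) \<ge> (\<Sum>q\<in>{1..Q}. (\<delta> * \<eta> * (1 - 2 * \<kappa>')) ^ CARD('r) * cvol \<eta> k q - (2 * \<delta> * \<eta>) ^ CARD('r) * gain C D q - real CARD('r) * \<tau> * cvol \<eta> k q)"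
        unfolding ccount_def of_nat_sum \<tau>_def D_def
        by (intro sum_mono count_q_bounds(2)[OF ok \<delta>0 \<delta>(2) \<kappa>' _ N0 C0 ES]) auto
      then show ?thesis using Gq by (simp add: sum_subtractf sum_distrib_left[symmetric] V_def)
    qed
    define X where "X = \<delta> ^ CARD('r) * x ^ (CARD('n) + 1)"
    have X0: "X > 0" unfolding X_def using \<delta>0 x1 by simp
    have main: "(\<delta> * \<eta> * c) ^ CARD('r) * V / X = (\<eta> * c) ^ CARD('r) * (V / x ^ (CARD('n) + 1))" for c
      using \<delta>0 by (simp add: X_def power_mult_distrib)
    \<comment> \<open>\<delta>^R cancels between the error and the normaliser; the bound that is
      left depends on \<open>Q\<close> alone.\<close>
    have GX: "G / X \<le> K1 * (x powr (- s) * (2 + ln x) ^ CARD('n))"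
    proof -
      have "G / X = (2 * \<eta>) ^ CARD('r) * (x * gain C D Q / x ^ (CARD('n) + 1))"
        using \<delta>0 by (simp add: G_def X_def power_mult_distrib)
      also have "\<dots> \<le> 2 ^ CARD('r) * (x * gain C D Q / x ^ (CARD('n) + 1))"
        using \<eta> x1 C0 by (intro mult_right_mono power_mono) (auto simp: gain_def x_def intro!: mult_nonneg_nonneg divide_nonneg_nonneg)
      also have "\<dots> \<le> 2 ^ CARD('r) * ((8 * real m + 1) ^ CARD('r) * C * sqrt (4 * real m) ^ (CARD('n) - 1) * (x powr (- s) * (2 + ln x) ^ CARD('n)))"
        using gain_le[OF C0 Q \<beta>(1) m1 D[unfolded x_def]] unfolding sexp x_def by (intro mult_left_mono) auto
      finally show ?thesis by (simp add: K1_def mult.assoc)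
    qed
    have \<tau>X: "real CARD('r) * \<tau> * V / X \<le> K2 / x * (V / x ^ (CARD('n) + 1))"
    proof -
      have "y * h \<le> real N * (\<kappa>' * (\<delta> * \<eta> / 2))"
      proof -
        have "y / \<delta> * (\<kappa>' * (\<delta> * \<eta> / 2)) \<le> real N * (\<kappa>' * (\<delta> * \<eta> / 2))"
          using N1 \<kappa>' \<delta>0 \<eta> by (intro mult_right_mono) auto
        then show ?thesis using \<delta>0 by (simp add: h_def)
      qed
      then have "(y * h) ^ (2 * m) \<le> (real N * (\<kappa>' * (\<delta> * \<eta> / 2))) ^ (2 * m)"
        using y1 h0 by (intro power_mono) auto
      then have "\<tau> \<le> (2 * real D + 1) / (y * h) ^ (2 * m)"
        unfolding \<tau>_def using y1 h0 N0 \<kappa>' \<delta>0 \<eta> by (intro divide_left_mono mult_pos_pos zero_less_power) auto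
      also have "\<dots> \<le> ((8 * real m + 1) * x powr \<beta>) / (y * h) ^ (2 * m)"
      proof (intro divide_right_mono)
        have "x powr \<beta> \<ge> 1" using x1 \<beta> by (simp add: ge_one_powr_ge_zero)
        then show "2 * real D + 1 \<le> (8 * real m + 1) * x powr \<beta>" using D by (simp add: algebra_simps)
      qed (use y1 h0 in auto)
      also have "\<dots> = (8 * real m + 1) / h ^ (2 * m) * (x powr \<beta> / y ^ (2 * m))"
        by (simp add: power_mult_distrib)
      finally have "\<tau> * (1 / \<delta>) ^ CARD('r) \<le> (8 * real m + 1) / h ^ (2 * m) * (x powr \<beta> / y ^ (2 * m)) * (x powr (crit - \<epsilon>)) ^ CARD('r)"
        using invd \<delta>0 h0 y1 by (intro mult_mono power_mono) auto
      also have "\<dots> = (8 * real m + 1) / h ^ (2 * m) * (x powr \<beta> / y ^ (2 * m) * (x powr (crit - \<epsilon>)) ^ CARD('r))" by simp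
      also have "\<dots> \<le> (8 * real m + 1) / h ^ (2 * m) * (1 / x)"
      proof (intro mult_left_mono)
        have "x powr \<beta> / y ^ (2 * m) * (x powr (crit - \<epsilon>)) ^ CARD('r) = x powr (\<beta> - real m * \<epsilon> + (crit - \<epsilon>) * real CARD('r))"
        proof -
          have "y ^ (2 * m) = x powr (real m * \<epsilon>)" unfolding y_def using x1 by (simp add: powr_realpow[symmetric] powr_powr mult.commute)
          moreover have "(x powr (crit - \<epsilon>)) ^ CARD('r) = x powr ((crit - \<epsilon>) * real CARD('r))"
            using x1 by (simp add: powr_realpow[symmetric] powr_powr)
          ultimately show ?thesis by (simp add: powr_add powr_diff)
        qed
        also have "\<dots> \<le> x powr (-1)"
        proof (intro powr_mono x1)
          have "(crit - \<epsilon>) * real CARD('r) \<le> 1 * real CARD('r)" using \<epsilon> crit_bounds by (intro mult_right_mono) auto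
          then show "\<beta> - real m * \<epsilon> + (crit - \<epsilon>) * real CARD('r) \<le> - 1" using m\<epsilon> \<beta> by linarith
        qed
        also have "\<dots> = 1 / x" using x1 by (simp add: powr_minus_divide)
        finally show "x powr \<beta> / y ^ (2 * m) * (x powr (crit - \<epsilon>)) ^ CARD('r) \<le> 1 / x" .
      qed (use h0 in auto)
      finally have t: "\<tau> * (1 / \<delta>) ^ CARD('r) \<le> (8 * real m + 1) / h ^ (2 * m) * (1 / x)" .
      have "real CARD('r) * \<tau> * V / X = real CARD('r) * (\<tau> * (1 / \<delta>) ^ CARD('r)) * (V / x ^ (CARD('n) + 1))"
        by (simp add: X_def power_one_over)
      also have "\<dots> \<le> real CARD('r) * ((8 * real m + 1) / h ^ (2 * m) * (1 / x)) * (V / x ^ (CARD('n) + 1))"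
        using V0 x1 by (intro mult_right_mono mult_left_mono t) auto
      finally show ?thesis by (simp add: K2_def)
    qed
    have "real (ccount \<delta> \<eta> k Q) / X \<le> (\<delta> * \<eta> * (1 + 2 * \<kappa>')) ^ CARD('r) * V / X + G / X + real CARD('r) * \<tau> * V / X"
      using divide_right_mono[OF upper, of X] X0 by (simp add: add_divide_distrib)
    moreover have "real (ccount \<delta> \<eta> k Q) / X \<ge> (\<delta> * \<eta> * (1 - 2 * \<kappa>')) ^ CARD('r) * V / X - G / X - real CARD('r) * \<tau> * V / X"
      using divide_right_mono[OF lower, of X] X0 by (simp add: diff_divide_distrib)
    ultimately show "real (ccount \<delta> \<eta> k Q) / (\<delta> ^ CARD('r) * real Q ^ (CARD('n) + 1)) \<le>
       (\<eta> * (1 + 2 * \<kappa>')) ^ CARD('r) * ((\<Sum>q\<in>{1..Q}. cvol \<eta> k q) / real Q ^ (CARD('n) + 1))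
       + K1 * (real Q powr (- s) * (2 + ln (real Q)) ^ CARD('n)) + K2 / real Q * ((\<Sum>q\<in>{1..Q}. cvol \<eta> k q) / real Q ^ (CARD('n) + 1))
     \<and> real (ccount \<delta> \<eta> k Q) / (\<delta> ^ CARD('r) * real Q ^ (CARD('n) + 1)) \<ge>
       (\<eta> * (1 - 2 * \<kappa>')) ^ CARD('r) * ((\<Sum>q\<in>{1..Q}. cvol \<eta> k q) / real Q ^ (CARD('n) + 1))
       - K1 * (real Q powr (- s) * (2 + ln (real Q)) ^ CARD('n)) - K2 / real Q * ((\<Sum>q\<in>{1..Q}. cvol \<eta> k q) / real Q ^ (CARD('n) + 1))"
      using GX \<tau>X unfolding main X_def[symmetric] x_def[symmetric] V_def[symmetric] by linarith
  qed
qed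

lemma powr_log_power_tendsto_0:
  assumes "s > 0"
  shows "(\<lambda>Q. real Q powr (- s) * (2 + ln (real Q)) ^ d) \<longlonglongrightarrow> 0"
  using assms by real_asymp

text \<open>The limit is the volume of the cube divided by n+1, the divisor coming from the sum of
  q^n.\<close>

theorem cube_equidistribution:
  assumes ok: "cube_ok \<eta> k" and \<epsilon>: "0 < \<epsilon>" "\<epsilon> < crit" and e: "e > 0"
  shows "\<forall>\<^sub>F Q in sequentially. \<forall>\<delta>. real Q powr (- crit + \<epsilon>) \<le> \<delta> \<and> \<delta> \<le> 1 / 2 \<longrightarrow>
     \<bar>real (ccount \<delta> \<eta> k Q) / (\<delta> ^ CARD('r) * real Q ^ (CARD('n) + 1)) - \<eta> ^ CARD('r) * (\<eta> ^ CARD('n) / real (CARD('n) + 1))\<bar> < e"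
proof -
  define v where "v = \<eta> ^ CARD('n) / real (CARD('n) + 1)"
  \<comment> \<open>\<kappa>' is fixed by the tolerance \<open>e\<close> first; only afterwards does
    \<open>Q\<close> tend to infinity.\<close>
  have "((\<lambda>\<kappa>'. (\<eta> * (1 + 2 * \<kappa>')) ^ CARD('r) * v) \<longlongrightarrow> (\<eta> * (1 + 2 * 0)) ^ CARD('r) * v) (at_right 0)"
    "((\<lambda>\<kappa>'. (\<eta> * (1 - 2 * \<kappa>')) ^ CARD('r) * v) \<longlongrightarrow> (\<eta> * (1 - 2 * 0)) ^ CARD('r) * v) (at_right 0)"
    by (intro tendsto_intros)+
  then have "\<forall>\<^sub>F \<kappa>' in at_right 0. (\<eta> * (1 + 2 * \<kappa>')) ^ CARD('r) * v < \<eta> ^ CARD('r) * v + e"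
     "\<forall>\<^sub>F \<kappa>' in at_right 0. (\<eta> * (1 - 2 * \<kappa>')) ^ CARD('r) * v > \<eta> ^ CARD('r) * v - e"
    using e by (auto intro!: order_tendstoD)
  moreover have "\<forall>\<^sub>F \<kappa>' in at_right 0. (0::real) < \<kappa>' \<and> \<kappa>' < 1 / 2"
    by (auto intro: eventually_at_right_less eventually_conj eventually_at_rightI[of 0 "1/2"])
  ultimately have "\<forall>\<^sub>F \<kappa>' in at_right 0. 0 < \<kappa>' \<and> \<kappa>' < 1 / 2 \<and>
     (\<eta> * (1 + 2 * \<kappa>')) ^ CARD('r) * v < \<eta> ^ CARD('r) * v + e \<and> (\<eta> * (1 - 2 * \<kappa>')) ^ CARD('r) * v > \<eta> ^ CARD('r) * v - e"
    by eventually_elim auto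
  then have "\<exists>\<kappa>'. 0 < \<kappa>' \<and> \<kappa>' < 1 / 2 \<and>
     (\<eta> * (1 + 2 * \<kappa>')) ^ CARD('r) * v < \<eta> ^ CARD('r) * v + e \<and> (\<eta> * (1 - 2 * \<kappa>')) ^ CARD('r) * v > \<eta> ^ CARD('r) * v - e"
    by (rule eventually_happens'[OF trivial_limit_at_right_real])
  then obtain \<kappa>' where \<kappa>': "0 < \<kappa>'" "\<kappa>' \<le> 1 / 2" "(\<eta> * (1 + 2 * \<kappa>')) ^ CARD('r) * v < \<eta> ^ CARD('r) * v + e"
    "(\<eta> * (1 - 2 * \<kappa>')) ^ CARD('r) * v > \<eta> ^ CARD('r) * v - e"
    by (auto intro: less_imp_le)
  obtain K1 K2 s where s: "s > 0" and K: "K1 \<ge> 0" "K2 \<ge> 0" and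
   B: "\<And>Q \<delta>. Q > 0 \<Longrightarrow> real Q powr (- crit + \<epsilon>) \<le> \<delta> \<Longrightarrow> \<delta> \<le> 1 / 2 \<Longrightarrow>
     real (ccount \<delta> \<eta> k Q) / (\<delta> ^ CARD('r) * real Q ^ (CARD('n) + 1)) \<le>
       (\<eta> * (1 + 2 * \<kappa>')) ^ CARD('r) * ((\<Sum>q\<in>{1..Q}. cvol \<eta> k q) / real Q ^ (CARD('n) + 1))
       + K1 * (real Q powr (- s) * (2 + ln (real Q)) ^ CARD('n)) + K2 / real Q * ((\<Sum>q\<in>{1..Q}. cvol \<eta> k q) / real Q ^ (CARD('n) + 1))
     \<and> real (ccount \<delta> \<eta> k Q) / (\<delta> ^ CARD('r) * real Q ^ (CARD('n) + 1)) \<ge>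
       (\<eta> * (1 - 2 * \<kappa>')) ^ CARD('r) * ((\<Sum>q\<in>{1..Q}. cvol \<eta> k q) / real Q ^ (CARD('n) + 1))
       - K1 * (real Q powr (- s) * (2 + ln (real Q)) ^ CARD('n)) - K2 / real Q * ((\<Sum>q\<in>{1..Q}. cvol \<eta> k q) / real Q ^ (CARD('n) + 1))"
    by (rule ccount_bounds[OF ok \<epsilon> \<kappa>'(1,2)]) (rule that)
  have K2: "(\<lambda>Q. K2 / real Q) \<longlonglongrightarrow> 0" by real_asymp
  note lims = cvol_asymp[OF ok, folded v_def] powr_log_power_tendsto_0[OF s, of "CARD('n)"] K2
  have "(\<lambda>Q. (\<eta> * (1 + 2 * \<kappa>')) ^ CARD('r) * ((\<Sum>q\<in>{1..Q}. cvol \<eta> k q) / real Q ^ (CARD('n) + 1))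
       + K1 * (real Q powr (- s) * (2 + ln (real Q)) ^ CARD('n)) + K2 / real Q * ((\<Sum>q\<in>{1..Q}. cvol \<eta> k q) / real Q ^ (CARD('n) + 1)))
      \<longlonglongrightarrow> (\<eta> * (1 + 2 * \<kappa>')) ^ CARD('r) * v + K1 * 0 + 0 * v"
    by (intro tendsto_intros lims)
  then have ev1: "\<forall>\<^sub>F Q in sequentially. (\<eta> * (1 + 2 * \<kappa>')) ^ CARD('r) * ((\<Sum>q\<in>{1..Q}. cvol \<eta> k q) / real Q ^ (CARD('n) + 1))
       + K1 * (real Q powr (- s) * (2 + ln (real Q)) ^ CARD('n)) + K2 / real Q * ((\<Sum>q\<in>{1..Q}. cvol \<eta> k q) / real Q ^ (CARD('n) + 1)) < \<eta> ^ CARD('r) * v + e"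
    by (rule order_tendstoD(2)) (use \<kappa>'(3) in simp)
  have "(\<lambda>Q. (\<eta> * (1 - 2 * \<kappa>')) ^ CARD('r) * ((\<Sum>q\<in>{1..Q}. cvol \<eta> k q) / real Q ^ (CARD('n) + 1))
       - K1 * (real Q powr (- s) * (2 + ln (real Q)) ^ CARD('n)) - K2 / real Q * ((\<Sum>q\<in>{1..Q}. cvol \<eta> k q) / real Q ^ (CARD('n) + 1)))
      \<longlonglongrightarrow> (\<eta> * (1 - 2 * \<kappa>')) ^ CARD('r) * v - K1 * 0 - 0 * v"
    by (intro tendsto_intros lims)
  then have ev2: "\<forall>\<^sub>F Q in sequentially. (\<eta> * (1 - 2 * \<kappa>')) ^ CARD('r) * ((\<Sum>q\<in>{1..Q}. cvol \<eta> k q) / real Q ^ (CARD('n) + 1))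
       - K1 * (real Q powr (- s) * (2 + ln (real Q)) ^ CARD('n)) - K2 / real Q * ((\<Sum>q\<in>{1..Q}. cvol \<eta> k q) / real Q ^ (CARD('n) + 1)) > \<eta> ^ CARD('r) * v - e"
    by (rule order_tendstoD(1)) (use \<kappa>'(4) in simp)
  show ?thesis
    using ev1 ev2 eventually_gt_at_top[of "0::nat"]
  proof eventually_elim
    case (elim Q)
    show ?case
    proof (intro allI impI, elim conjE)
      fix \<delta> assume \<delta>: "real Q powr (- crit + \<epsilon>) \<le> \<delta>" "\<delta> \<le> 1 / 2"
      show "\<bar>real (ccount \<delta> \<eta> k Q) / (\<delta> ^ CARD('r) * real Q ^ (CARD('n) + 1)) - \<eta> ^ CARD('r) * (\<eta> ^ CARD('n) / real (CARD('n) + 1))\<bar> < e"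
        using B[OF elim(3) \<delta>] elim(1,2) unfolding v_def[symmetric] by linarith
    qed
  qed
qed

end

section \<open>Sup-norm neighbourhoods of the graph\<close>

lemma grid_cube_lmeasurable: "grid_cube \<eta> k \<in> lmeasurable"
  and measure_grid_cube: "\<eta> > 0 \<Longrightarrow> measure lebesgue (grid_cube \<eta> k :: (real ^ 'c::finite) set) = \<eta> ^ CARD('c)"
proof -
  define a :: "real ^ 'c" where "a = (\<chi> c. \<eta> * of_int (k c))"
  define b :: "real ^ 'c" where "b = (\<chi> c. \<eta> * (of_int (k c) + 1))"
  have sub: "box a b \<subseteq> grid_cube \<eta> k" "grid_cube \<eta> k \<subseteq> cbox a b"
    by (auto simp: grid_cube_def a_def b_def mem_box_cart intro: less_imp_le) (meson less_imp_le)
  have "negligible (cbox a b - box a b)" by (rule negligible_frontier_interval)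
  then have neg: "negligible ((cbox a b - grid_cube \<eta> k) \<union> (grid_cube \<eta> k - cbox a b))"
    by (rule negligible_subset) (use sub in auto)
  show "grid_cube \<eta> k \<in> lmeasurable"
    by (rule lmeasurable_negligible_symdiff[OF lmeasurable_cbox neg])
  show "measure lebesgue (grid_cube \<eta> k) = \<eta> ^ CARD('c)" if "\<eta> > 0"
  proof -
    have ne: "cbox a b \<noteq> {}" using that by (auto simp: interval_ne_empty_cart a_def b_def algebra_simps)
    have "measure lebesgue (grid_cube \<eta> k) = measure lebesgue (cbox a b)"
      by (rule measure_negligible_symdiff[OF lmeasurable_cbox neg])
    also have "\<dots> = prod (\<lambda>i. b $ i - a $ i) UNIV"
      using content_cbox_cart[OF ne] by simp
    also have "\<dots> = \<eta> ^ CARD('c)" by (simp add: a_def b_def algebra_simps)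
    finally show ?thesis .
  qed
qed

lemma grid_cube_unique:
  assumes "z \<in> grid_cube \<eta> k" "z \<in> grid_cube \<eta> k'" "\<eta> > 0"
  shows "k = k'"
proof
  fix c
  have "\<eta> * of_int (k c) < \<eta> * (of_int (k' c) + 1)" "\<eta> * of_int (k' c) < \<eta> * (of_int (k c) + 1)"
    using assms(1,2) unfolding grid_cube_def by (auto intro: le_less_trans)
  then have "real_of_int (k c) < of_int (k' c) + 1" "real_of_int (k' c) < of_int (k c) + 1"
    using assms(3) by (simp_all only: mult_less_cancel_left_pos)
  then show "k c = k' c" by linarith
qed

lemma grid_cube_exists: "\<eta> > 0 \<Longrightarrow> z \<in> grid_cube \<eta> (\<lambda>c. \<lfloor>z $ c / \<eta>\<rfloor>)"
proof -
  assume e: "\<eta> > 0"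
  have "\<eta> * of_int \<lfloor>z $ c / \<eta>\<rfloor> \<le> z $ c \<and> z $ c < \<eta> * (of_int \<lfloor>z $ c / \<eta>\<rfloor> + 1)" for c
  proof -
    have 1: "of_int \<lfloor>z $ c / \<eta>\<rfloor> \<le> z $ c / \<eta>" and 2: "z $ c / \<eta> < of_int \<lfloor>z $ c / \<eta>\<rfloor> + 1" by linarith+
    show ?thesis
      using 1[unfolded pos_le_divide_eq[OF e]] 2[unfolded pos_divide_less_eq[OF e]]
      unfolding mult.commute[of \<eta>] by blast
  qed
  then show ?thesis by (simp add: grid_cube_def)
qed

context curved_graph
begin

definition lin :: "real ^ 'n \<Rightarrow> real ^ 'n \<Rightarrow> 'r \<Rightarrow> real" where
  "lin x u r = (\<Sum>i\<in>UNIV. partial_deriv i (f r) x * u $ i)"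

definition xpart :: "real ^ ('n + 'r) \<Rightarrow> real ^ 'n" where
  "xpart z = (\<chi> i. z $ Inl i)"

text \<open>For t = 1 this is the limit region: \<open>u\<close> is the horizontal displacement in
  units of \<delta>/q, and the vertical coordinate may deviate by 1 from the shift that it causes.
  One parameter \<open>t\<close> scales all three tolerances, so that the regions are nested and
  comparable by dilation.\<close>

definition tube :: "real \<Rightarrow> real \<Rightarrow> (real ^ ('n + 'r)) set" where
  "tube e0 t = {z. \<exists>u :: real ^ 'n. (\<forall>i. \<bar>z $ Inl i - x0 $ i\<bar> \<le> t * e0) \<and> (\<forall>i. \<bar>u $ i\<bar> \<le> t) \<and>
     (\<forall>r. \<bar>z $ Inr r - lin (xpart z) u r\<bar> \<le> t)}"

text \<open>M n is a Lipschitz constant of each first partial derivative on the cube; the second n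
  comes from summing over the coordinates of the displacement.\<close>

definition lipc :: real where "lipc = M * (real CARD('n))\<^sup>2"

lemma xpart_nth [simp]: "xpart z $ i = z $ Inl i"
  by (simp add: xpart_def)

lemma lipc_pos: "lipc > 0"
  unfolding lipc_def using M_pos by (simp add: card_gt_0_iff)

lemma partial_deriv_diff_le:
  assumes "\<And>i. \<bar>x $ i - x0 $ i\<bar> \<le> \<rho>" "\<And>i. \<bar>y $ i - x0 $ i\<bar> \<le> \<rho>" "\<And>i. \<bar>x $ i - y $ i\<bar> \<le> d"
  shows "\<bar>partial_deriv i (f r) x - partial_deriv i (f r) y\<bar> \<le> M * real CARD('n) * d"
proof -
  have "\<bar>partial_deriv i (f r) x - partial_deriv i (f r) y - (\<Sum>j\<in>UNIV. 0 * (x $ j - y $ j))\<bar> \<le> M * (\<Sum>j\<in>UNIV. \<bar>x $ j - y $ j\<bar>)"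
  proof (rule coordinatewise_MVT[where lo = "\<lambda>i. x0 $ i - \<rho>" and hi = "\<lambda>i. x0 $ i + \<rho>" and g = "\<lambda>j. partial_deriv j (partial_deriv i (f r))"])
    show "((\<lambda>t. partial_deriv i (f r) (y + t *\<^sub>R axis j 1)) has_real_derivative partial_deriv j (partial_deriv i (f r)) (y + t *\<^sub>R axis j 1)) (at t)" for j y t
      by (rule C_k_Suc_deriv[of "Suc 0"]) (use smooth2[of r] in simp)
    show "\<bar>partial_deriv j (partial_deriv i (f r)) \<xi> - 0\<bar> \<le> M" if "\<And>i. x0 $ i - \<rho> \<le> \<xi> $ i \<and> \<xi> $ i \<le> x0 $ i + \<rho>" for j \<xi>
    proof -
      have "\<bar>\<xi> $ i - x0 $ i\<bar> \<le> \<rho>" for i using that[of i] by linarith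
      then show ?thesis using pders_le[of "[i, j]" \<xi> r] n3 by simp
    qed
    show "x0 $ i - \<rho> \<le> x $ i \<and> x $ i \<le> x0 $ i + \<rho>" for i using assms(1)[of i] by linarith
    show "x0 $ i - \<rho> \<le> y $ i \<and> y $ i \<le> x0 $ i + \<rho>" for i using assms(2)[of i] by linarith
  qed
  also have "\<dots> \<le> M * (\<Sum>j\<in>(UNIV::'n set). d)" using M_pos assms(3) by (intro mult_left_mono sum_mono) auto
  finally show ?thesis by (simp add: algebra_simps)
qed

lemma lin_diff_le:
  assumes "\<And>i. \<bar>x $ i - x0 $ i\<bar> \<le> \<rho>" "\<And>i. \<bar>y $ i - x0 $ i\<bar> \<le> \<rho>" "\<And>i. \<bar>x $ i - y $ i\<bar> \<le> d" "\<And>i. \<bar>u $ i\<bar> \<le> t"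
  shows "\<bar>lin x u r - lin y u r\<bar> \<le> lipc * d * t"
proof -
  have d0: "d \<ge> 0" using assms(3)[of undefined] by linarith
  have "\<bar>lin x u r - lin y u r\<bar> = \<bar>\<Sum>i\<in>UNIV. (partial_deriv i (f r) x - partial_deriv i (f r) y) * u $ i\<bar>"
    by (simp add: lin_def sum_subtractf left_diff_distrib)
  also have "\<dots> \<le> (\<Sum>i\<in>(UNIV::'n set). (M * real CARD('n) * d) * t)"
  proof (rule order.trans[OF sum_abs], rule sum_mono)
    fix i show "\<bar>(partial_deriv i (f r) x - partial_deriv i (f r) y) * u $ i\<bar> \<le> (M * real CARD('n) * d) * t"
      unfolding abs_mult using partial_deriv_diff_le[OF assms(1-3)] assms(4) M_pos d0 by (intro mult_mono) auto
  qed
  also have "\<dots> = lipc * d * t" by (simp add: lipc_def power2_eq_square)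
  finally show ?thesis .
qed

lemma first_order:
  assumes "\<And>i. \<bar>x $ i - x0 $ i\<bar> + d \<le> \<rho>" "\<And>i. \<bar>h $ i\<bar> \<le> d"
  shows "\<bar>f r (x + h) - f r x - lin x h r\<bar> \<le> lipc * d * d"
proof -
  have d0: "d \<ge> 0" using assms(2)[of undefined] by linarith
  have "\<bar>f r (x + h) - f r x - (\<Sum>j\<in>UNIV. partial_deriv j (f r) x * ((x + h) $ j - x $ j))\<bar> \<le> (M * real CARD('n) * d) * (\<Sum>j\<in>UNIV. \<bar>(x + h) $ j - x $ j\<bar>)"
  proof (rule coordinatewise_MVT[where lo = "\<lambda>i. x $ i - d" and hi = "\<lambda>i. x $ i + d" and g = "\<lambda>j. partial_deriv j (f r)"])
    show "((\<lambda>t. f r (y + t *\<^sub>R axis j 1)) has_real_derivative partial_deriv j (f r) (y + t *\<^sub>R axis j 1)) (at t)" for j y t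
      by (rule C_k_Suc_deriv[OF smooth2])
    show "\<bar>partial_deriv j (f r) \<xi> - partial_deriv j (f r) x\<bar> \<le> M * real CARD('n) * d" if "\<And>i. x $ i - d \<le> \<xi> $ i \<and> \<xi> $ i \<le> x $ i + d" for j \<xi>
    proof (rule partial_deriv_diff_le)
      fix i
      show "\<bar>\<xi> $ i - x0 $ i\<bar> \<le> \<rho>" "\<bar>x $ i - x0 $ i\<bar> \<le> \<rho>" "\<bar>\<xi> $ i - x $ i\<bar> \<le> d" using that[of i] assms(1)[of i] d0 by linarith+
    qed
    show "x $ i - d \<le> (x + h) $ i \<and> (x + h) $ i \<le> x $ i + d" "x $ i - d \<le> x $ i \<and> x $ i \<le> x $ i + d" for i
      using assms(2)[of i] d0 by (auto simp: abs_le_iff)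
  qed
  also have "\<dots> \<le> (M * real CARD('n) * d) * (\<Sum>j\<in>(UNIV::'n set). d)"
    using M_pos assms(2) d0 by (intro mult_left_mono sum_mono) auto
  finally show ?thesis by (simp add: lin_def lipc_def power2_eq_square algebra_simps)
qed

lemma lin_scale: "lin x (c *\<^sub>R u) r = c * lin x u r"
  by (simp add: lin_def sum_distrib_left algebra_simps)

lemma tube_mono: "t \<le> t' \<Longrightarrow> e0 > 0 \<Longrightarrow> tube e0 t \<subseteq> tube e0 t'"
proof
  fix z assume tt: "t \<le> t'" "e0 > 0" and "z \<in> tube e0 t"
  then obtain u where u: "\<forall>i. \<bar>z $ Inl i - x0 $ i\<bar> \<le> t * e0" "\<forall>i. \<bar>u $ i\<bar> \<le> t"
     "\<forall>r. \<bar>z $ Inr r - lin (xpart z) u r\<bar> \<le> t" unfolding tube_def by blast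
  moreover have "t * e0 \<le> t' * e0" using tt by (intro mult_right_mono) auto
  ultimately show "z \<in> tube e0 t'" unfolding tube_def using tt(1) by (blast intro: order.trans)
qed

text \<open>Parametrised by base point, displacement and vertical deviation, the tube is a
  continuous image of a product of boxes. Its measurability follows from compactness.\<close>

lemma tube_compact: "compact (tube e0 t)"
proof -
  define g :: "(real ^ 'n) \<times> (real ^ 'n) \<times> (real ^ 'r) \<Rightarrow> real ^ ('n + 'r)" where
    "g p = (\<chi> c. case c of Inl i \<Rightarrow> fst p $ i | Inr r \<Rightarrow> lin (fst p) (fst (snd p)) r + snd (snd p) $ r)" for p
  define K where "K = cbox (\<chi> i. x0 $ i - t * e0) (\<chi> i. x0 $ i + t * e0) \<times> cbox (\<chi> i::'n. - t) (\<chi> i. t) \<times> cbox (\<chi> i::'r. - t) (\<chi> i. t)"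
  have comp: "compact K" unfolding K_def by (intro compact_Times compact_cbox)
  have pd: "continuous_on UNIV (partial_deriv i (f r))" for i r
    using smooth2[of r] by simp
  have cont: "continuous_on K g"
    unfolding g_def[abs_def]
  proof (rule continuous_on_vec_lambda)
    fix c :: "'n + 'r"
    show "continuous_on K (\<lambda>p. case c of Inl i \<Rightarrow> fst p $ i | Inr r \<Rightarrow> lin (fst p) (fst (snd p)) r + snd (snd p) $ r)"
    proof (cases c)
      case (Inl i)
      then show ?thesis by (auto intro!: continuous_intros)
    next
      case (Inr r)
      have "continuous_on K (\<lambda>p. partial_deriv i (f r) (fst p))" for i
        by (rule continuous_on_compose2[OF pd]) (auto intro!: continuous_intros)
      then show ?thesis unfolding Inr lin_def by (auto intro!: continuous_intros)
    qed
  qed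
  have "tube e0 t = g ` K"
  proof (intro equalityI subsetI)
    fix z assume "z \<in> tube e0 t"
    then obtain u where u: "\<forall>i. \<bar>z $ Inl i - x0 $ i\<bar> \<le> t * e0" "\<forall>i. \<bar>u $ i\<bar> \<le> t"
      "\<forall>r. \<bar>z $ Inr r - lin (xpart z) u r\<bar> \<le> t" unfolding tube_def by blast
    define w :: "real ^ 'r" where "w = (\<chi> r. z $ Inr r - lin (xpart z) u r)"
    have "x0 $ i - t * e0 \<le> z $ Inl i \<and> z $ Inl i \<le> x0 $ i + t * e0" for i using u(1)[rule_format, of i] by linarith
    moreover have "- t \<le> u $ i \<and> u $ i \<le> t" for i using u(2)[rule_format, of i] by linarith
    moreover have "- t \<le> w $ r \<and> w $ r \<le> t" for r using u(3)[rule_format, of r] unfolding w_def by simp linarith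
    ultimately have "(xpart z, u, w) \<in> K" by (auto simp: K_def mem_box_cart xpart_def)
    moreover have "z = g (xpart z, u, w)"
      by (auto simp: g_def w_def vec_eq_iff xpart_def split: sum.splits)
    ultimately show "z \<in> g ` K" by blast
  next
    fix z assume "z \<in> g ` K"
    then obtain x u w where xuw: "(x, u, w) \<in> K" "z = g (x, u, w)" by auto
    have b: "x0 $ i - t * e0 \<le> x $ i \<and> x $ i \<le> x0 $ i + t * e0" "- t \<le> u $ i \<and> u $ i \<le> t" "- t \<le> w $ r \<and> w $ r \<le> t" for i r
      using xuw(1) by (auto simp: K_def mem_box_cart)
    have z: "z $ Inl i = x $ i" "z $ Inr r = lin x u r + w $ r" for i r by (auto simp: xuw(2) g_def)
    have x: "xpart z = x" by (simp add: xpart_def z vec_eq_iff)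
    have "\<bar>z $ Inl i - x0 $ i\<bar> \<le> t * e0" "\<bar>u $ i\<bar> \<le> t" "\<bar>z $ Inr r - lin (xpart z) u r\<bar> \<le> t" for i r
      using b(1)[of i] b(2)[of i] b(3)[of r] unfolding z x by linarith+
    then show "z \<in> tube e0 t" unfolding tube_def by blast
  qed
  then show ?thesis using compact_continuous_image[OF cont comp] by simp
qed

text \<open>The witness \<open>u\<close> is kept. The base point moves by at most \<eta>, which
  changes the value of the differential at \<open>u\<close> by at most lipc \<eta> t \<le> 2 lipc
  \<eta>.\<close>

lemma tube_nbhd:
  assumes z: "z \<in> tube e0 t" and t: "0 \<le> t" "t \<le> t'" "t' \<le> 2" and e0: "0 < e0" "e0 \<le> \<rho> / 8" and
    z': "\<And>c. \<bar>z' $ c - z $ c\<bar> \<le> \<eta>" and \<eta>: "\<eta> \<le> (t' - t) * e0" "\<eta> * (1 + 2 * lipc) \<le> t' - t"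
  shows "z' \<in> tube e0 t'"
proof -
  obtain u where u: "\<And>i. \<bar>z $ Inl i - x0 $ i\<bar> \<le> t * e0" "\<And>i. \<bar>u $ i\<bar> \<le> t"
     "\<And>r. \<bar>z $ Inr r - lin (xpart z) u r\<bar> \<le> t" using z unfolding tube_def by blast
  have te: "t' * e0 \<le> 2 * e0" using t e0 by (intro mult_right_mono) auto
  have "\<eta> \<ge> 0" using z'[of undefined] by linarith
  have 1: "\<bar>z' $ Inl i - x0 $ i\<bar> \<le> t' * e0" for i
    using u(1)[of i] z'[of "Inl i"] \<eta>(1) unfolding left_diff_distrib by linarith
  have in1: "\<bar>xpart z' $ i - x0 $ i\<bar> \<le> \<rho>" for i using 1[of i] te e0 rho unfolding xpart_nth by linarith
  have "t * e0 \<le> t' * e0" using t e0 by (intro mult_right_mono) auto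
  then have in2: "\<bar>xpart z $ i - x0 $ i\<bar> \<le> \<rho>" for i using u(1)[of i] te e0 rho \<open>t * e0 \<le> t' * e0\<close> unfolding xpart_nth by linarith
  have "\<bar>z' $ Inr r - lin (xpart z') u r\<bar> \<le> t'" for r
  proof -
    have "\<bar>lin (xpart z) u r - lin (xpart z') u r\<bar> \<le> lipc * \<eta> * t"
      by (rule lin_diff_le[OF in2 in1 _ u(2)]) (use z' in \<open>auto simp: xpart_def abs_minus_commute\<close>)
    also have "\<dots> \<le> lipc * \<eta> * 2" using t lipc_pos \<open>\<eta> \<ge> 0\<close> by (intro mult_left_mono) auto
    finally have "\<bar>lin (xpart z) u r - lin (xpart z') u r\<bar> \<le> \<eta> * (2 * lipc)" by (simp add: mult_ac)
    then show ?thesis using u(3)[of r] z'[of "Inr r"] \<eta>(2) unfolding distrib_left by linarith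
  qed
  then show ?thesis using 1 u(2) t(2) unfolding tube_def by (blast intro: order.trans)
qed

text \<open>Comparing the outer with the inner approximation by a dilation shows that the boundary of the tube
  is negligible, without computing any volume.\<close>

lemma tube_scale:
  assumes e0: "0 < e0" "e0 \<le> \<rho> / 8" "16 * lipc * e0 \<le> 1" and r: "0 \<le> r" "r \<le> 1 / 2"
  defines "s \<equiv> 1 + 8 * r"
  shows "tube e0 (1 + r) \<subseteq> (\<lambda>z. s *\<^sub>R z + (\<chi> c. case c of Inl i \<Rightarrow> (1 - s) * x0 $ i | Inr _ \<Rightarrow> 0)) ` tube e0 (1 - r)"
proof
  fix z assume "z \<in> tube e0 (1 + r)"
  then obtain u where u: "\<And>i. \<bar>z $ Inl i - x0 $ i\<bar> \<le> (1 + r) * e0" "\<And>i. \<bar>u $ i\<bar> \<le> 1 + r"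
     "\<And>r'. \<bar>z $ Inr r' - lin (xpart z) u r'\<bar> \<le> 1 + r" unfolding tube_def by blast
  have s1: "s \<ge> 1" using r by (simp add: s_def)
  define c :: "real ^ ('n + 'r)" where "c = (\<chi> c. case c of Inl i \<Rightarrow> (1 - s) * x0 $ i | Inr _ \<Rightarrow> 0)"
  define z' where "z' = (1 / s) *\<^sub>R (z - c)"
  have z: "z = s *\<^sub>R z' + c" using s1 by (simp add: z'_def)
  have rr: "r * r \<le> r * (1 / 2)" using r by (intro mult_left_mono) auto
  \<comment> \<open>The factor 8 makes (1 - r) s at least (1 + r)^2 for r \<le> 1/2; the vertical
    coordinate needs the square.\<close>
  have "(1 - r) * s = 1 + 7 * r - 8 * (r * r)" "(1 + r) * (1 + r) = 1 + 2 * r + r * r"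
    by (simp_all add: s_def algebra_simps)
  then have sr1: "1 + r \<le> (1 - r) * s" and sr2: "(1 + r) * (1 + r) \<le> (1 - r) * s" using rr r by linarith+
  have zl: "z' $ Inl i - x0 $ i = (z $ Inl i - x0 $ i) / s" for i
    using s1 by (simp add: z'_def c_def field_simps)
  have zr: "z' $ Inr r' = z $ Inr r' / s" for r' by (simp add: z'_def c_def)
  have up: "\<bar>x / s\<bar> \<le> (1 - r) * w" if "\<bar>x\<bar> \<le> (1 + r) * w" "w \<ge> 0" for x w
  proof -
    have "\<bar>x\<bar> \<le> (1 - r) * w * s" using that mult_right_mono[OF sr1 that(2)] by (simp add: mult_ac)
    then show ?thesis using s1 by (simp add: pos_divide_le_eq)
  qed
  have 1: "\<bar>z' $ Inl i - x0 $ i\<bar> \<le> (1 - r) * e0" for i unfolding zl by (rule up) (use u(1) e0 in auto)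
  define u' where "u' = (1 / s) *\<^sub>R u"
  have 2: "\<bar>u' $ i\<bar> \<le> 1 - r" for i using up[of "u $ i" 1] u(2)[of i] by (simp add: u'_def)
  have e2: "(1 + r) * e0 \<le> 2 * e0" "(1 - r) * e0 \<le> 2 * e0" using r e0 by (auto intro!: mult_right_mono)
  have in1: "\<bar>xpart z $ i - x0 $ i\<bar> \<le> \<rho>" for i using u(1)[of i] e2 e0 rho unfolding xpart_nth by linarith
  have in2: "\<bar>xpart z' $ i - x0 $ i\<bar> \<le> \<rho>" for i using 1[of i] e2 e0 rho unfolding xpart_nth by linarith
  have dist: "\<bar>xpart z $ i - xpart z' $ i\<bar> \<le> 16 * e0 * r" for i
  proof -
    have "xpart z $ i - xpart z' $ i = (z' $ Inl i - x0 $ i) * (s - 1)"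
      using zl[of i] s1 by (simp add: xpart_def field_simps)
    then have "\<bar>xpart z $ i - xpart z' $ i\<bar> = \<bar>z' $ Inl i - x0 $ i\<bar> * (8 * r)" using r by (simp add: abs_mult s_def)
    also have "\<dots> \<le> (2 * e0) * (8 * r)" using 1[of i] e2(2) r by (intro mult_right_mono) auto
    finally show ?thesis by simp
  qed
  have 3: "\<bar>z' $ Inr r' - lin (xpart z') u' r'\<bar> \<le> 1 - r" for r'
  proof -
    \<comment> \<open>The dilation moves the base point and with it the differential. Smallness of
      \<open>e0\<close> turns this into an error of at most r (1 + r), so the vertical tolerance
      becomes (1 + r)^2.\<close>
    have "\<bar>lin (xpart z) u r' - lin (xpart z') u r'\<bar> \<le> lipc * (16 * e0 * r) * (1 + r)"
      by (rule lin_diff_le[OF in1 in2 dist u(2)])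
    also have "\<dots> = (16 * lipc * e0) * (r * (1 + r))" by (simp add: mult_ac)
    also have "\<dots> \<le> 1 * (r * (1 + r))" using e0 r by (intro mult_right_mono) auto
    finally have "\<bar>z $ Inr r' - lin (xpart z') u r'\<bar> \<le> (1 + r) * (1 + r)" using u(3)[of r'] by (simp add: algebra_simps)
    then have "\<bar>z $ Inr r' - lin (xpart z') u r'\<bar> / s \<le> 1 - r" using sr2 s1 by (simp add: pos_divide_le_eq)
    moreover have "z' $ Inr r' - lin (xpart z') u' r' = (z $ Inr r' - lin (xpart z') u r') / s"
      unfolding u'_def lin_scale zr by (simp add: diff_divide_distrib)
    ultimately show ?thesis using s1 by simp
  qed
  have "z' \<in> tube e0 (1 - r)" unfolding tube_def using 1 2 3 by blast
  then show "z \<in> (\<lambda>z. s *\<^sub>R z + (\<chi> c. case c of Inl i \<Rightarrow> (1 - s) * x0 $ i | Inr _ \<Rightarrow> 0)) ` tube e0 (1 - r)"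
    using z unfolding c_def by blast
qed

lemma tube_lmeasurable: "tube e0 t \<in> lmeasurable"
  by (rule lmeasurable_compact[OF tube_compact])

lemma tube_measure_scale:
  assumes "0 < e0" "e0 \<le> \<rho> / 8" "16 * lipc * e0 \<le> 1" "0 \<le> r" "r \<le> 1 / 2"
  shows "measure lebesgue (tube e0 (1 + r)) \<le> (1 + 8 * r) ^ CARD('n + 'r) * measure lebesgue (tube e0 (1 - r))"
proof -
  let ?c = "(\<chi> c. case c of Inl i \<Rightarrow> (1 - (1 + 8 * r)) * x0 $ i | Inr _ \<Rightarrow> 0) :: real ^ ('n + 'r)"
  let ?T = "(\<lambda>z. (1 + 8 * r) *\<^sub>R z + ?c) ` tube e0 (1 - r)"
  have "compact ?T" by (rule compact_continuous_image[OF _ tube_compact]) (auto intro!: continuous_intros)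
  then have "measure lebesgue (tube e0 (1 + r)) \<le> measure lebesgue ?T"
    using tube_scale[OF assms] lmeasurable_compact tube_lmeasurable
    by (intro measure_mono_fmeasurable) (auto dest: fmeasurableD)
  also have "\<dots> = \<bar>1 + 8 * r\<bar> ^ DIM(real ^ ('n + 'r)) * measure lebesgue (tube e0 (1 - r))"
    by (rule measure_lebesgue_affine)
  finally show ?thesis using assms(4) by simp
qed

text \<open>The choice u = 0 already gives a box of positive volume inside the tube.\<close>

lemma tube_measure_pos:
  assumes "0 < e0"
  shows "measure lebesgue (tube e0 1) > 0"
proof -
  define a :: "real ^ ('n + 'r)" where "a = (\<chi> c. case c of Inl i \<Rightarrow> x0 $ i - e0 | Inr _ \<Rightarrow> - 1)"
  define b :: "real ^ ('n + 'r)" where "b = (\<chi> c. case c of Inl i \<Rightarrow> x0 $ i + e0 | Inr _ \<Rightarrow> 1)"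
  have ab: "a $ c < b $ c" for c using assms by (auto simp: a_def b_def split: sum.splits)
  then have ne: "cbox a b \<noteq> {}" by (auto simp: interval_ne_empty_cart intro: less_imp_le)
  have "cbox a b \<subseteq> tube e0 1"
  proof
    fix z assume z: "z \<in> cbox a b"
    have "x0 $ i - e0 \<le> z $ Inl i \<and> z $ Inl i \<le> x0 $ i + e0" for i
      using z[unfolded mem_box_cart, rule_format, of "Inl i"] by (simp add: a_def b_def)
    note a1 = this
    have 1: "\<bar>z $ Inl i - x0 $ i\<bar> \<le> 1 * e0" for i using a1[of i] by linarith
    have a2: "- 1 \<le> z $ Inr r \<and> z $ Inr r \<le> 1" for r
      using z[unfolded mem_box_cart, rule_format, of "Inr r"] by (simp add: a_def b_def)
    have lin0: "lin x 0 r = 0" for x r by (simp add: lin_def)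
    have 2: "\<bar>z $ Inr r - lin (xpart z) 0 r\<bar> \<le> 1" for r unfolding lin0 using a2[of r] by linarith
    have 3: "\<bar>(0 :: real ^ 'n) $ i\<bar> \<le> 1" for i by simp
    show "z \<in> tube e0 1" unfolding tube_def using 1 2 3 by blast
  qed
  then have "measure lebesgue (cbox a b) \<le> measure lebesgue (tube e0 1)"
    using tube_lmeasurable by (intro measure_mono_fmeasurable) auto
  moreover have "measure lebesgue (cbox a b) > 0"
    using content_cbox_cart[OF ne] ab by (simp add: prod_pos)
  ultimately show ?thesis by linarith
qed

text \<open>\<open>Ks\<close> collects the cubes of a fine mesh that meet the inner tube: they cover
  it, remain in the outer one by \<open>tube_nbhd\<close>, and are disjoint, so their total volume
  lies between the two measures. The mesh is also small against \<rho>, which gives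
  \<open>cube_ok\<close>.\<close>

lemma tube_grid:
  assumes t: "0 \<le> t" "t < t'" "t' \<le> 2" and e0: "0 < e0" "e0 \<le> \<rho> / 8"
  obtains \<eta> and Ks :: "('n + 'r \<Rightarrow> int) set" where "0 < \<eta>" "finite Ks" "\<And>k. k \<in> Ks \<Longrightarrow> cube_ok \<eta> k"
    "tube e0 t \<subseteq> (\<Union>k\<in>Ks. grid_cube \<eta> k)" "(\<Union>k\<in>Ks. grid_cube \<eta> k) \<subseteq> tube e0 t'"
    "measure lebesgue (tube e0 t) \<le> real (card Ks) * \<eta> ^ CARD('n + 'r)"
    "real (card Ks) * \<eta> ^ CARD('n + 'r) \<le> measure lebesgue (tube e0 t')"
proof -
  define \<eta> where "\<eta> = min 1 (min (\<rho> / 8) (min ((t' - t) * e0) ((t' - t) / (1 + 2 * lipc))))"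
  have L: "1 + 2 * lipc > 0" using lipc_pos by simp
  have "\<eta> \<le> \<rho> / 8" unfolding \<eta>_def by (rule min.coboundedI2, rule min.coboundedI1) simp
  moreover have "\<eta> \<le> (t' - t) * e0" unfolding \<eta>_def by (rule min.coboundedI2, rule min.coboundedI2, rule min.coboundedI1) simp
  moreover have "0 < \<eta>" "\<eta> \<le> 1" unfolding \<eta>_def using t e0 L rho by auto
  ultimately have \<eta>: "0 < \<eta>" "\<eta> \<le> 1" "\<eta> \<le> \<rho> / 8" "\<eta> \<le> (t' - t) * e0" by blast+
  have "\<eta> \<le> (t' - t) / (1 + 2 * lipc)" unfolding \<eta>_def by simp
  then have \<eta>L: "\<eta> * (1 + 2 * lipc) \<le> t' - t" using L by (simp add: pos_le_divide_eq)
  define Ks where "Ks = {k. grid_cube \<eta> k \<inter> tube e0 t \<noteq> {}}"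
  have near: "\<bar>z' $ c - z $ c\<bar> \<le> \<eta>" if "z \<in> grid_cube \<eta> k" "z' \<in> grid_cube \<eta> k" for z z' :: "real ^ ('n + 'r)" and k c
  proof -
    have "\<eta> * of_int (k c) \<le> z $ c" "z $ c < \<eta> * (of_int (k c) + 1)" "\<eta> * of_int (k c) \<le> z' $ c" "z' $ c < \<eta> * (of_int (k c) + 1)"
      using that by (auto simp: grid_cube_def)
    then show ?thesis unfolding distrib_left by linarith
  qed
  have sub: "(\<Union>k\<in>Ks. grid_cube \<eta> k) \<subseteq> tube e0 t'"
  proof
    fix z' assume "z' \<in> (\<Union>k\<in>Ks. grid_cube \<eta> k)"
    then obtain k z where k: "z' \<in> grid_cube \<eta> k" "z \<in> grid_cube \<eta> k" "z \<in> tube e0 t" unfolding Ks_def by blast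
    show "z' \<in> tube e0 t'"
      by (rule tube_nbhd[OF k(3) t(1) _ t(3) e0 near[OF k(2) k(1)] \<eta>(4) \<eta>L]) (use t in simp)
  qed
  have sup: "tube e0 t \<subseteq> (\<Union>k\<in>Ks. grid_cube \<eta> k)"
    using grid_cube_exists[OF \<eta>(1)] unfolding Ks_def by blast
  obtain B where B: "\<And>z. z \<in> tube e0 t \<Longrightarrow> norm z \<le> B"
    using compact_imp_bounded[OF tube_compact] unfolding bounded_iff by blast
  define m where "m = \<lceil>B / \<eta>\<rceil> + 1"
  have "Ks \<subseteq> PiE UNIV (\<lambda>_. {- m..m})"
  proof
    fix k assume "k \<in> Ks"
    then obtain z where z: "z \<in> grid_cube \<eta> k" "z \<in> tube e0 t" unfolding Ks_def by blast
    have "- m \<le> k c \<and> k c \<le> m" for c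
    proof -
      have "\<bar>z $ c\<bar> \<le> B" using B[OF z(2)] component_le_norm_cart[of z c] by linarith
      moreover have "\<eta> * of_int (k c) \<le> z $ c" "z $ c < \<eta> * (of_int (k c) + 1)" using z(1) by (auto simp: grid_cube_def)
      ultimately have "of_int (k c) * \<eta> \<le> B" "- B \<le> (of_int (k c) + 1) * \<eta>" unfolding mult.commute[of _ \<eta>] by linarith+
      then have "of_int (k c) \<le> B / \<eta>" "(- B) / \<eta> \<le> of_int (k c) + 1"
        by (simp_all only: pos_le_divide_eq[OF \<eta>(1)] pos_divide_le_eq[OF \<eta>(1)])
      then show ?thesis unfolding m_def minus_divide_left[symmetric] by linarith
    qed
    then show "k \<in> PiE UNIV (\<lambda>_. {- m..m})" by auto
  qed
  then have fin: "finite Ks" by (rule finite_subset) (intro finite_PiE; simp)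
  have ok: "cube_ok \<eta> k" if "k \<in> Ks" for k
  proof -
    obtain z where z: "z \<in> grid_cube \<eta> k" "z \<in> tube e0 t" using \<open>k \<in> Ks\<close> unfolding Ks_def by blast
    have "t * e0 \<le> 2 * e0" using t e0 by (intro mult_right_mono) auto
    then have te: "t * e0 \<le> \<rho> / 4" using e0 by linarith
    have "x0 $ i - \<rho> / 2 \<le> \<eta> * of_int (k (Inl i)) \<and> \<eta> * (of_int (k (Inl i)) + 1) \<le> x0 $ i + \<rho> / 2" for i
    proof -
      have "\<bar>z $ Inl i - x0 $ i\<bar> \<le> t * e0" using z(2) unfolding tube_def by blast
      moreover have "\<eta> * of_int (k (Inl i)) \<le> z $ Inl i" "z $ Inl i < \<eta> * (of_int (k (Inl i)) + 1)" using z(1) by (auto simp: grid_cube_def)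
      ultimately show ?thesis using te \<eta>(3) rho unfolding distrib_left by linarith
    qed
    then show ?thesis using \<eta> by (simp add: cube_ok_def)
  qed
  have meas: "measure lebesgue (\<Union>k\<in>Ks. grid_cube \<eta> k :: (real ^ ('n + 'r)) set) = real (card Ks) * \<eta> ^ CARD('n + 'r)"
  proof -
    have "measure lebesgue (\<Union>k\<in>Ks. grid_cube \<eta> k :: (real ^ ('n + 'r)) set) = (\<Sum>k\<in>Ks. measure lebesgue (grid_cube \<eta> k :: (real ^ ('n + 'r)) set))"
    proof (rule measure_UNION'[OF fin grid_cube_lmeasurable])
      show "pairwise (\<lambda>k k'. disjnt (grid_cube \<eta> k :: (real ^ ('n + 'r)) set) (grid_cube \<eta> k')) Ks"
        unfolding pairwise_def disjnt_iff using grid_cube_unique[OF _ _ \<eta>(1)] by blast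
    qed
    then show ?thesis by (simp add: measure_grid_cube[OF \<eta>(1)])
  qed
  have um: "(\<Union>k\<in>Ks. grid_cube \<eta> k :: (real ^ ('n + 'r)) set) \<in> lmeasurable"
    using fin grid_cube_lmeasurable by (intro fmeasurable.finite_UN) auto
  show thesis
  proof (rule that[OF \<eta>(1) fin ok sup sub])
    show "measure lebesgue (tube e0 t) \<le> real (card Ks) * \<eta> ^ CARD('n + 'r)"
      unfolding meas[symmetric] using sup um tube_lmeasurable by (intro measure_mono_fmeasurable) auto
    show "real (card Ks) * \<eta> ^ CARD('n + 'r) \<le> measure lebesgue (tube e0 t')"
      unfolding meas[symmetric] using sub um tube_lmeasurable by (intro measure_mono_fmeasurable) auto
  qed
qed

end

section \<open>Sup-norm distance to compact sets\<close>

lemma ball_Basis_cart: "(\<forall>b\<in>Basis. P ((x :: real ^ 'm::finite) \<bullet> b)) \<longleftrightarrow> (\<forall>i. P (x $ i))"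
  by (auto simp: Basis_vec_def cart_eq_inner_axis)

lemma infnorm_le_iff_cart: "infnorm (x :: real ^ 'm::finite) \<le> e \<longleftrightarrow> (\<forall>i. \<bar>x $ i\<bar> \<le> e)"
  unfolding infnorm_Max by (subst Max_le_iff) (auto simp: ball_Basis_cart[of "\<lambda>y. \<bar>y\<bar> \<le> e"])

lemma infnorm_less_iff_cart: "infnorm (x :: real ^ 'm::finite) < e \<longleftrightarrow> (\<forall>i. \<bar>x $ i\<bar> < e)"
  unfolding infnorm_Max by (subst Max_less_iff) (auto simp: ball_Basis_cart[of "\<lambda>y. \<bar>y\<bar> < e"])

lemma closure_linf_ball:
  assumes "e > 0"
  shows "closure (linf_ball x0 e) = cbox (\<chi> i. x0 $ i - e) (\<chi> i. x0 $ i + e)"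
proof -
  have "linf_ball x0 e = box (\<chi> i. x0 $ i - e) (\<chi> i. x0 $ i + e)"
    unfolding linf_ball_def infnorm_less_iff_cart by (auto simp: mem_box_cart abs_less_iff algebra_simps)
  moreover have "box (\<chi> i. x0 $ i - e) (\<chi> i. x0 $ i + e) \<noteq> {}"
    using assms by (simp add: interval_ne_empty_cart)
  ultimately show ?thesis by (simp add: closure_box)
qed

text \<open>Compactness makes the infimum a minimum, so the weak inequality is witnessed by a point
  even in the case of equality.\<close>

lemma linf_dist_set_le_iff:
  assumes "compact S" "S \<noteq> {}"
  shows "linf_dist_set y S \<le> d \<longleftrightarrow> (\<exists>z\<in>S. \<forall>k. \<bar>y $ k - z $ k\<bar> \<le> d)"
proof -
  have "continuous_on S (\<lambda>z. infnorm (y - z))"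
    unfolding continuous_on_def by (auto intro!: tendsto_infnorm tendsto_intros)
  from continuous_attains_inf[OF assms this] obtain z where z: "z \<in> S" "\<And>z'. z' \<in> S \<Longrightarrow> infnorm (y - z) \<le> infnorm (y - z')"
    by blast
  have "linf_dist_set y S = infnorm (y - z)"
    unfolding linf_dist_set_def
  proof (rule antisym)
    show "(INF z\<in>S. infnorm (y - z)) \<le> infnorm (y - z)"
      by (rule cINF_lower[OF _ z(1)]) (auto intro!: bdd_belowI[of _ 0] infnorm_pos_le)
    show "infnorm (y - z) \<le> (INF z\<in>S. infnorm (y - z))"
      by (rule cINF_greatest[OF assms(2) z(2)])
  qed
  then have "linf_dist_set y S \<le> d \<longleftrightarrow> (\<exists>z\<in>S. infnorm (y - z) \<le> d)"
    using z by (auto intro: order.trans)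
  then show ?thesis unfolding infnorm_le_iff_cart by simp
qed

lemma finite_rational_points:
  fixes S :: "(real ^ 'm::finite) set"
  assumes "compact S" "S \<noteq> {}"
  shows "finite (rational_points S Q \<delta>)"
proof -
  obtain B where B: "\<And>z. z \<in> S \<Longrightarrow> norm z \<le> B"
    using compact_imp_bounded[OF assms(1)] unfolding bounded_iff by blast
  define m where "m = \<lceil>real Q * (\<bar>B\<bar> + \<bar>\<delta>\<bar>)\<rceil>"
  have "rational_points S Q \<delta> \<subseteq> vec_lambda ` (PiE UNIV (\<lambda>_. {- m..m})) \<times> {..Q}"
  proof
    fix p assume p: "p \<in> rational_points S Q \<delta>"
    obtain a q where aq: "p = (a, q)" by (cases p)
    have q: "1 \<le> q" "q \<le> Q" and "linf_dist_set (\<chi> i. real_of_int (a $ i) / real q) S \<le> \<delta> / real q"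
      using p by (auto simp: aq rational_points_def)
    then obtain z where z: "z \<in> S" "\<And>k. \<bar>real_of_int (a $ k) / real q - z $ k\<bar> \<le> \<delta> / real q"
      unfolding linf_dist_set_le_iff[OF assms] by auto
    have "a $ k \<in> {- m..m}" for k
    proof -
      have "\<bar>z $ k\<bar> \<le> \<bar>B\<bar>" using B[OF z(1)] component_le_norm_cart[of z k] by linarith
      moreover have "\<delta> / real q \<le> \<bar>\<delta>\<bar> / 1" using q by (intro frac_le) auto
      ultimately have "\<bar>real_of_int (a $ k) / real q\<bar> \<le> \<bar>B\<bar> + \<bar>\<delta>\<bar>" using z(2)[of k] by linarith
      then have "\<bar>real_of_int (a $ k)\<bar> \<le> real q * (\<bar>B\<bar> + \<bar>\<delta>\<bar>)" using q by (simp add: pos_divide_le_eq mult.commute)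
      also have "\<dots> \<le> real Q * (\<bar>B\<bar> + \<bar>\<delta>\<bar>)" using q by (intro mult_right_mono) auto
      finally show ?thesis unfolding m_def by simp linarith
    qed
    then have "vec_nth a \<in> PiE UNIV (\<lambda>_. {- m..m})" by auto
    then have "a \<in> vec_lambda ` (PiE UNIV (\<lambda>_. {- m..m}))" by (metis image_eqI vec_nth_inverse)
    then show "p \<in> vec_lambda ` (PiE UNIV (\<lambda>_. {- m..m})) \<times> {..Q}" using q by (simp add: aq)
  qed
  then show ?thesis by (rule finite_subset) (intro finite_cartesian_product finite_imageI finite_PiE; simp)
qed

section \<open>Comparison of the counted pairs with points in the tube\<close>

context curved_graph
begin

lemma graph_compact:
  assumes "e0 > 0"
  shows "compact (graph_manifold f x0 e0)" "graph_manifold f x0 e0 \<noteq> {}"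
proof -
  have "continuous_on X (\<lambda>x. \<chi> k. case k of Inl i \<Rightarrow> x $ i | Inr j \<Rightarrow> f j x)" for X
  proof (rule continuous_on_vec_lambda)
    fix k :: "'n + 'r"
    show "continuous_on X (\<lambda>x. case k of Inl i \<Rightarrow> x $ i | Inr j \<Rightarrow> f j x)"
      using continuous_on_subset[OF C_k_continuous[OF smooth]] by (cases k) (auto intro!: continuous_intros)
  qed
  then show "compact (graph_manifold f x0 e0)"
    unfolding graph_manifold_def closure_linf_ball[OF assms] by (rule compact_continuous_image) (rule compact_cbox)
  show "graph_manifold f x0 e0 \<noteq> {}"
    unfolding graph_manifold_def closure_linf_ball[OF assms] using assms by (simp add: interval_ne_empty_cart)
qed

text \<open>The graph point is described by the displacement \<open>h\<close> of its base point from
  the horizontal part of \<open>y\<close>; after division by \<delta>/q this becomes the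
  \<open>u\<close> of the tube.\<close>

lemma dist_graph_iff:
  assumes "e0 > 0"
  shows "linf_dist_set y (graph_manifold f x0 e0) \<le> d \<longleftrightarrow>
    (\<exists>h. (\<forall>i. \<bar>h $ i\<bar> \<le> d) \<and> (\<forall>i. \<bar>y $ Inl i + h $ i - x0 $ i\<bar> \<le> e0) \<and> (\<forall>r. \<bar>y $ Inr r - f r ((\<chi> i. y $ Inl i) + h)\<bar> \<le> d))"
    (is "?L \<longleftrightarrow> (\<exists>h. ?P h)")
proof -
  have "?L \<longleftrightarrow> (\<exists>x. (\<forall>i. \<bar>x $ i - x0 $ i\<bar> \<le> e0) \<and> (\<forall>i. \<bar>y $ Inl i - x $ i\<bar> \<le> d) \<and> (\<forall>r. \<bar>y $ Inr r - f r x\<bar> \<le> d))"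
  proof -
    have "?L \<longleftrightarrow> (\<exists>z\<in>graph_manifold f x0 e0. \<forall>k. \<bar>y $ k - z $ k\<bar> \<le> d)"
      by (rule linf_dist_set_le_iff[OF graph_compact[OF assms]])
    also have "\<dots> \<longleftrightarrow> (\<exists>x\<in>cbox (\<chi> i. x0 $ i - e0) (\<chi> i. x0 $ i + e0). \<forall>k. \<bar>y $ k - (case k of Inl i \<Rightarrow> x $ i | Inr j \<Rightarrow> f j x)\<bar> \<le> d)"
      unfolding graph_manifold_def closure_linf_ball[OF assms] by simp
    also have "\<dots> \<longleftrightarrow> (\<exists>x. (\<forall>i. \<bar>x $ i - x0 $ i\<bar> \<le> e0) \<and> (\<forall>i. \<bar>y $ Inl i - x $ i\<bar> \<le> d) \<and> (\<forall>r. \<bar>y $ Inr r - f r x\<bar> \<le> d))"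
    proof -
      have "x \<in> cbox (\<chi> i. x0 $ i - e0) (\<chi> i. x0 $ i + e0) \<longleftrightarrow> (\<forall>i. \<bar>x $ i - x0 $ i\<bar> \<le> e0)" for x
        by (simp add: mem_box_cart abs_diff_le_iff)
      then show ?thesis by (simp add: Bex_def split_sum_all)
    qed
    finally show ?thesis .
  qed
  also have "\<dots> \<longleftrightarrow> (\<exists>h. ?P h)"
  proof
    assume "\<exists>x. (\<forall>i. \<bar>x $ i - x0 $ i\<bar> \<le> e0) \<and> (\<forall>i. \<bar>y $ Inl i - x $ i\<bar> \<le> d) \<and> (\<forall>r. \<bar>y $ Inr r - f r x\<bar> \<le> d)"
    then obtain x where x: "\<forall>i. \<bar>x $ i - x0 $ i\<bar> \<le> e0" "\<forall>i. \<bar>y $ Inl i - x $ i\<bar> \<le> d" "\<forall>r. \<bar>y $ Inr r - f r x\<bar> \<le> d" by blast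
    have e: "(\<chi> i. y $ Inl i) + (x - (\<chi> i. y $ Inl i)) = x" by simp
    have "?P (x - (\<chi> i. y $ Inl i))" unfolding e using x by (simp add: abs_minus_commute)
    then show "\<exists>h. ?P h" by blast
  next
    assume "\<exists>h. ?P h"
    then obtain h where h: "?P h" by blast
    show "\<exists>x. (\<forall>i. \<bar>x $ i - x0 $ i\<bar> \<le> e0) \<and> (\<forall>i. \<bar>y $ Inl i - x $ i\<bar> \<le> d) \<and> (\<forall>r. \<bar>y $ Inr r - f r x\<bar> \<le> d)"
      by (rule exI[of _ "(\<chi> i. y $ Inl i) + h"]) (use h in simp)
  qed
  finally show ?thesis .
qed

text \<open>Let d = \<delta>/q. Distance at most \<open>d\<close> to the graph means that over some
  base point x + d u with |u| \<le> 1 the vertical deviation is at most \<open>d\<close>. Expansion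
  at x = a/q turns this deviation into d times the expression in the definition of
  \<open>tube\<close>, up to lipc d^2 \<le> r d; division by \<open>d\<close> leaves a tolerance
  between 1 - r and 1 + r. The horizontal displacement is absorbed by r e0.\<close>

lemma rpt_tube:
  assumes e0: "0 < e0" "e0 \<le> \<rho> / 8" and \<delta>: "0 < \<delta>" "\<delta> \<le> 1" and q: "q > 0" and r: "0 < r" "r \<le> 1"
    and big: "1 / real q \<le> r * e0" "lipc / real q \<le> r" "1 / real q \<le> \<rho> / 8"
  shows "rpt \<delta> q a \<in> tube e0 (1 - r) \<Longrightarrow> linf_dist_set (\<chi> i. real_of_int (a $ i) / real q) (graph_manifold f x0 e0) \<le> \<delta> / real q"
    "linf_dist_set (\<chi> i. real_of_int (a $ i) / real q) (graph_manifold f x0 e0) \<le> \<delta> / real q \<Longrightarrow> rpt \<delta> q a \<in> tube e0 (1 + r)"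
proof -
  define z where "z = rpt \<delta> q a"
  define x where "x = xpart z"
  define d where "d = \<delta> / real q"
  have d0: "d > 0" using \<delta> q by (simp add: d_def)
  have dq: "d \<le> 1 / real q" using \<delta> by (simp add: d_def divide_right_mono)
  have xi: "x $ i = of_int (a $ Inl i) / real q" for i by (simp add: x_def z_def rpt_def)
  have xv: "x = (\<chi> i. of_int (a $ Inl i) / real q)" by (simp add: vec_eq_iff xi)
  have zr: "d * z $ Inr s = of_int (a $ Inr s) / real q - f s x" for s
    using \<delta> q by (simp add: z_def rpt_def d_def xv field_simps)
  have lipd: "lipc * d \<le> r"
  proof -
    have "lipc * d \<le> lipc * (1 / real q)" using dq lipc_pos by (intro mult_left_mono) auto
    then show ?thesis using big(2) by simp
  qed
  have dist: "linf_dist_set (\<chi> i. real_of_int (a $ i) / real q) (graph_manifold f x0 e0) \<le> d \<longleftrightarrow>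
    (\<exists>h. (\<forall>i. \<bar>h $ i\<bar> \<le> d) \<and> (\<forall>i. \<bar>x $ i + h $ i - x0 $ i\<bar> \<le> e0) \<and> (\<forall>s. \<bar>of_int (a $ Inr s) / real q - f s (x + h)\<bar> \<le> d))"
    unfolding dist_graph_iff[OF e0(1)] xv by simp
  \<comment> \<open>The true vertical deviation and \<open>d\<close> times its rescaled linear model
    differ by the Taylor remainder; both implications rest on this estimate.\<close>
  have key: "\<bar>(of_int (a $ Inr s) / real q - f s (x + d *\<^sub>R u)) - d * (z $ Inr s - lin x u s)\<bar> \<le> d * r"
    if "\<And>i. \<bar>x $ i - x0 $ i\<bar> \<le> 2 * e0" "\<And>i. \<bar>u $ i\<bar> \<le> 1" for u s
  proof -
    have "\<bar>f s (x + d *\<^sub>R u) - f s x - lin x (d *\<^sub>R u) s\<bar> \<le> lipc * d * d"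
    proof (rule first_order)
      fix i
      show "\<bar>x $ i - x0 $ i\<bar> + d \<le> \<rho>" using that(1)[of i] dq big(3) e0 rho by linarith
      have "d * \<bar>u $ i\<bar> \<le> d * 1" using that(2)[of i] d0 by (intro mult_left_mono) auto
      then show "\<bar>(d *\<^sub>R u) $ i\<bar> \<le> d" using d0 by (simp add: abs_mult)
    qed
    also have "\<dots> \<le> r * d" using lipd d0 by (intro mult_right_mono) auto
    finally have "\<bar>f s (x + d *\<^sub>R u) - f s x - d * lin x u s\<bar> \<le> d * r" unfolding lin_scale by (simp add: mult.commute)
    moreover have "(of_int (a $ Inr s) / real q - f s (x + d *\<^sub>R u)) - d * (z $ Inr s - lin x u s) = - (f s (x + d *\<^sub>R u) - f s x - d * lin x u s)"
      unfolding right_diff_distrib zr by simp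
    ultimately show ?thesis by simp
  qed
  show "linf_dist_set (\<chi> i. real_of_int (a $ i) / real q) (graph_manifold f x0 e0) \<le> \<delta> / real q" if prem: "rpt \<delta> q a \<in> tube e0 (1 - r)"
  proof -
    obtain u where u: "\<And>i. \<bar>x $ i - x0 $ i\<bar> \<le> (1 - r) * e0" "\<And>i. \<bar>u $ i\<bar> \<le> 1 - r" "\<And>s. \<bar>z $ Inr s - lin x u s\<bar> \<le> 1 - r"
      using prem unfolding tube_def z_def[symmetric] x_def by auto
    have "(1 - r) * e0 \<le> 2 * e0" using r e0 by (intro mult_right_mono) auto
    then have u2: "\<bar>x $ i - x0 $ i\<bar> \<le> 2 * e0" for i using u(1)[of i] by linarith
    have u3: "\<bar>u $ i\<bar> \<le> 1" for i using u(2)[of i] r by linarith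
    have du: "\<bar>d * u $ i\<bar> \<le> d" for i
      using mult_left_mono[OF u3[of i], of d] d0 by (simp add: abs_mult)
    have "\<bar>x $ i + (d *\<^sub>R u) $ i - x0 $ i\<bar> \<le> e0" for i
      using u(1)[of i] du[of i] dq big(1) unfolding left_diff_distrib vector_scaleR_component real_scaleR_def by linarith
    moreover have "\<bar>of_int (a $ Inr s) / real q - f s (x + d *\<^sub>R u)\<bar> \<le> d" for s
    proof -
      have "d * \<bar>z $ Inr s - lin x u s\<bar> \<le> d * (1 - r)" using u(3) d0 by (intro mult_left_mono) auto
      moreover have "\<bar>d * (z $ Inr s - lin x u s)\<bar> = d * \<bar>z $ Inr s - lin x u s\<bar>" using d0 by (simp add: abs_mult)
      moreover have "d * (1 - r) = d - d * r" by (simp add: right_diff_distrib)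
      ultimately have "\<bar>d * (z $ Inr s - lin x u s)\<bar> \<le> d - d * r" by linarith
      then show ?thesis using key[OF u2 u3, of s] by linarith
    qed
    ultimately have "linf_dist_set (\<chi> i. real_of_int (a $ i) / real q) (graph_manifold f x0 e0) \<le> d"
      unfolding dist by (intro exI[of _ "d *\<^sub>R u"]) (use du in simp)
    then show ?thesis by (simp add: d_def)
  qed
  show "rpt \<delta> q a \<in> tube e0 (1 + r)" if prem: "linf_dist_set (\<chi> i. real_of_int (a $ i) / real q) (graph_manifold f x0 e0) \<le> \<delta> / real q"
  proof -
    obtain h where h: "\<And>i. \<bar>h $ i\<bar> \<le> d" "\<And>i. \<bar>x $ i + h $ i - x0 $ i\<bar> \<le> e0" "\<And>s. \<bar>of_int (a $ Inr s) / real q - f s (x + h)\<bar> \<le> d"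
      using prem unfolding d_def[symmetric] dist by blast
    define u where "u = (1 / d) *\<^sub>R h"
    have hu: "h = d *\<^sub>R u" using d0 by (simp add: u_def)
    have u1: "\<bar>u $ i\<bar> \<le> 1" for i using h(1)[of i] d0 by (simp add: u_def)
    have xd: "\<bar>x $ i - x0 $ i\<bar> \<le> (1 + r) * e0" for i
      using h(1)[of i] h(2)[of i] dq big(1) unfolding distrib_right by linarith
    have "(1 + r) * e0 \<le> 2 * e0" using r e0 by (intro mult_right_mono) auto
    then have u2: "\<bar>x $ i - x0 $ i\<bar> \<le> 2 * e0" for i using xd[of i] by linarith
    have "\<bar>z $ Inr s - lin x u s\<bar> \<le> 1 + r" for s
    proof -
      have "\<bar>d * (z $ Inr s - lin x u s)\<bar> \<le> d + d * r" using key[OF u2 u1, of s] h(3)[of s] unfolding hu by linarith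
      moreover have "\<bar>d * (z $ Inr s - lin x u s)\<bar> = d * \<bar>z $ Inr s - lin x u s\<bar>" using d0 by (simp add: abs_mult)
      moreover have "d * (1 + r) = d + d * r" by (simp add: distrib_left)
      ultimately have "d * \<bar>z $ Inr s - lin x u s\<bar> \<le> d * (1 + r)" by linarith
      then show ?thesis using d0 by simp
    qed
    moreover have "\<bar>u $ i\<bar> \<le> 1 + r" for i using u1[of i] r by linarith
    ultimately show ?thesis unfolding tube_def z_def[symmetric] using xd by (auto simp: x_def)
  qed
qed

definition cpairs :: "real \<Rightarrow> real \<Rightarrow> ('n + 'r \<Rightarrow> int) \<Rightarrow> nat \<Rightarrow> ((int ^ ('n + 'r)) \<times> nat) set" where
  "cpairs \<delta> \<eta> k Q = {(a, q). 1 \<le> q \<and> q \<le> Q \<and> rpt \<delta> q a \<in> grid_cube \<eta> k}"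

lemma window_small:
  assumes "cube_ok \<eta> k" "0 < \<delta>" "\<delta> \<le> 1 / 2"
  shows "0 < \<delta> * \<eta> / 2" "\<delta> * \<eta> / 2 < 1 / 2"
proof -
  have \<eta>: "0 < \<eta>" "\<eta> \<le> 1" using assms by (auto simp: cube_ok_def)
  show "0 < \<delta> * \<eta> / 2" using assms \<eta> by simp
  have "\<delta> * \<eta> \<le> 1 / 2 * 1" using assms \<eta> by (intro mult_mono) auto
  then show "\<delta> * \<eta> / 2 < 1 / 2" by simp
qed

lemma cpairs_card:
  assumes "cube_ok \<eta> k" "0 < \<delta>" "\<delta> \<le> 1 / 2"
  shows "finite (cpairs \<delta> \<eta> k Q)" "card (cpairs \<delta> \<eta> k Q) = ccount \<delta> \<eta> k Q"
proof -
  have fin: "finite {a. rpt \<delta> q a \<in> grid_cube \<eta> k}" if "q \<in> {1..Q}" for q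
    using that by (intro rpt_count(1) assms window_small[OF assms]) auto
  have eq: "cpairs \<delta> \<eta> k Q = prod.swap ` (SIGMA q : {1..Q}. {a. rpt \<delta> q a \<in> grid_cube \<eta> k})"
    by (auto simp: cpairs_def image_iff)
  show "finite (cpairs \<delta> \<eta> k Q)" unfolding eq using fin by (intro finite_imageI finite_SigmaI) auto
  show "card (cpairs \<delta> \<eta> k Q) = ccount \<delta> \<eta> k Q"
    unfolding eq ccount_def using fin by (subst card_image) (auto simp: card_SigmaI)
qed

lemma ccount_le_cvol:
  assumes "cube_ok \<eta> k" "0 < \<delta>" "\<delta> \<le> 1 / 2"
  shows "real (ccount \<delta> \<eta> k Q) \<le> (\<Sum>q\<in>{1..Q}. cvol \<eta> k q)"
  unfolding ccount_def of_nat_sum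
proof (rule sum_mono)
  fix q assume q: "q \<in> {1..Q}"
  have "card {a. rpt \<delta> q a \<in> grid_cube \<eta> k} = (\<Sum>t\<in>lbox UNIV (clen \<eta> k q) (\<lambda>_. 0). \<Prod>r\<in>UNIV. card (cwin \<delta> \<eta> k q t r))"
    using q by (intro rpt_count(2) assms window_small[OF assms]) auto
  also have "\<dots> \<le> (\<Sum>t\<in>lbox UNIV (clen \<eta> k q) (\<lambda>_. 0 :: nat). 1)"
  proof (intro sum_mono prod_le_1 conjI)
    fix t r show "card (cwin \<delta> \<eta> k q t r) \<le> 1"
      unfolding cwin_eq[OF assms(2)] by (rule card_int_window(2)) (rule window_small[OF assms])+
  qed auto
  finally show "real (card {a. rpt \<delta> q a \<in> grid_cube \<eta> k}) \<le> cvol \<eta> k q" by (simp add: cvol_def)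
qed

lemma tube_count_upper:
  assumes e0: "0 < e0" "e0 \<le> \<rho> / 8" and r: "0 < r" "r \<le> 1"
    and Ks: "finite Ks" "\<And>k. k \<in> Ks \<Longrightarrow> cube_ok \<eta> k" "tube e0 (1 + r) \<subseteq> (\<Union>k\<in>Ks. grid_cube \<eta> k)"
    and q1: "\<And>q. q > q1 \<Longrightarrow> 1 / real q \<le> r * e0 \<and> lipc / real q \<le> r \<and> 1 / real q \<le> \<rho> / 8"
    and \<delta>: "0 < \<delta>" "\<delta> \<le> 1 / 2"
  shows "count_rational (graph_manifold f x0 e0) Q \<delta> \<le> card (rational_points (graph_manifold f x0 e0) q1 (1 / 2)) + (\<Sum>k\<in>Ks. ccount \<delta> \<eta> k Q)"
proof -
  let ?S = "graph_manifold f x0 e0"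
  have "rational_points ?S Q \<delta> \<subseteq> rational_points ?S q1 (1 / 2) \<union> (\<Union>k\<in>Ks. cpairs \<delta> \<eta> k Q)"
  proof
    fix p assume p: "p \<in> rational_points ?S Q \<delta>"
    obtain a q where aq: "p = (a, q)" by (cases p)
    have q: "1 \<le> q" "q \<le> Q" and d: "linf_dist_set (\<chi> i. real_of_int (a $ i) / real q) ?S \<le> \<delta> / real q"
      using p by (auto simp: aq rational_points_def)
    show "p \<in> rational_points ?S q1 (1 / 2) \<union> (\<Union>k\<in>Ks. cpairs \<delta> \<eta> k Q)"
    proof (cases "q \<le> q1")
      case True
      have "\<delta> / real q \<le> 1 / 2 / real q" using \<delta> by (intro divide_right_mono) auto
      then have "linf_dist_set (\<chi> i. real_of_int (a $ i) / real q) ?S \<le> 1 / 2 / real q" using d by linarith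
      then have "p \<in> rational_points ?S q1 (1 / 2)" using q True by (simp add: aq rational_points_def)
      then show ?thesis by blast
    next
      case False
      then have "rpt \<delta> q a \<in> tube e0 (1 + r)"
        using q1[of q] \<delta> q d by (intro rpt_tube(2)[OF e0 _ _ _ r]) auto
      then have "p \<in> (\<Union>k\<in>Ks. cpairs \<delta> \<eta> k Q)" using Ks(3) q by (auto simp: aq cpairs_def)
      then show ?thesis by blast
    qed
  qed
  then have "count_rational ?S Q \<delta> \<le> card (rational_points ?S q1 (1 / 2) \<union> (\<Union>k\<in>Ks. cpairs \<delta> \<eta> k Q))"
    unfolding count_rational_def
    using finite_rational_points[OF graph_compact[OF e0(1)]] Ks(1,2) cpairs_card(1)[OF _ \<delta>] by (intro card_mono) auto
  also have "\<dots> \<le> card (rational_points ?S q1 (1 / 2)) + card (\<Union>k\<in>Ks. cpairs \<delta> \<eta> k Q)" by (rule card_Un_le)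
  also have "card (\<Union>k\<in>Ks. cpairs \<delta> \<eta> k Q) \<le> (\<Sum>k\<in>Ks. card (cpairs \<delta> \<eta> k Q))" by (rule card_UN_le[OF Ks(1)])
  also have "\<dots> = (\<Sum>k\<in>Ks. ccount \<delta> \<eta> k Q)" using Ks(2) cpairs_card(2)[OF _ \<delta>] by (intro sum.cong) auto
  finally show ?thesis by simp
qed

text \<open>Disjointness of the cubes excludes double counting. The pairs with q \<le> q1 are
  bounded by the number of horizontal points, again independently of \<open>Q\<close> and
  \<delta>.\<close>

lemma tube_count_lower:
  assumes e0: "0 < e0" "e0 \<le> \<rho> / 8" and r: "0 < r" "r \<le> 1" and \<eta>: "\<eta> > 0"
    and Ks: "finite Ks" "\<And>k. k \<in> Ks \<Longrightarrow> cube_ok \<eta> k" "(\<Union>k\<in>Ks. grid_cube \<eta> k) \<subseteq> tube e0 (1 - r)"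
    and q1: "\<And>q. q > q1 \<Longrightarrow> 1 / real q \<le> r * e0 \<and> lipc / real q \<le> r \<and> 1 / real q \<le> \<rho> / 8"
    and \<delta>: "0 < \<delta>" "\<delta> \<le> 1 / 2"
  shows "(\<Sum>k\<in>Ks. real (ccount \<delta> \<eta> k Q)) \<le> (\<Sum>k\<in>Ks. \<Sum>q\<in>{1..q1}. cvol \<eta> k q) + real (count_rational (graph_manifold f x0 e0) Q \<delta>)"
proof -
  let ?S = "graph_manifold f x0 e0"
  have fin: "finite (cpairs \<delta> \<eta> k Q')" if "k \<in> Ks" for k Q' using cpairs_card(1)[OF Ks(2)[OF that] \<delta>] .
  have "(\<Sum>k\<in>Ks. ccount \<delta> \<eta> k Q) = (\<Sum>k\<in>Ks. card (cpairs \<delta> \<eta> k Q))"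
    using Ks(2) cpairs_card(2)[OF _ \<delta>] by (intro sum.cong) auto
  also have "\<dots> = card (\<Union>k\<in>Ks. cpairs \<delta> \<eta> k Q)"
  proof (rule card_UN_disjoint[symmetric])
    show "\<forall>k\<in>Ks. \<forall>k'\<in>Ks. k \<noteq> k' \<longrightarrow> cpairs \<delta> \<eta> k Q \<inter> cpairs \<delta> \<eta> k' Q = {}"
      unfolding cpairs_def using grid_cube_unique[OF _ _ \<eta>] by blast
  qed (use Ks(1) fin in auto)
  also have "\<dots> \<le> card ((\<Union>k\<in>Ks. cpairs \<delta> \<eta> k q1) \<union> rational_points ?S Q \<delta>)"
  proof (rule card_mono)
    show "finite ((\<Union>k\<in>Ks. cpairs \<delta> \<eta> k q1) \<union> rational_points ?S Q \<delta>)"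
      using finite_rational_points[OF graph_compact[OF e0(1)]] Ks(1) fin by auto
    show "(\<Union>k\<in>Ks. cpairs \<delta> \<eta> k Q) \<subseteq> (\<Union>k\<in>Ks. cpairs \<delta> \<eta> k q1) \<union> rational_points ?S Q \<delta>"
    proof
      fix p assume "p \<in> (\<Union>k\<in>Ks. cpairs \<delta> \<eta> k Q)"
      then obtain k a q where k: "k \<in> Ks" and aq: "p = (a, q)" "1 \<le> q" "q \<le> Q" "rpt \<delta> q a \<in> grid_cube \<eta> k"
        by (auto simp: cpairs_def)
      show "p \<in> (\<Union>k\<in>Ks. cpairs \<delta> \<eta> k q1) \<union> rational_points ?S Q \<delta>"
      proof (cases "q \<le> q1")
        case True
        then show ?thesis using k aq by (auto simp: cpairs_def)
      next
        case False
        have "rpt \<delta> q a \<in> tube e0 (1 - r)" using Ks(3) k aq(4) by blast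
        then have "linf_dist_set (\<chi> i. real_of_int (a $ i) / real q) ?S \<le> \<delta> / real q"
          using q1[of q] False \<delta> aq by (intro rpt_tube(1)[OF e0 _ _ _ r]) auto
        then show ?thesis using aq by (simp add: rational_points_def)
      qed
    qed
  qed
  also have "\<dots> \<le> card (\<Union>k\<in>Ks. cpairs \<delta> \<eta> k q1) + count_rational ?S Q \<delta>"
    unfolding count_rational_def by (rule card_Un_le)
  also have "card (\<Union>k\<in>Ks. cpairs \<delta> \<eta> k q1) \<le> (\<Sum>k\<in>Ks. card (cpairs \<delta> \<eta> k q1))" by (rule card_UN_le[OF Ks(1)])
  also have "\<dots> = (\<Sum>k\<in>Ks. ccount \<delta> \<eta> k q1)" using Ks(2) cpairs_card(2)[OF _ \<delta>] by (intro sum.cong) auto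
  finally have "(\<Sum>k\<in>Ks. ccount \<delta> \<eta> k Q) \<le> (\<Sum>k\<in>Ks. ccount \<delta> \<eta> k q1) + count_rational ?S Q \<delta>" by simp
  then have "real (\<Sum>k\<in>Ks. ccount \<delta> \<eta> k Q) \<le> real ((\<Sum>k\<in>Ks. ccount \<delta> \<eta> k q1) + count_rational ?S Q \<delta>)" by (simp only: of_nat_le_iff)
  then have "(\<Sum>k\<in>Ks. real (ccount \<delta> \<eta> k Q)) \<le> (\<Sum>k\<in>Ks. real (ccount \<delta> \<eta> k q1)) + real (count_rational ?S Q \<delta>)" by simp
  also have "(\<Sum>k\<in>Ks. real (ccount \<delta> \<eta> k q1)) \<le> (\<Sum>k\<in>Ks. \<Sum>q\<in>{1..q1}. cvol \<eta> k q)"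
    using Ks(2) ccount_le_cvol[OF _ \<delta>] by (intro sum_mono) auto
  finally show ?thesis by simp
qed

end

section \<open>Passage to volumes and the asymptotic formula\<close>

context curved_graph
begin

text \<open>Since crit R \<le> (n-1)/2, the normaliser is at least \<open>Q\<close> in the whole
  range of \<delta>; hence bounded contributions vanish after division, uniformly in
  \<delta>.\<close>

lemma scale_power_ge:
  assumes "Q > 0" "real Q powr (- crit + \<epsilon>) \<le> \<delta>" "0 < \<epsilon>"
  shows "real Q \<le> \<delta> ^ CARD('r) * real Q ^ (CARD('n) + 1)"
proof -
  define x where "x = real Q"
  have x1: "x \<ge> 1" using assms(1) by (simp add: x_def)
  have n: "real CARD('n) \<ge> 3" using n3 by simp
  have R: "real CARD('r) \<ge> 1" by (simp add: Suc_le_eq)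
  have "crit * real CARD('r) \<le> (real CARD('n) - 1) / 2"
  proof -
    have "crit * ((real CARD('n) - 1) / 2) \<ge> 0" using crit_bounds n by simp
    then show ?thesis using crit_bounds(3) unfolding distrib_left by linarith
  qed
  then have e: "1 \<le> - crit * real CARD('r) + (real CARD('n) + 1)" using n by (simp add: field_simps)
  have xpos: "x > 0" using x1 by simp
  have "x powr 1 \<le> x powr (- crit * real CARD('r) + (real CARD('n) + 1))" by (rule powr_mono[OF e x1])
  also have "\<dots> = (x powr (- crit)) ^ CARD('r) * x ^ (CARD('n) + 1)"
  proof -
    have "(x powr (- crit)) ^ CARD('r) = x powr (- crit * real CARD('r))" using xpos by (simp add: powr_realpow[symmetric] powr_powr)
    moreover have "x ^ (CARD('n) + 1) = x powr (real CARD('n) + 1)"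
      by (simp only: powr_realpow[OF xpos, of "CARD('n) + 1", symmetric] of_nat_add of_nat_1)
    ultimately show ?thesis by (simp only: powr_add)
  qed
  also have "\<dots> \<le> \<delta> ^ CARD('r) * x ^ (CARD('n) + 1)"
  proof (intro mult_right_mono power_mono)
    have "x powr (- crit) \<le> x powr (- crit + \<epsilon>)" using x1 assms(3) by (intro powr_mono) auto
    then show "x powr (- crit) \<le> \<delta>" using assms(2) by (simp add: x_def)
  qed (use x1 in auto)
  finally show ?thesis using xpos by (simp add: x_def)
qed

lemma sum_ccount_asymp:
  assumes Ks: "finite Ks" "\<forall>k\<in>Ks. cube_ok \<eta> k" and \<epsilon>: "0 < \<epsilon>" "\<epsilon> < crit" and \<sigma>: "\<sigma> > 0"
  shows "\<forall>\<^sub>F Q in sequentially. \<forall>\<delta>. real Q powr (- crit + \<epsilon>) \<le> \<delta> \<and> \<delta> \<le> 1 / 2 \<longrightarrow>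
     \<bar>(\<Sum>k\<in>Ks. real (ccount \<delta> \<eta> k Q)) / (\<delta> ^ CARD('r) * real Q ^ (CARD('n) + 1)) - real (card Ks) * \<eta> ^ CARD('n + 'r) / real (CARD('n) + 1)\<bar> \<le> \<sigma>"
proof -
  define e where "e = \<sigma> / (real (card Ks) + 1)"
  have e0: "e > 0" unfolding e_def using \<sigma> by (simp add: add_nonneg_pos)
  have "\<forall>\<^sub>F Q in sequentially. \<forall>k\<in>Ks. \<forall>\<delta>. real Q powr (- crit + \<epsilon>) \<le> \<delta> \<and> \<delta> \<le> 1 / 2 \<longrightarrow>
     \<bar>real (ccount \<delta> \<eta> k Q) / (\<delta> ^ CARD('r) * real Q ^ (CARD('n) + 1)) - \<eta> ^ CARD('r) * (\<eta> ^ CARD('n) / real (CARD('n) + 1))\<bar> < e"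
    using Ks cube_equidistribution[OF _ \<epsilon> e0] by (intro eventually_ball_finite) auto
  then show ?thesis
  proof eventually_elim
    case (elim Q)
    show ?case
    proof (intro allI impI)
      fix \<delta> assume \<delta>: "real Q powr (- crit + \<epsilon>) \<le> \<delta> \<and> \<delta> \<le> 1 / 2"
      let ?X = "\<delta> ^ CARD('r) * real Q ^ (CARD('n) + 1)"
      let ?v = "\<eta> ^ CARD('r) * (\<eta> ^ CARD('n) / real (CARD('n) + 1))"
      have v: "?v = \<eta> ^ CARD('n + 'r) / real (CARD('n) + 1)" by (simp add: power_add)
      have "(\<Sum>k\<in>Ks. real (ccount \<delta> \<eta> k Q)) / ?X - real (card Ks) * \<eta> ^ CARD('n + 'r) / real (CARD('n) + 1)
        = (\<Sum>k\<in>Ks. real (ccount \<delta> \<eta> k Q) / ?X - ?v)"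
        unfolding v by (simp add: sum_subtractf sum_divide_distrib)
      also have "\<bar>\<dots>\<bar> \<le> (\<Sum>k\<in>Ks. e)"
        by (rule order.trans[OF sum_abs], rule sum_mono) (use elim \<delta> in \<open>auto intro: less_imp_le\<close>)
      also have "\<dots> \<le> \<sigma>"
      proof -
        have "real (card Ks) * \<sigma> \<le> \<sigma> * (real (card Ks) + 1)" using \<sigma> by (simp add: algebra_simps)
        then show ?thesis unfolding e_def by (simp add: pos_divide_le_eq add_nonneg_pos)
      qed
      finally show "\<bar>(\<Sum>k\<in>Ks. real (ccount \<delta> \<eta> k Q)) / ?X - real (card Ks) * \<eta> ^ CARD('n + 'r) / real (CARD('n) + 1)\<bar> \<le> \<sigma>" .
    qed
  qed
qed

theorem count_rational_asymp:
  assumes e0: "0 < e0" "e0 \<le> \<rho> / 8" "16 * lipc * e0 \<le> 1"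
    and \<epsilon>: "0 < \<epsilon>" "\<epsilon> < crit" and \<eta>': "\<eta>' > 0"
  defines "c \<equiv> measure lebesgue (tube e0 1) / real (CARD('n) + 1)"
  shows "\<forall>\<^sub>F Q in sequentially. \<forall>\<delta>. real Q powr (- crit + \<epsilon>) \<le> \<delta> \<and> \<delta> \<le> 1 / 2 \<longrightarrow>
     \<bar>real (count_rational (graph_manifold f x0 e0) Q \<delta>) / (c * \<delta> ^ CARD('r) * real Q ^ (CARD('n) + 1)) - 1\<bar> < \<eta>'"
proof -
  define d where "d = CARD('n + 'r)"
  define \<mu> where "\<mu> t = measure lebesgue (tube e0 t)" for t
  have \<mu>0: "\<mu> 1 > 0" unfolding \<mu>_def by (rule tube_measure_pos[OF e0(1)])
  have c0: "c > 0" unfolding c_def \<mu>_def[symmetric] using \<mu>0 by simp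
  have c\<mu>: "\<mu> 1 / real (CARD('n) + 1) = c" by (simp add: c_def \<mu>_def)
  \<comment> \<open>The dilation from 1 - 2r to 1 + 2r has ratio 1 + 8 (2r) = 1 + 16 r;
    \<open>r\<close> is fixed so that the volume ratio loses at most half of \<eta>'.\<close>
  have "((\<lambda>r. (1 + 16 * r) ^ d) \<longlongrightarrow> (1 + 16 * 0) ^ d) (at_right (0::real))" by (intro tendsto_intros)
  then have "\<forall>\<^sub>F r in at_right (0::real). (1 + 16 * r) ^ d < 1 + \<eta>' / 2"
    by (rule order_tendstoD(2)) (use \<eta>' in simp)
  moreover have "\<forall>\<^sub>F r in at_right (0::real). 0 < r \<and> r < 1 / 4"
    by (auto intro: eventually_at_right_less eventually_conj eventually_at_rightI[of 0 "1/4"])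
  ultimately have "\<forall>\<^sub>F r in at_right (0::real). 0 < r \<and> r < 1 / 4 \<and> (1 + 16 * r) ^ d < 1 + \<eta>' / 2"
    by eventually_elim auto
  then have "\<exists>r::real. 0 < r \<and> r < 1 / 4 \<and> (1 + 16 * r) ^ d < 1 + \<eta>' / 2"
    by (rule eventually_happens'[OF trivial_limit_at_right_real])
  then obtain r :: real where r: "0 < r" "r < 1 / 4" and rd: "(1 + 16 * r) ^ d < 1 + \<eta>' / 2" by blast
  define A where "A = (1 + 16 * r) ^ d"
  have A1: "A \<ge> 1" unfolding A_def using r by (intro one_le_power) auto
  have scale: "\<mu> (1 + 2 * r) \<le> A * \<mu> (1 - 2 * r)"
    using tube_measure_scale[OF e0, of "2 * r"] r by (simp add: \<mu>_def A_def d_def)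
  have mono: "\<mu> t \<le> \<mu> t'" if "t \<le> t'" for t t'
    unfolding \<mu>_def using tube_mono[OF that e0(1)] tube_lmeasurable by (intro measure_mono_fmeasurable) (auto dest: fmeasurableD)
  have up: "\<mu> (1 + 2 * r) \<le> A * \<mu> 1"
  proof -
    have "A * \<mu> (1 - 2 * r) \<le> A * \<mu> 1" using A1 r by (intro mult_left_mono mono) auto
    then show ?thesis using scale by linarith
  qed
  have lo: "\<mu> 1 \<le> A * \<mu> (1 - 2 * r)"
    using scale mono[of 1 "1 + 2 * r"] r by simp
  \<comment> \<open>The outer cubes cover the tube 1 + r of \<open>rpt_tube\<close> and stay within
    1 + 2r; the inner ones cover 1 - 2r and stay within 1 - r.\<close>
  obtain \<eta>1 Ks1 where K1: "0 < \<eta>1" "finite Ks1" "\<And>k. k \<in> Ks1 \<Longrightarrow> cube_ok \<eta>1 k"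
    "tube e0 (1 + r) \<subseteq> (\<Union>k\<in>Ks1. grid_cube \<eta>1 k)" "(\<Union>k\<in>Ks1. grid_cube \<eta>1 k) \<subseteq> tube e0 (1 + 2 * r)"
    "measure lebesgue (tube e0 (1 + r)) \<le> real (card Ks1) * \<eta>1 ^ CARD('n + 'r)"
    "real (card Ks1) * \<eta>1 ^ CARD('n + 'r) \<le> measure lebesgue (tube e0 (1 + 2 * r))"
    using tube_grid[of "1 + r" "1 + 2 * r", OF _ _ _ e0(1,2)] r by auto
  obtain \<eta>2 Ks2 where K2: "0 < \<eta>2" "finite Ks2" "\<And>k. k \<in> Ks2 \<Longrightarrow> cube_ok \<eta>2 k"
    "tube e0 (1 - 2 * r) \<subseteq> (\<Union>k\<in>Ks2. grid_cube \<eta>2 k)" "(\<Union>k\<in>Ks2. grid_cube \<eta>2 k) \<subseteq> tube e0 (1 - r)"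
    "measure lebesgue (tube e0 (1 - 2 * r)) \<le> real (card Ks2) * \<eta>2 ^ CARD('n + 'r)"
    "real (card Ks2) * \<eta>2 ^ CARD('n + 'r) \<le> measure lebesgue (tube e0 (1 - r))"
    using tube_grid[of "1 - 2 * r" "1 - r", OF _ _ _ e0(1,2)] r by auto
  have lim: "(\<lambda>q. 1 / real q) \<longlonglongrightarrow> 0" "(\<lambda>q. lipc / real q) \<longlonglongrightarrow> 0" by real_asymp+
  have "\<forall>\<^sub>F q in sequentially. 1 / real q < r * e0" by (rule order_tendstoD(2)[OF lim(1)]) (use r e0 in simp)
  moreover have "\<forall>\<^sub>F q in sequentially. lipc / real q < r" by (rule order_tendstoD(2)[OF lim(2)]) (use r in simp)
  moreover have "\<forall>\<^sub>F q in sequentially. 1 / real q < \<rho> / 8" by (rule order_tendstoD(2)[OF lim(1)]) (use rho in simp)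
  ultimately have "\<forall>\<^sub>F q in sequentially. 1 / real q \<le> r * e0 \<and> lipc / real q \<le> r \<and> 1 / real q \<le> \<rho> / 8"
    by eventually_elim auto
  then obtain q1 where q1: "\<And>q. q > q1 \<Longrightarrow> 1 / real q \<le> r * e0 \<and> lipc / real q \<le> r \<and> 1 / real q \<le> \<rho> / 8"
    unfolding eventually_sequentially by (meson less_imp_le)
  have K1ok: "\<forall>k\<in>Ks1. cube_ok \<eta>1 k" and K2ok: "\<forall>k\<in>Ks2. cube_ok \<eta>2 k" using K1(3) K2(3) by blast+
  define C1 where "C1 = real (card (rational_points (graph_manifold f x0 e0) q1 (1 / 2)))"
  define C2 where "C2 = (\<Sum>k\<in>Ks2. \<Sum>q\<in>{1..q1}. cvol \<eta>2 k q)"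
  have C12: "C1 \<ge> 0" "C2 \<ge> 0" unfolding C1_def C2_def cvol_def by (auto intro!: sum_nonneg)
  \<comment> \<open>Two errors of size \<sigma>, one from equidistribution and one from small
    denominators, together take a quarter of c \<eta>', within the half that the volumes leave
    over.\<close>
  define \<sigma> where "\<sigma> = c * \<eta>' / 8"
  have \<sigma>0: "\<sigma> > 0" using c0 \<eta>' by (simp add: \<sigma>_def)
  have "(\<lambda>Q. C1 / real Q) \<longlonglongrightarrow> 0" "(\<lambda>Q. C2 / real Q) \<longlonglongrightarrow> 0" by real_asymp+
  then have ev: "\<forall>\<^sub>F Q in sequentially. C1 / real Q < \<sigma>" "\<forall>\<^sub>F Q in sequentially. C2 / real Q < \<sigma>"
    using \<sigma>0 by (auto intro!: order_tendstoD)
  show ?thesis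
    using ev sum_ccount_asymp[OF K1(2) K1ok \<epsilon> \<sigma>0] sum_ccount_asymp[OF K2(2) K2ok \<epsilon> \<sigma>0] eventually_gt_at_top[of "0::nat"]
  proof eventually_elim
    case (elim Q)
    show ?case
    proof (intro allI impI)
      fix \<delta> assume \<delta>: "real Q powr (- crit + \<epsilon>) \<le> \<delta> \<and> \<delta> \<le> 1 / 2"
      define X where "X = \<delta> ^ CARD('r) * real Q ^ (CARD('n) + 1)"
      define N where "N = real (count_rational (graph_manifold f x0 e0) Q \<delta>)"
      have QX: "real Q \<le> X" unfolding X_def using scale_power_ge[of Q \<epsilon> \<delta>] elim(5) \<delta> \<epsilon> by blast
      have X0: "X > 0" using QX elim(5) by linarith
      have "real Q powr (- crit + \<epsilon>) > 0" using elim(5) by simp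
      then have \<delta>0: "\<delta> > 0" "\<delta> \<le> 1 / 2" using \<delta> by linarith+
      have CX: "C1 / X \<le> C1 / real Q" "C2 / X \<le> C2 / real Q" using QX elim(5) C12 X0 by (auto intro!: divide_left_mono)
      have s1: "\<bar>(\<Sum>k\<in>Ks1. real (ccount \<delta> \<eta>1 k Q)) / X - real (card Ks1) * \<eta>1 ^ CARD('n + 'r) / real (CARD('n) + 1)\<bar> \<le> \<sigma>"
        using elim(3) \<delta> unfolding X_def by blast
      have s2: "\<bar>(\<Sum>k\<in>Ks2. real (ccount \<delta> \<eta>2 k Q)) / X - real (card Ks2) * \<eta>2 ^ CARD('n + 'r) / real (CARD('n) + 1)\<bar> \<le> \<sigma>"
        using elim(4) \<delta> unfolding X_def by blast
      have upper: "N / X \<le> A * c + 2 * \<sigma>"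
      proof -
        have "count_rational (graph_manifold f x0 e0) Q \<delta> \<le> card (rational_points (graph_manifold f x0 e0) q1 (1 / 2)) + (\<Sum>k\<in>Ks1. ccount \<delta> \<eta>1 k Q)"
          by (rule tube_count_upper[OF e0(1,2) r(1) _ K1(2,3,4) q1 \<delta>0]) (use r in auto)
        then have "N \<le> C1 + (\<Sum>k\<in>Ks1. real (ccount \<delta> \<eta>1 k Q))"
          unfolding N_def C1_def of_nat_sum[symmetric] of_nat_add[symmetric] of_nat_le_iff .
        then have "N / X \<le> C1 / X + (\<Sum>k\<in>Ks1. real (ccount \<delta> \<eta>1 k Q)) / X"
          unfolding add_divide_distrib[symmetric] using X0 by (intro divide_right_mono) auto
        moreover have "real (card Ks1) * \<eta>1 ^ CARD('n + 'r) / real (CARD('n) + 1) \<le> A * \<mu> 1 / real (CARD('n) + 1)"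
          using K1(7) up unfolding \<mu>_def by (intro divide_right_mono) auto
        ultimately show ?thesis using s1 CX(1) elim(1) unfolding times_divide_eq_right[symmetric, of A] c\<mu> by linarith
      qed
      have lower: "N / X \<ge> c / A - 2 * \<sigma>"
      proof -
        have "(\<Sum>k\<in>Ks2. real (ccount \<delta> \<eta>2 k Q)) \<le> C2 + N"
          unfolding C2_def N_def by (rule tube_count_lower[OF e0(1,2) r(1) _ K2(1,2,3,5) q1 \<delta>0]) (use r in auto)
        then have "(\<Sum>k\<in>Ks2. real (ccount \<delta> \<eta>2 k Q)) / X \<le> C2 / X + N / X"
          unfolding add_divide_distrib[symmetric] using X0 by (intro divide_right_mono) auto
        moreover have "c / A \<le> real (card Ks2) * \<eta>2 ^ CARD('n + 'r) / real (CARD('n) + 1)"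
        proof -
          have "\<mu> 1 / A \<le> \<mu> (1 - 2 * r)" using lo A1 by (simp add: pos_divide_le_eq mult.commute)
          then have "\<mu> 1 / A \<le> real (card Ks2) * \<eta>2 ^ CARD('n + 'r)" using K2(6) unfolding \<mu>_def by linarith
          then have "\<mu> 1 / A / real (CARD('n) + 1) \<le> real (card Ks2) * \<eta>2 ^ CARD('n + 'r) / real (CARD('n) + 1)" by (intro divide_right_mono) auto
          then show ?thesis unfolding c\<mu>[symmetric] by (simp add: mult.commute)
        qed
        ultimately show ?thesis using s2 CX(2) elim(2) by linarith
      qed
      have "N / X < c * (1 + \<eta>')"
      proof -
        have "A * c \<le> (1 + \<eta>' / 2) * c" using rd c0 unfolding A_def by (intro mult_right_mono) auto
        moreover have "(1 + \<eta>' / 2) * c + 2 * \<sigma> < c * (1 + \<eta>')" using c0 \<eta>' by (simp add: \<sigma>_def algebra_simps)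
        ultimately show ?thesis using upper by linarith
      qed
      moreover have "N / X > c * (1 - \<eta>')"
      proof -
        have "1 \<le> (1 + \<eta>' / 2) * (1 / A)" using rd A1 unfolding A_def[symmetric] by (simp add: pos_le_divide_eq)
        moreover have "(\<eta>' / 2) * (1 / A) \<le> (\<eta>' / 2) * 1" using A1 \<eta>' by (intro mult_left_mono) auto
        ultimately have "1 / A \<ge> 1 - \<eta>' / 2" unfolding distrib_right by linarith
        then have "c * (1 / A) \<ge> c * (1 - \<eta>' / 2)" using c0 by (intro mult_left_mono) auto
        moreover have "c * (1 - \<eta>' / 2) - 2 * \<sigma> > c * (1 - \<eta>')" using c0 \<eta>' by (simp add: \<sigma>_def algebra_simps)
        ultimately show ?thesis using lower by simp
      qed
      ultimately have "\<bar>N / X - c\<bar> < c * \<eta>'" unfolding abs_less_iff by (simp add: algebra_simps)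
      moreover have "N / (c * \<delta> ^ CARD('r) * real Q ^ (CARD('n) + 1)) - 1 = (N / X - c) / c"
        using c0 by (simp add: X_def field_simps)
      ultimately have "\<bar>N / (c * \<delta> ^ CARD('r) * real Q ^ (CARD('n) + 1)) - 1\<bar> < \<eta>'"
        using c0 by (simp add: pos_divide_less_eq mult.commute)
      then show "\<bar>real (count_rational (graph_manifold f x0 e0) Q \<delta>) / (c * \<delta> ^ CARD('r) * real Q ^ (CARD('n) + 1)) - 1\<bar> < \<eta>'"
        unfolding N_def .
    qed
  qed
qed

end

section \<open>Uniform nondegeneracy of the Hessians\<close>

text \<open>A symmetric matrix whose kernel is at most one-dimensional is nonsingular, or becomes
  nonsingular after deleting a row and column \<open>i\<close> with \<open>w\<^sub>i \<noteq> 0\<close> for a kernel vector \<open>w\<close>: if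
  \<open>v\<^sub>i = 0\<close> and \<open>A v\<close> is a multiple of the \<open>i\<close>-th unit vector, pairing with \<open>w\<close> shows \<open>A v = 0\<close>.\<close>

lemma symmetric_principal_nonsingular:
  fixes A :: "real ^ 'n::finite ^ 'n"
  assumes sym: "transpose A = A" and rank: "rank A \<ge> CARD('n) - 1"
  shows "\<exists>I. card I \<ge> CARD('n) - 1 \<and> (\<forall>v. (\<forall>i. i \<notin> I \<longrightarrow> v $ i = 0) \<longrightarrow> (\<forall>i\<in>I. (A *v v) $ i = 0) \<longrightarrow> v = 0)"
proof (cases "\<exists>w. w \<noteq> 0 \<and> A *v w = 0")
  case False
  then have "\<forall>v. (\<forall>i. (A *v v) $ i = 0) \<longrightarrow> v = 0" by (metis vec_eq_iff zero_index)
  then show ?thesis by (intro exI[of _ UNIV]) auto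
next
  case True
  then obtain w where w: "w \<noteq> 0" "A *v w = 0" by blast
  then obtain i where wi: "w $ i \<noteq> 0" by (metis vec_eq_iff zero_index)
  have adj: "(A *v x) \<bullet> y = x \<bullet> (A *v y)" for x y
  proof -
    have "A *v x = x v* A" using transpose_matrix_vector[of A x] unfolding sym .
    then show ?thesis by (simp only: dot_lmul_matrix)
  qed
  \<comment> \<open>By symmetry the kernel is orthogonal to the range, whose dimension is at least n
    - 1.\<close>
  have "dim {v. A *v v = 0} \<le> 1"
  proof -
    have "subspace (range ((*v) A))" by (intro linear_subspace_image matrix_vector_mul_linear subspace_UNIV)
    then have "dim {y \<in> UNIV. \<forall>x\<in>range ((*v) A). orthogonal x y} + dim (range ((*v) A)) = dim (UNIV :: (real ^ 'n) set)"
      by (rule dim_subspace_orthogonal_to_vectors) auto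
    moreover have "{v. A *v v = 0} \<subseteq> {y \<in> UNIV. \<forall>x\<in>range ((*v) A). orthogonal x y}"
      by (auto simp: orthogonal_def adj)
    then have "dim {v. A *v v = 0} \<le> dim {y \<in> UNIV. \<forall>x\<in>range ((*v) A). orthogonal x y}" by (rule dim_subset)
    moreover have "dim (UNIV :: (real ^ 'n) set) = CARD('n)" by simp
    ultimately show ?thesis using rank unfolding rank_dim_range by linarith
  qed
  have v0: "v = 0" if v: "\<forall>k. k \<notin> UNIV - {i} \<longrightarrow> v $ k = 0" "\<forall>k\<in>UNIV - {i}. (A *v v) $ k = 0" for v
  proof -
    have "(A *v v) \<bullet> w = 0" using w by (simp add: adj)
    moreover have "(A *v v) \<bullet> w = (A *v v) $ i * w $ i"
      unfolding inner_vec_def using v(2) by (subst sum.remove[of _ i]) auto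
    ultimately have "(A *v v) $ i = 0" using wi by simp
    then have Av: "A *v v = 0" using v(2) by (auto simp: vec_eq_iff)
    show "v = 0"
    proof (rule ccontr)
      assume "v \<noteq> 0"
      have "v \<noteq> w" using v(1) wi by auto
      \<comment> \<open>The \<open>i\<close>-th coordinate tells the two apart: it is 0 for
        \<open>v\<close> and nonzero for \<open>w\<close>.\<close>
      have "independent {v, w}"
      proof
        assume "dependent {v, w}"
        then obtain u x where u: "x \<in> {v, w}" "u x \<noteq> 0" "(\<Sum>y\<in>{v, w}. u y *\<^sub>R y) = 0"
          using dependent_finite[of "{v, w}"] by auto
        have eq: "u v *\<^sub>R v + u w *\<^sub>R w = 0" using u(3) \<open>v \<noteq> w\<close> by simp
        then have "(u v *\<^sub>R v + u w *\<^sub>R w) $ i = 0" by simp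
        then have "u w = 0" using v(1) wi by simp
        then have "u v = 0" using eq \<open>v \<noteq> 0\<close> by simp
        then show False using u(1,2) \<open>u w = 0\<close> by auto
      qed
      then have "card {v, w} \<le> dim {v. A *v v = 0}"
        by (intro independent_card_le_dim) (use Av w in auto)
      then show False using \<open>v \<noteq> w\<close> \<open>dim {v. A *v v = 0} \<le> 1\<close> by simp
    qed
  qed
  have "card (UNIV - {i}) = CARD('n) - 1" by (simp add: card_Diff_singleton)
  then show ?thesis by (intro exI[of _ "UNIV - {i}"] conjI allI impI) (auto intro!: v0)
qed

lemma max_abs_exists: "\<exists>k. \<forall>i. \<bar>(v :: real ^ 'm::finite) $ i\<bar> \<le> \<bar>v $ k\<bar>"
proof -
  have "Max (range (\<lambda>i. \<bar>v $ i\<bar>)) \<in> range (\<lambda>i. \<bar>v $ i\<bar>)" by (intro Max_in) auto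
  then obtain k where "Max (range (\<lambda>i. \<bar>v $ i\<bar>)) = \<bar>v $ k\<bar>" by blast
  moreover have "\<bar>v $ i\<bar> \<le> Max (range (\<lambda>i. \<bar>v $ i\<bar>))" for i by (intro Max_ge) auto
  ultimately show ?thesis by metis
qed

text \<open>The constant is found by compactness: for a sequence of parameters and unit vectors violating
  the bound with constants tending to \<open>0\<close>, a limit point violates nonsingularity.\<close>

lemma uniform_nonsingular:
  fixes B :: "'r::finite \<Rightarrow> 'n::finite \<Rightarrow> 'n \<Rightarrow> real"
  assumes ns: "\<And>t :: real ^ 'r. t \<noteq> 0 \<Longrightarrow> \<exists>I. card I \<ge> m \<and>
     (\<forall>v :: real ^ 'n. (\<forall>i. i \<notin> I \<longrightarrow> v $ i = 0) \<longrightarrow> (\<forall>i\<in>I. (\<Sum>k\<in>UNIV. (\<Sum>r\<in>UNIV. t $ r * B r i k) * v $ k) = 0) \<longrightarrow> v = 0)"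
    and m: "m > 0"
  shows "\<exists>\<kappa>>0. \<forall>t r0. (\<forall>r. \<bar>t r\<bar> \<le> 1) \<longrightarrow> \<bar>t r0\<bar> = 1 \<longrightarrow>
     (\<exists>I. card I \<ge> m \<and> (\<forall>v k. (\<forall>i. i \<notin> I \<longrightarrow> v i = 0) \<longrightarrow>
         (\<exists>i\<in>I. \<kappa> * \<bar>v k\<bar> \<le> \<bar>\<Sum>k'\<in>UNIV. (\<Sum>r\<in>UNIV. t r * B r i k') * v k'\<bar>)))"
proof (rule ccontr)
  define F where "F t v i = (\<Sum>k\<in>UNIV. (\<Sum>r\<in>UNIV. t $ r * B r i k) * v $ k)" for t :: "real ^ 'r" and v :: "real ^ 'n" and i
  define G where "G t v i = \<bar>\<Sum>k'\<in>UNIV. (\<Sum>r\<in>UNIV. t r * B r i k') * v k'\<bar>" for t v i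
  assume "\<not> ?thesis"
  then have "\<not> (\<exists>\<kappa>>0. \<forall>t r0. (\<forall>r. \<bar>t r\<bar> \<le> 1) \<longrightarrow> \<bar>t r0\<bar> = 1 \<longrightarrow> (\<exists>I. card I \<ge> m \<and>
     (\<forall>v k. (\<forall>i. i \<notin> I \<longrightarrow> v i = 0) \<longrightarrow> (\<exists>i\<in>I. \<kappa> * \<bar>v k\<bar> \<le> G t v i))))"
    unfolding G_def .
  then have "\<not> (\<forall>t r0. (\<forall>r. \<bar>t r\<bar> \<le> 1) \<longrightarrow> \<bar>t r0\<bar> = 1 \<longrightarrow> (\<exists>I. card I \<ge> m \<and>
     (\<forall>v k. (\<forall>i. i \<notin> I \<longrightarrow> v i = 0) \<longrightarrow> (\<exists>i\<in>I. \<kappa> * \<bar>v k\<bar> \<le> G t v i))))" if "\<kappa> > 0" for \<kappa>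
    using that by blast
  then have neg: "\<exists>t r0. (\<forall>r. \<bar>t r\<bar> \<le> 1) \<and> \<bar>t r0\<bar> = 1 \<and> (\<forall>I. \<not> (card I \<ge> m \<and>
     (\<forall>v k. (\<forall>i. i \<notin> I \<longrightarrow> v i = 0) \<longrightarrow> (\<exists>i\<in>I. \<kappa> * \<bar>v k\<bar> \<le> G t v i))))" if "\<kappa> > 0" for \<kappa>
    using that unfolding not_all not_imp not_ex .
  \<comment> \<open>\<open>T\<close> and \<open>Y I\<close> are unit spheres of the sup norm, for
    the parameters and for the vectors supported in \<open>I\<close>; both are compact and avoid
    0.\<close>
  define T :: "(real ^ 'r) set" where "T = {t. (\<forall>r. \<bar>t $ r\<bar> \<le> 1) \<and> (\<exists>r0. \<bar>t $ r0\<bar> = 1)}"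
  define Y :: "'n set \<Rightarrow> (real ^ 'n) set" where "Y I = {v. (\<forall>i. i \<notin> I \<longrightarrow> v $ i = 0) \<and> (\<forall>i. \<bar>v $ i\<bar> \<le> 1) \<and> (\<exists>k. \<bar>v $ k\<bar> = 1)}" for I
  have bad: "\<exists>t\<in>T. \<forall>I. card I \<ge> m \<longrightarrow> (\<exists>v\<in>Y I. \<forall>i\<in>I. \<bar>F t v i\<bar> \<le> \<kappa>)" if \<kappa>: "\<kappa> > 0" for \<kappa>
  proof -
    obtain t r0 where t: "\<forall>r. \<bar>t r\<bar> \<le> 1" "\<bar>t r0\<bar> = 1" and
      tn: "\<And>I. \<not> (card I \<ge> m \<and> (\<forall>v k. (\<forall>i. i \<notin> I \<longrightarrow> v i = 0) \<longrightarrow> (\<exists>i\<in>I. \<kappa> * \<bar>v k\<bar> \<le> G t v i)))"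
      using neg[OF \<kappa>] by (elim exE conjE) (rule that; blast)
    have tb: "\<exists>v k. (\<forall>i. i \<notin> I \<longrightarrow> v i = 0) \<and> (\<forall>i\<in>I. G t v i < \<kappa> * \<bar>v k\<bar>)" if "card I \<ge> m" for I
      using tn[of I] that unfolding not_le[symmetric] by blast
    define t' where "t' = (\<chi> r. t r)"
    have "t' \<in> T" using t by (auto simp: T_def t'_def)
    moreover have "\<exists>w\<in>Y I. \<forall>i\<in>I. \<bar>F t' w i\<bar> \<le> \<kappa>" if I: "card I \<ge> m" for I
    proof -
      obtain v k where v: "\<forall>i. i \<notin> I \<longrightarrow> v i = 0" "\<forall>i\<in>I. \<bar>\<Sum>k'\<in>UNIV. (\<Sum>r\<in>UNIV. t r * B r i k') * v k'\<bar> < \<kappa> * \<bar>v k\<bar>"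
        using tb[OF I] unfolding G_def by blast
      \<comment> \<open>Here \<open>m > 0\<close> enters: an index in \<open>I\<close> makes the
        strict inequality force |v k| > 0, so that \<open>v\<close> can be normalised.\<close>
      have "I \<noteq> {}" using I m by auto
      then obtain i0 where "i0 \<in> I" by blast
      then have "0 < \<kappa> * \<bar>v k\<bar>" using v(2) by (meson abs_ge_zero le_less_trans)
      then have vk: "\<bar>v k\<bar> > 0" using \<kappa> by (simp add: zero_less_mult_iff)
      obtain k1 where k1: "\<And>i. \<bar>v i\<bar> \<le> \<bar>v k1\<bar>" using max_abs_exists[of "\<chi> i. v i"] by auto
      have V: "\<bar>v k1\<bar> > 0" using vk k1[of k] by linarith
      define w where "w = (\<chi> i. v i / \<bar>v k1\<bar>)"
      have "w \<in> Y I" unfolding Y_def w_def using v(1) k1 V by (auto intro!: exI[of _ k1])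
      moreover have "\<bar>F t' w i\<bar> \<le> \<kappa>" if i: "i \<in> I" for i
      proof -
        have "F t' w i = (\<Sum>k'\<in>UNIV. (\<Sum>r\<in>UNIV. t r * B r i k') * v k') / \<bar>v k1\<bar>"
          by (simp add: F_def t'_def w_def sum_divide_distrib)
        moreover have "\<bar>\<Sum>k'\<in>UNIV. (\<Sum>r\<in>UNIV. t r * B r i k') * v k'\<bar> \<le> \<kappa> * \<bar>v k1\<bar>"
        proof -
          have "\<kappa> * \<bar>v k\<bar> \<le> \<kappa> * \<bar>v k1\<bar>" using k1[of k] \<kappa> by (intro mult_left_mono) auto
          moreover have "\<bar>\<Sum>k'\<in>UNIV. (\<Sum>r\<in>UNIV. t r * B r i k') * v k'\<bar> < \<kappa> * \<bar>v k\<bar>" using v(2) i by blast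
          ultimately show ?thesis by linarith
        qed
        ultimately show ?thesis using V by (simp add: abs_divide pos_divide_le_eq)
      qed
      ultimately show ?thesis by blast
    qed
    ultimately show ?thesis by blast
  qed
  define \<kappa> where "\<kappa> l = 1 / real (Suc l)" for l
  have \<kappa>0: "\<kappa> l > 0" for l by (simp add: \<kappa>_def)
  obtain t where t: "\<And>l. t l \<in> T" "\<And>l I. card I \<ge> m \<Longrightarrow> \<exists>v\<in>Y I. \<forall>i\<in>I. \<bar>F (t l) v i\<bar> \<le> \<kappa> l"
    using bad[OF \<kappa>0] by metis
  have compT: "compact T"
  proof -
    have "T = cbox (\<chi> r. -1) (\<chi> r. 1) \<inter> (\<Union>r0. {t. \<bar>t $ r0\<bar> = 1})"
      unfolding T_def by (auto simp: mem_box_cart abs_le_iff minus_le_iff)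
    moreover have "closed (\<Union>r0. {t :: real ^ 'r. \<bar>t $ r0\<bar> = 1})"
      by (intro closed_UN ballI closed_Collect_eq continuous_intros) auto
    ultimately show ?thesis by (simp add: compact_Int_closed)
  qed
  have compY: "compact (Y I)" for I
  proof -
    have "Y I = cbox (\<chi> r. -1) (\<chi> r. 1) \<inter> ((\<Union>k. {v. \<bar>v $ k\<bar> = 1}) \<inter> (\<Inter>i\<in>- I. {v. v $ i = 0}))"
      unfolding Y_def by (auto simp: mem_box_cart abs_le_iff minus_le_iff)
    moreover have "closed ((\<Union>k. {v :: real ^ 'n. \<bar>v $ k\<bar> = 1}) \<inter> (\<Inter>i\<in>- I. {v. v $ i = 0}))"
      by (intro closed_Int closed_UN closed_INT ballI closed_Collect_eq continuous_intros) auto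
    ultimately show ?thesis by (simp add: compact_Int_closed)
  qed
  obtain t0 \<phi> where t0: "t0 \<in> T" "strict_mono \<phi>" "(t \<circ> \<phi>) \<longlonglongrightarrow> t0"
    using compT t(1) unfolding compact_def by blast
  have "t0 \<noteq> 0" using t0(1) unfolding T_def by auto
  \<comment> \<open>\<open>I\<close> is taken from the limit parameter. It can be used along the
    whole sequence because the violating vectors exist for every index set of sufficient
    size.\<close>
  from ns[OF this] obtain I where I: "card I \<ge> m" and
    Ins: "\<And>v :: real ^ 'n. (\<forall>i. i \<notin> I \<longrightarrow> v $ i = 0) \<Longrightarrow> (\<forall>i\<in>I. F t0 v i = 0) \<Longrightarrow> v = 0"
    unfolding F_def by blast
  obtain v where v: "\<And>l. v l \<in> Y I" "\<And>l i. i \<in> I \<Longrightarrow> \<bar>F (t l) (v l) i\<bar> \<le> \<kappa> l"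
    using t(2)[OF I] by metis
  obtain v0 \<psi> where v0: "v0 \<in> Y I" "strict_mono \<psi>" "((v \<circ> \<phi>) \<circ> \<psi>) \<longlonglongrightarrow> v0"
    using compY[of I] v(1) unfolding compact_def by (metis comp_apply)
  have tl: "(\<lambda>l. t (\<phi> (\<psi> l))) \<longlonglongrightarrow> t0"
    using LIMSEQ_subseq_LIMSEQ[OF t0(3) v0(2)] by (simp add: o_def)
  have vl: "(\<lambda>l. v (\<phi> (\<psi> l))) \<longlonglongrightarrow> v0" using v0(3) by (simp add: o_def)
  have "F t0 v0 i = 0" if i: "i \<in> I" for i
  proof -
    have "(\<lambda>l. F (t (\<phi> (\<psi> l))) (v (\<phi> (\<psi> l))) i) \<longlonglongrightarrow> F t0 v0 i"
      unfolding F_def by (intro tendsto_intros tendsto_vec_nth tl vl)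
    moreover have "(\<lambda>l. F (t (\<phi> (\<psi> l))) (v (\<phi> (\<psi> l))) i) \<longlonglongrightarrow> 0"
    proof (rule Lim_null_comparison)
      have "strict_mono (\<lambda>l. \<phi> (\<psi> l))" using t0(2) v0(2) by (simp add: strict_mono_def)
      moreover have "\<kappa> \<longlonglongrightarrow> 0" unfolding \<kappa>_def[abs_def] using LIMSEQ_inverse_real_of_nat by (simp add: inverse_eq_divide)
      ultimately show "(\<lambda>l. \<kappa> (\<phi> (\<psi> l))) \<longlonglongrightarrow> 0" using LIMSEQ_subseq_LIMSEQ by (fastforce simp: o_def)
      show "\<forall>\<^sub>F l in sequentially. norm (F (t (\<phi> (\<psi> l))) (v (\<phi> (\<psi> l))) i) \<le> \<kappa> (\<phi> (\<psi> l))"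
        using v(2)[OF i] by simp
    qed
    ultimately show ?thesis by (rule LIMSEQ_unique)
  qed
  then have "v0 = 0" using v0(1) by (intro Ins) (auto simp: Y_def)
  then show False using v0(1) by (simp add: Y_def)
qed

lemma hessian_sum:
  fixes f :: "'r::finite \<Rightarrow> real ^ 'n::finite \<Rightarrow> real"
  assumes "\<And>j. C_k (Suc (Suc 0)) (f j)"
  shows "hessian (\<lambda>x. \<Sum>j\<in>UNIV. t j * f j x) x $ i $ k = (\<Sum>j\<in>UNIV. t j * partial_deriv i (partial_deriv k (f j)) x)"
proof -
  have "partial_deriv k (\<lambda>x. \<Sum>j\<in>UNIV. t j * f j x) = (\<lambda>x. \<Sum>j\<in>UNIV. t j * partial_deriv k (f j) x)"
    by (rule partial_deriv_sum) (rule assms)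
  moreover have "partial_deriv i (\<lambda>x. \<Sum>j\<in>UNIV. t j * partial_deriv k (f j) x) = (\<lambda>x. \<Sum>j\<in>UNIV. t j * partial_deriv i (partial_deriv k (f j)) x)"
    by (rule partial_deriv_sum) (rule C_k_partial[OF assms])
  ultimately show ?thesis by (simp add: hessian_def)
qed

text \<open>The order of the choices matters: \<kappa> comes from the Hessians at \<open>x0\<close>,
  then \<rho> from the continuity of the second derivatives relative to \<kappa>, and last
  \<open>M\<close> as a bound on the closed cube of radius \<rho>.\<close>

lemma curved_graph_exists:
  fixes f :: "'r::finite \<Rightarrow> real ^ 'n::finite \<Rightarrow> real"
  assumes n: "CARD('n) \<ge> 3" and smooth: "\<And>j. C_k CARD('n) (f j)"
    and rank: "\<And>t :: real ^ 'r. t \<noteq> 0 \<Longrightarrow> rank (hessian (\<lambda>x. \<Sum>j\<in>UNIV. t $ j * f j x) x0) \<ge> CARD('n) - 1"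
  shows "\<exists>\<rho> M \<kappa>. curved_graph f x0 \<rho> M \<kappa>"
proof -
  have smooth2: "C_k (Suc (Suc 0)) (f j)" for j by (rule C_k_mono[OF smooth]) (use n in simp)
  define B where "B r i k = partial_deriv i (partial_deriv k (f r)) x0" for r i k
  have ns: "\<exists>I. card I \<ge> CARD('n) - 1 \<and>
     (\<forall>v :: real ^ 'n. (\<forall>i. i \<notin> I \<longrightarrow> v $ i = 0) \<longrightarrow> (\<forall>i\<in>I. (\<Sum>k\<in>UNIV. (\<Sum>r\<in>UNIV. t $ r * B r i k) * v $ k) = 0) \<longrightarrow> v = 0)"
    if t: "t \<noteq> 0" for t :: "real ^ 'r"
  proof -
    define A where "A = hessian (\<lambda>x. \<Sum>j\<in>UNIV. t $ j * f j x) x0"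
    have A: "A $ i $ k = (\<Sum>r\<in>UNIV. t $ r * B r i k)" for i k
      unfolding A_def B_def by (rule hessian_sum[OF smooth2])
    have "B r i k = B r k i" for r i k unfolding B_def by (rule partial_deriv_commute[OF smooth2])
    then have "transpose A = A" by (simp add: transpose_def vec_eq_iff A)
    from symmetric_principal_nonsingular[OF this] rank[OF t] show ?thesis
      unfolding A_def[symmetric] matrix_vector_mult_def by (simp add: A)
  qed
  have pos: "CARD('n) - 1 > 0" using n by simp
  have "\<exists>\<kappa>>0. \<forall>t r0. (\<forall>r. \<bar>t r\<bar> \<le> 1) \<longrightarrow> \<bar>t r0\<bar> = 1 \<longrightarrow>
     (\<exists>I. card I \<ge> CARD('n) - 1 \<and> (\<forall>v k. (\<forall>i. i \<notin> I \<longrightarrow> v i = 0) \<longrightarrow>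
         (\<exists>i\<in>I. \<kappa> * \<bar>v k\<bar> \<le> \<bar>\<Sum>k'\<in>UNIV. (\<Sum>r\<in>UNIV. t r * B r i k') * v k'\<bar>)))"
    by (rule uniform_nonsingular[OF _ pos]) (rule ns)
  then obtain \<kappa> where \<kappa>: "\<kappa> > 0" and
    nd: "\<And>t r0. (\<forall>r. \<bar>t r\<bar> \<le> 1) \<Longrightarrow> \<bar>t r0\<bar> = 1 \<Longrightarrow>
     (\<exists>I. card I \<ge> CARD('n) - 1 \<and> (\<forall>v k. (\<forall>i. i \<notin> I \<longrightarrow> v i = 0) \<longrightarrow>
         (\<exists>i\<in>I. \<kappa> * \<bar>v k\<bar> \<le> \<bar>\<Sum>k'\<in>UNIV. (\<Sum>r\<in>UNIV. t r * B r i k') * v k'\<bar>)))"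
    by (elim exE conjE) (rule that; blast)
  define \<omega> where "\<omega> = \<kappa> / (2 * real CARD('n) * real CARD('r))"
  have \<omega>: "\<omega> > 0" unfolding \<omega>_def using \<kappa> by (simp add: card_gt_0_iff)
  have "\<forall>\<^sub>F y in at x0. \<forall>a\<in>(UNIV :: ('r \<times> 'n \<times> 'n) set).
     dist (partial_deriv (fst (snd a)) (partial_deriv (snd (snd a)) (f (fst a))) y) (B (fst a) (fst (snd a)) (snd (snd a))) < \<omega>"
  proof (intro eventually_ball_finite ballI)
    fix a :: "'r \<times> 'n \<times> 'n"
    have "continuous_on UNIV (partial_deriv (fst (snd a)) (partial_deriv (snd (snd a)) (f (fst a))))"
      using smooth2[of "fst a"] by simp
    then have "isCont (partial_deriv (fst (snd a)) (partial_deriv (snd (snd a)) (f (fst a)))) x0"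
      by (simp add: continuous_on_eq_continuous_at)
    then show "\<forall>\<^sub>F y in at x0. dist (partial_deriv (fst (snd a)) (partial_deriv (snd (snd a)) (f (fst a))) y) (B (fst a) (fst (snd a)) (snd (snd a))) < \<omega>"
      unfolding isCont_def B_def by (rule tendstoD) (rule \<omega>)
  qed simp
  then obtain d where d: "d > 0" "\<And>y a. y \<noteq> x0 \<Longrightarrow> dist y x0 < d \<Longrightarrow>
     dist (partial_deriv (fst (snd a)) (partial_deriv (snd (snd a)) (f (fst a))) y) (B (fst a) (fst (snd a)) (snd (snd a))) < \<omega>"
    unfolding eventually_at by auto
  have osc: "\<bar>partial_deriv i (partial_deriv k (f r)) y - B r i k\<bar> \<le> \<omega>" if "dist y x0 < d" for y i k r
  proof (cases "y = x0")
    case True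
    then show ?thesis using \<omega> by (simp add: B_def)
  next
    case False
    then show ?thesis using d(2)[of y "(r, i, k)"] that by (simp add: dist_real_def)
  qed
  \<comment> \<open>The sup-norm cube of radius \<rho> lies in the Euclidean ball of radius
    \<open>d\<close>, as the Euclidean norm is at most the sum of the n coordinates.\<close>
  define \<rho> where "\<rho> = min 1 (d / (2 * real CARD('n)))"
  have \<rho>: "0 < \<rho>" "\<rho> \<le> 1" unfolding \<rho>_def using d(1) by (auto simp: card_gt_0_iff)
  have near: "dist y x0 < d" if "\<And>i. \<bar>y $ i - x0 $ i\<bar> \<le> \<rho>" for y
  proof -
    have "dist y x0 \<le> (\<Sum>i\<in>UNIV. \<bar>(y - x0) $ i\<bar>)" unfolding dist_norm by (rule norm_le_l1_cart)
    also have "\<dots> \<le> (\<Sum>i\<in>(UNIV::'n set). \<rho>)" using that by (intro sum_mono) auto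
    also have "\<dots> = real CARD('n) * \<rho>" by simp
    also have "\<dots> \<le> real CARD('n) * (d / (2 * real CARD('n)))" unfolding \<rho>_def by (intro mult_left_mono) auto
    also have "\<dots> = d / 2" by simp
    finally show ?thesis using d(1) by simp
  qed
  obtain M where M: "M > 0" "\<And>j ks y. length ks \<le> CARD('n) \<Longrightarrow> y \<in> cbox (\<chi> i. x0 $ i - \<rho>) (\<chi> i. x0 $ i + \<rho>) \<Longrightarrow> \<bar>pders ks (f j) y\<bar> \<le> M"
    using pders_bounded[of "CARD('n)" f, OF smooth compact_cbox] by metis
  have "curved_graph f x0 \<rho> M \<kappa>"
  proof
    show "\<bar>pders ks (f r) y\<bar> \<le> M" if "length ks \<le> CARD('n)" "\<And>i. \<bar>y $ i - x0 $ i\<bar> \<le> \<rho>" for ks y r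
    proof (rule M(2)[OF that(1)])
      have "x0 $ i - \<rho> \<le> y $ i \<and> y $ i \<le> x0 $ i + \<rho>" for i using that(2)[of i] by linarith
      then show "y \<in> cbox (\<chi> i. x0 $ i - \<rho>) (\<chi> i. x0 $ i + \<rho>)" by (simp add: mem_box_cart)
    qed
    show "\<bar>partial_deriv i (partial_deriv k (f r)) y - partial_deriv i (partial_deriv k (f r)) x0\<bar> \<le> \<kappa> / (2 * real CARD('n) * real CARD('r))"
      if "\<And>i. \<bar>y $ i - x0 $ i\<bar> \<le> \<rho>" for y i k r
      using osc[OF near[OF that], of i k r] unfolding B_def \<omega>_def .
    show "\<exists>I. card I \<ge> CARD('n) - 1 \<and> (\<forall>v k. (\<forall>i. i \<notin> I \<longrightarrow> v i = 0) \<longrightarrow>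
         (\<exists>i\<in>I. \<kappa> * \<bar>v k\<bar> \<le> \<bar>\<Sum>k'\<in>UNIV. (\<Sum>r\<in>UNIV. t r * partial_deriv i (partial_deriv k' (f r)) x0) * v k'\<bar>))"
      if "\<And>r. \<bar>t r\<bar> \<le> 1" "\<bar>t r0\<bar> = 1" for t r0
      using nd[of t r0] that unfolding B_def by blast
  qed (use n smooth \<rho> M(1) \<kappa> in auto)
  then show ?thesis by blast
qed

theorem corollary1p5:
  fixes x0 :: "real ^ 'n::finite"
    and f :: "'r::finite \<Rightarrow> real ^ 'n \<Rightarrow> real"
    and l :: nat
  assumes "CARD('n) \<ge> 3"
    and "CARD('r) \<ge> 1"
    and "real l > max (real CARD('n) + 1) (real CARD('n) / 2 + 4)"
    and "\<And>j. C_k l (f j)"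
    and "\<And>t :: real ^ 'r. t \<noteq> 0 \<Longrightarrow>
           rank (hessian (\<lambda>x. \<Sum>j\<in>UNIV. t $ j * f j x) x0) \<ge> CARD('n) - 1"
  shows "\<exists>E>0. \<forall>\<epsilon>0. 0 < \<epsilon>0 \<and> \<epsilon>0 < E \<longrightarrow>
           (\<exists>c>0. \<exists>e0>0. \<forall>\<epsilon>. 0 < \<epsilon> \<and> \<epsilon> < e0 \<longrightarrow>
             (\<forall>\<eta>>0. \<forall>\<^sub>F Q in sequentially. \<forall>\<delta>.
                real Q powr (- ((real CARD('n) - 1) / (real CARD('n) + 2 * real CARD('r) - 1)) + \<epsilon>) \<le> \<delta>
                  \<and> \<delta> \<le> 1 / 2 \<longrightarrow>
                \<bar>real (count_rational (graph_manifold f x0 \<epsilon>0) Q \<delta>)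
                   / (c * \<delta> ^ CARD('r) * real Q ^ (CARD('n) + 1)) - 1\<bar> < \<eta>))"
proof -
  have "real CARD('n) < real l" using assms(3) by simp
  then have "C_k CARD('n) (f j)" for j by (intro C_k_mono[OF assms(4)]) simp
  then obtain \<rho> M \<kappa> where "curved_graph f x0 \<rho> M \<kappa>"
    using curved_graph_exists[OF assms(1) _ assms(5)] by blast
  then interpret curved_graph f x0 \<rho> M \<kappa> .
  \<comment> \<open>\<rho>/8 keeps the tubes up to t = 2, with the displaced base points, inside the
    cube of radius \<rho>; the second bound is the smallness under which a dilation controls the
    boundary of the tube.\<close>
  define E where "E = min (\<rho> / 8) (1 / (16 * lipc))"
  show ?thesis
  proof (rule exI[of _ E], intro conjI allI impI)
    show "E > 0" unfolding E_def using rho lipc_pos by simp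
    fix \<epsilon>0 assume "0 < \<epsilon>0 \<and> \<epsilon>0 < E"
    then have e0: "0 < \<epsilon>0" "\<epsilon>0 \<le> \<rho> / 8" "\<epsilon>0 \<le> 1 / (16 * lipc)" unfolding E_def by auto
    then have e1: "16 * lipc * \<epsilon>0 \<le> 1" using lipc_pos by (simp add: pos_le_divide_eq mult_ac)
    show "\<exists>c>0. \<exists>e0>0. \<forall>\<epsilon>. 0 < \<epsilon> \<and> \<epsilon> < e0 \<longrightarrow>
             (\<forall>\<eta>>0. \<forall>\<^sub>F Q in sequentially. \<forall>\<delta>.
                real Q powr (- ((real CARD('n) - 1) / (real CARD('n) + 2 * real CARD('r) - 1)) + \<epsilon>) \<le> \<delta>
                  \<and> \<delta> \<le> 1 / 2 \<longrightarrow>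
                \<bar>real (count_rational (graph_manifold f x0 \<epsilon>0) Q \<delta>)
                   / (c * \<delta> ^ CARD('r) * real Q ^ (CARD('n) + 1)) - 1\<bar> < \<eta>)"
    proof (rule exI[of _ "measure lebesgue (tube \<epsilon>0 1) / real (CARD('n) + 1)"], rule conjI)
      show "measure lebesgue (tube \<epsilon>0 1) / real (CARD('n) + 1) > 0" using tube_measure_pos[OF e0(1)] by simp
      show "\<exists>e0>0. \<forall>\<epsilon>. 0 < \<epsilon> \<and> \<epsilon> < e0 \<longrightarrow>
             (\<forall>\<eta>>0. \<forall>\<^sub>F Q in sequentially. \<forall>\<delta>.
                real Q powr (- ((real CARD('n) - 1) / (real CARD('n) + 2 * real CARD('r) - 1)) + \<epsilon>) \<le> \<delta>
                  \<and> \<delta> \<le> 1 / 2 \<longrightarrow>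
                \<bar>real (count_rational (graph_manifold f x0 \<epsilon>0) Q \<delta>)
                   / (measure lebesgue (tube \<epsilon>0 1) / real (CARD('n) + 1) * \<delta> ^ CARD('r) * real Q ^ (CARD('n) + 1)) - 1\<bar> < \<eta>)"
        unfolding crit_def[symmetric]
      \<comment> \<open>\<epsilon> < crit keeps the exponent negative, so that the range of \<delta>
        is nonempty for large \<open>Q\<close>.\<close>
      proof (rule exI[of _ crit], intro conjI allI impI)
        show "crit > 0" by (rule crit_bounds)
        fix \<epsilon> \<eta> :: real assume "0 < \<epsilon> \<and> \<epsilon> < crit" "\<eta> > 0"
        then show "\<forall>\<^sub>F Q in sequentially. \<forall>\<delta>. real Q powr (- crit + \<epsilon>) \<le> \<delta> \<and> \<delta> \<le> 1 / 2 \<longrightarrow>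
           \<bar>real (count_rational (graph_manifold f x0 \<epsilon>0) Q \<delta>)
             / (measure lebesgue (tube \<epsilon>0 1) / real (CARD('n) + 1) * \<delta> ^ CARD('r) * real Q ^ (CARD('n) + 1)) - 1\<bar> < \<eta>"
          using count_rational_asymp[OF e0(1,2) e1] by blast
      qed
    qed
  qed
qed

end
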